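(* Let $Y_1,Y_2,\dots$ be independent copies of $Y=(Y_1',Y_2')^{\mathsf T}\in\mathbb R^2$ in the exponential mixed model: $W$ is uniform on $(-\sqrt3,\sqrt3)$ and, given $W=w$, the two elements of $Y$ are conditionally independent, each with density $y_j\mapsto(\psi+\lambda w)\exp\{-y_j(\psi+\lambda w)\}\mathbb I(y_j\ge0)$, with parameter $\theta=(\lambda,\psi)\in\Theta=\{(\lambda,\psi)\in[0,\infty)\times\mathbb R:\psi>\sqrt3\lambda\}$. Then: (a) for any $n\ge1$ there is a set $\mathcal Y^n$ of full measure such that $T_n(\theta;y^n)=s_n(\theta;y^n)^{\mathsf T}\mathcal I_n(\theta)^{-1}s_n(\theta;y^n)$ (defined at non-critical $\theta$) has a continuous extension on $\Theta\times\mathcal Y^n$, and that extension is $T_n(\theta;y^n)=\tilde s_n(\theta;y^n)^{\mathsf T}\tilde{\mathcal I}_n(\theta)^{-1}\tilde s_n(\theta;y^n)$, where $\tilde s_n$ and $\tilde{\mathcal I}_n$ are formed with an admissible choice of orders and eigenvectors (as defined in the context; such a choice exists for every $\theta\in\Theta$ and $n$); (b) with $T_n$ denoting this extension and $\mathcal R_n(\alpha)=\{\theta\in\Theta:T_n(\theta;Y^n)\le q_{2,1-\alpha}\}$, where $q_{2,1-\alpha}$ is the $(1-\alpha)$th quantile of the chi-square distribution with two degrees of freedom, it holds for every $\alpha\in(0,1)$ and every non-empty compact $C\subseteq\Theta$ that $$\lim_{n\to\infty}\inf_{\theta\in C}\mathsf P_\theta\{\theta\in\mathcal R_n(\alpha)\}=1-\alpha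 .$$
   Context: Write $f_\theta$ for the marginal (Lebesgue) density of $Y$, $\ell(\theta;y)=\log f_\theta(y)$, $Y^n=(Y_1,\dots,Y_n)$ with realization $y^n=(y_1,\dots,y_n)$, $\ell_n(\theta;y^n)=\sum_{i=1}^n\ell(\theta;y_i)$, $s(\theta;y)=\nabla\ell(\theta;y)$, $s_n=\nabla\ell_n$ (gradients with respect to $\theta=(\theta_1,\theta_2)=(\lambda,\psi)$), $\nabla_j^l$ for the $l$th order partial derivative with respect to $\theta_j$, and $\mathcal I_n(\theta)=\operatorname{cov}_\theta\{s_n(\theta;Y^n)\}$. A subscript $\theta$ on $\mathsf P,\operatorname{cov}$ means the data have the distribution indexed by $\theta$. At boundary points ($\lambda=0$) derivatives are those of the extension of the log-likelihood to a neighborhood of the point. A point $\theta\in\Theta$ is critical if $\mathcal I_n(\theta)$ is singular and non-critical otherwise. "Almost every" and "full measure" refer to the distribution of the data under any $\theta\in\Theta$ (all have the same null sets). Modified score: given, for $\theta\in\Theta$ and $n$, positive integers $k_1,k_2$ (depending on $\theta,n$) and orthonormal eigenvectors $v^n_{\theta1},v^n_{\theta2}$ of $\mathcal I_n(\theta)$, let $\tilde s_n(\theta;y^n)\in\mathbb R^2$ have $j$th element $\sum_{i=1}^n\{\nabla_j^{k_j-1}s(\theta;y_i)\}^{\mathsf T}v^n_{\theta j}$ and let $\tilde{\mathcal I}_n(\theta)=\operatorname{cov}_\theta\{\tilde s_n(\theta;Y^n)\}$. A choice of orders and eigenvectors is admissible at $(\theta,n)$ if (i) $\tilde{\mathcal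 I}_n(\theta)$ is positive definite; (ii) $\{\nabla_j^ls_n(\tilde\theta;y^n)\}^{\mathsf T}v^n_{\theta j}=0$, $l=0,\dots,k_j-2$, for every $\tilde\theta$ with $\tilde\theta_j=\theta_j$ and almost every $y^n$; and (iii) $k_j\le k(\theta)$ for $j=1,2$, where $k(\theta)\ge2$ is an order (not depending on $n$) such that on some open ball $B\subseteq\mathbb R^2$ centered at $\theta$ the partial derivatives of $\ell(\cdot;y)$ of order $k(\theta)$ exist and are jointly continuous in parameter and $y$ for almost every $y$, and for some $\delta>0$ every partial derivative $D\ell$ of order at most $k(\theta)$ satisfies $\sup_{\theta''\in B\cap\Theta,\tilde\theta\in B}\int|D\ell(\tilde\theta;y)|^{2+\delta}f_{\theta''}(y)\,\mathrm dy<\infty$ (with derivatives extended to $B$ when $B\not\subseteq\Theta$). *)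

theory Defs
  imports "HOL-Probability.Probability"
begin

section \<open>The exponential mixed model\<close>

text \<open>Parameters are vectors in \<open>real^2\<close> with \<open>\<theta>$1 = \<lambda>\<close> and \<open>\<theta>$2 = \<psi>\<close>.\<close>

definition param_space :: "(real^2) set" where
  "param_space = {\<theta>. \<theta>$1 \<ge> 0 \<and> \<theta>$2 > sqrt 3 * \<theta>$1}"

definition mixing_law :: "real measure" where
  "mixing_law = uniform_measure lborel {- sqrt 3<..<sqrt 3}"

text \<open>Conditional density of \<open>Y\<close> given \<open>W = w\<close>; note that
  \<open>exponential_density l x = (if x < 0 then 0 else l * exp (- x * l))\<close>.\<close>

definition cond_density :: "real^2 \<Rightarrow> real \<Rightarrow> real^2 \<Rightarrow> real" where
  "cond_density \<theta> w y = (\<Prod>j\<in>UNIV. exponential_density (\<theta>$2 + \<theta>$1 * w) (y$j))"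

definition joint_law :: "real^2 \<Rightarrow> (real \<times> (real^2)) measure" where
  "joint_law \<theta> = density (mixing_law \<Otimes>\<^sub>M lborel) (\<lambda>(w, y). ennreal (cond_density \<theta> w y))"

definition obs_law :: "real^2 \<Rightarrow> (real^2) measure" where
  "obs_law \<theta> = distr (joint_law \<theta>) borel snd"

text \<open>The formula for the marginal density makes sense on all of \<open>real^2\<close>. On the open cone
  \<open>\<theta>$2 > sqrt 3 * \<bar>\<theta>$1\<bar>\<close>, which contains \<open>param_space\<close>, the rates \<open>\<theta>$2 + \<theta>$1 * w\<close> stay
  positive; this is the extension used for derivatives at boundary points \<open>\<theta>$1 = 0\<close>.\<close>

definition mixed_density :: "real^2 \<Rightarrow> real^2 \<Rightarrow> real" where
  "mixed_density \<theta> y = (\<integral>w. cond_density \<theta> w y \<partial>mixing_law)"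

definition sample_law :: "nat \<Rightarrow> real^2 \<Rightarrow> (nat \<Rightarrow> real^2) measure" where
  "sample_law n \<theta> = (\<Pi>\<^sub>M i\<in>{..<n}. obs_law \<theta>)"

definition full_measure :: "nat \<Rightarrow> (nat \<Rightarrow> real^2) set \<Rightarrow> bool" where
  "full_measure n A \<longleftrightarrow> (\<forall>\<theta>\<in>param_space. A \<in> sets (sample_law n \<theta>) \<and> measure (sample_law n \<theta>) A = 1)"

subsection \<open>\<open>mixed_density\<close> is the Lebesgue density of \<open>obs_law\<close>\<close>

lemma prob_space_mixing_law: "prob_space mixing_law"
  unfolding mixing_law_def by (rule prob_space_uniform_measure) auto

lemma sets_mixing_law [simp, measurable_cong]: "sets mixing_law = sets borel"
  by (simp add: mixing_law_def)

lemma space_mixing_law [simp]: "space mixing_law = UNIV"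
  by (simp add: mixing_law_def)

lemma AE_mixing_law: "AE w in mixing_law. \<bar>w\<bar> < sqrt 3"
  unfolding mixing_law_def by (rule AE_uniform_measureI) auto

lemma rate_bounds:
  assumes "\<theta> \<in> param_space" "\<bar>w\<bar> < sqrt 3"
  shows "0 < \<theta>$2 + \<theta>$1 * w" "\<theta>$2 + \<theta>$1 * w \<le> 2 * \<theta>$2"
proof -
  have "\<bar>\<theta>$1 * w\<bar> \<le> \<theta>$1 * sqrt 3"
    using assms by (auto simp: param_space_def abs_mult intro!: mult_mono)
  then show "0 < \<theta>$2 + \<theta>$1 * w" "\<theta>$2 + \<theta>$1 * w \<le> 2 * \<theta>$2"
    using assms by (auto simp: param_space_def mult.commute)
qed

lemma measurable_vec_nth [measurable]: "(\<lambda>y::real^2. y $ j) \<in> borel_measurable borel"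
  by (intro borel_measurable_continuous_onI continuous_intros)

lemma measurable_exponential_density [measurable]:
  "(\<lambda>(l, x). exponential_density l x) \<in> borel_measurable (borel \<Otimes>\<^sub>M borel)"
  unfolding exponential_density_def by measurable

lemma measurable_cond_density [measurable]:
  "(\<lambda>(w, y). cond_density \<theta> w y) \<in> borel_measurable (borel \<Otimes>\<^sub>M borel)"
proof -
  have "(\<lambda>p::real \<times> (real^2). exponential_density (\<theta>$2 + \<theta>$1 * fst p) (snd p $ j))
      \<in> borel_measurable (borel \<Otimes>\<^sub>M borel)" for j
  proof -
    have "(\<lambda>p::real \<times> (real^2). snd p $ j) \<in> borel_measurable (borel \<Otimes>\<^sub>M borel)"
      by (rule measurable_compose[OF measurable_snd measurable_vec_nth])
    moreover have "(\<lambda>p::real \<times> (real^2). \<theta>$2 + \<theta>$1 * fst p) \<in> borel_measurable (borel \<Otimes>\<^sub>M borel)"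
      by (intro borel_measurable_add borel_measurable_times borel_measurable_const measurable_fst)
    ultimately have "(\<lambda>p::real \<times> (real^2). (\<theta>$2 + \<theta>$1 * fst p, snd p $ j))
        \<in> (borel \<Otimes>\<^sub>M borel) \<rightarrow>\<^sub>M (borel \<Otimes>\<^sub>M borel)"
      by (rule measurable_Pair[rotated])
    from measurable_compose[OF this measurable_exponential_density] show ?thesis by simp
  qed
  then show ?thesis
    unfolding cond_density_def case_prod_beta by (intro borel_measurable_prod)
qed

lemma measurable_cond_density_fst [measurable]:
  "(\<lambda>w. cond_density \<theta> w y) \<in> borel_measurable borel"
  unfolding cond_density_def exponential_density_def by measurable

lemma cond_density_bounds:
  assumes "\<theta> \<in> param_space" "\<bar>w\<bar> < sqrt 3"
  shows "0 \<le> cond_density \<theta> w y" "cond_density \<theta> w y \<le> (2 * \<theta>$2)\<^sup>2"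
proof -
  have *: "0 \<le> exponential_density (\<theta>$2 + \<theta>$1 * w) x"
    "exponential_density (\<theta>$2 + \<theta>$1 * w) x \<le> 2 * \<theta>$2" for x
  proof -
    note r = rate_bounds[OF assms]
    show "0 \<le> exponential_density (\<theta>$2 + \<theta>$1 * w) x"
      using r by (auto simp: exponential_density_def)
    have "(\<theta>$2 + \<theta>$1 * w) * exp (- x * (\<theta>$2 + \<theta>$1 * w)) \<le> (2 * \<theta>$2) * 1" if "x \<ge> 0"
      using r that by (intro mult_mono) auto
    then show "exponential_density (\<theta>$2 + \<theta>$1 * w) x \<le> 2 * \<theta>$2"
      using r by (auto simp: exponential_density_def)
  qed
  show "0 \<le> cond_density \<theta> w y"
    unfolding cond_density_def by (intro prod_nonneg) (use * in auto)
  have "cond_density \<theta> w y \<le> (\<Prod>j\<in>(UNIV::2 set). 2 * \<theta>$2)"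
    unfolding cond_density_def by (intro prod_mono) (use * in auto)
  then show "cond_density \<theta> w y \<le> (2 * \<theta>$2)\<^sup>2"
    by simp
qed

lemma nn_integral_cond_density:
  assumes "\<theta> \<in> param_space"
  shows "(\<integral>\<^sup>+w. ennreal (cond_density \<theta> w y) \<partial>mixing_law) = ennreal (mixed_density \<theta> y)"
proof -
  interpret prob_space mixing_law by (rule prob_space_mixing_law)
  show ?thesis
    unfolding mixed_density_def
  proof (rule nn_integral_eq_integral)
    show "integrable mixing_law (\<lambda>w. cond_density \<theta> w y)"
    proof (rule integrable_const_bound[where B = "(2 * \<theta>$2)\<^sup>2"])
      show "AE w in mixing_law. norm (cond_density \<theta> w y) \<le> (2 * \<theta>$2)\<^sup>2"
        using AE_mixing_law cond_density_bounds[OF assms] by (auto elim!: eventually_mono)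
    qed measurable
    show "AE w in mixing_law. 0 \<le> cond_density \<theta> w y"
      using AE_mixing_law cond_density_bounds[OF assms] by (auto elim!: eventually_mono)
  qed
qed

lemma obs_law_eq_density:
  assumes "\<theta> \<in> param_space"
  shows "obs_law \<theta> = density lborel (\<lambda>y. ennreal (mixed_density \<theta> y))"
proof (rule measure_eqI)
  show "sets (obs_law \<theta>) = sets (density lborel (\<lambda>y. ennreal (mixed_density \<theta> y)))"
    by (simp add: obs_law_def)
next
  fix A assume "A \<in> sets (obs_law \<theta>)"
  then have A [measurable]: "A \<in> sets borel" by (simp add: obs_law_def)
  interpret prob_space mixing_law by (rule prob_space_mixing_law)
  interpret pair_sigma_finite mixing_law "lborel :: (real^2) measure" ..
  have meas: "(\<lambda>y. ennreal (mixed_density \<theta> y)) \<in> borel_measurable lborel"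
  proof -
    have "(\<lambda>y. \<integral>\<^sup>+w. ennreal (cond_density \<theta> w y) \<partial>mixing_law) \<in> borel_measurable lborel"
      by measurable
    then show ?thesis by (simp add: nn_integral_cond_density[OF assms])
  qed
  have "emeasure (obs_law \<theta>) A = emeasure (joint_law \<theta>) (snd -` A \<inter> space (joint_law \<theta>))"
    unfolding obs_law_def by (rule emeasure_distr) (auto simp: joint_law_def)
  also have "\<dots> = (\<integral>\<^sup>+p. (case p of (w, y) \<Rightarrow> ennreal (cond_density \<theta> w y)) *
      indicator (snd -` A \<inter> space (mixing_law \<Otimes>\<^sub>M lborel)) p \<partial>(mixing_law \<Otimes>\<^sub>M lborel))"
    unfolding joint_law_def
  proof (subst emeasure_density)
    show "snd -` A \<inter> space (density (mixing_law \<Otimes>\<^sub>M lborel) (\<lambda>(w, y). ennreal (cond_density \<theta> w y)))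
        \<in> sets (mixing_law \<Otimes>\<^sub>M lborel)"
      unfolding space_density by (rule measurable_sets[OF measurable_snd]) simp
  qed auto
  also have "\<dots> = (\<integral>\<^sup>+p. (case p of (w, y) \<Rightarrow> ennreal (cond_density \<theta> w y) * indicator A y)
      \<partial>(mixing_law \<Otimes>\<^sub>M lborel))"
    by (intro nn_integral_cong) (auto simp: indicator_def)
  also have "\<dots> = (\<integral>\<^sup>+y. \<integral>\<^sup>+w. ennreal (cond_density \<theta> w y) * indicator A y \<partial>mixing_law \<partial>lborel)"
    by (subst nn_integral_snd[symmetric]) auto
  also have "\<dots> = (\<integral>\<^sup>+y. ennreal (mixed_density \<theta> y) * indicator A y \<partial>lborel)"
    by (intro nn_integral_cong) (simp add: nn_integral_multc nn_integral_cond_density[OF assms])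
  also have "\<dots> = emeasure (density lborel (\<lambda>y. ennreal (mixed_density \<theta> y))) A"
    using meas by (subst emeasure_density) auto
  finally show "emeasure (obs_law \<theta>) A = \<dots>" .
qed

section \<open>Partial derivatives\<close>

definition partial :: "2 \<Rightarrow> (real^2 \<Rightarrow> real) \<Rightarrow> real^2 \<Rightarrow> real" where
  "partial j g \<theta> = deriv (\<lambda>t. g (\<theta> + t *\<^sub>R axis j 1)) 0"

definition grad :: "(real^2 \<Rightarrow> real) \<Rightarrow> real^2 \<Rightarrow> real^2" where
  "grad g \<theta> = (\<chi> i. partial i g \<theta>)"

text \<open>\<open>nabla j l\<close> differentiates a vector field \<open>l\<close> times with respect to \<open>\<theta>$j\<close>, componentwise.\<close>

definition nabla :: "2 \<Rightarrow> nat \<Rightarrow> (real^2 \<Rightarrow> real^2) \<Rightarrow> real^2 \<Rightarrow> real^2" where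
  "nabla j l G \<theta> = (\<chi> i. (partial j ^^ l) (\<lambda>t. G t $ i) \<theta>)"

text \<open>A list of indices denotes an arbitrary (mixed) partial derivative; its length is the order.\<close>

definition partials :: "2 list \<Rightarrow> (real^2 \<Rightarrow> real) \<Rightarrow> real^2 \<Rightarrow> real" where
  "partials js g = foldr partial js g"

definition partials_exist_on :: "nat \<Rightarrow> (real^2 \<Rightarrow> real) \<Rightarrow> (real^2) set \<Rightarrow> bool" where
  "partials_exist_on k g B \<longleftrightarrow> (\<forall>js j. length js < k \<longrightarrow>
     (\<forall>\<theta>\<in>B. (\<lambda>t. partials js g (\<theta> + t *\<^sub>R axis j 1)) field_differentiable (at 0)))"

section \<open>Likelihood, score and information\<close>

definition loglik :: "real^2 \<Rightarrow> real^2 \<Rightarrow> real" where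
  "loglik \<theta> y = ln (mixed_density \<theta> y)"

definition score :: "real^2 \<Rightarrow> real^2 \<Rightarrow> real^2" where
  "score \<theta> y = grad (\<lambda>t. loglik t y) \<theta>"

definition loglik_n :: "nat \<Rightarrow> real^2 \<Rightarrow> (nat \<Rightarrow> real^2) \<Rightarrow> real" where
  "loglik_n n \<theta> y = (\<Sum>i<n. loglik \<theta> (y i))"

definition score_n :: "nat \<Rightarrow> real^2 \<Rightarrow> (nat \<Rightarrow> real^2) \<Rightarrow> real^2" where
  "score_n n \<theta> y = grad (\<lambda>t. loglik_n n t y) \<theta>"

definition cov_matrix :: "'a measure \<Rightarrow> ('a \<Rightarrow> real^'d) \<Rightarrow> real^'d^'d" where
  "cov_matrix M X = (\<chi> i j. \<integral>x. (X x $ i - (\<integral>x'. X x' $ i \<partial>M)) * (X x $ j - (\<integral>x'. X x' $ j \<partial>M)) \<partial>M)"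

definition info_n :: "nat \<Rightarrow> real^2 \<Rightarrow> real^2^2" where
  "info_n n \<theta> = cov_matrix (sample_law n \<theta>) (score_n n \<theta>)"

definition critical :: "nat \<Rightarrow> real^2 \<Rightarrow> bool" where
  "critical n \<theta> \<longleftrightarrow> \<not> invertible (info_n n \<theta>)"

definition score_stat :: "nat \<Rightarrow> real^2 \<Rightarrow> (nat \<Rightarrow> real^2) \<Rightarrow> real" where
  "score_stat n \<theta> y = score_n n \<theta> y \<bullet> (matrix_inv (info_n n \<theta>) *v score_n n \<theta> y)"

section \<open>The modified score\<close>

text \<open>The orders \<open>k\<^sub>1, k\<^sub>2\<close> and eigenvectors \<open>v\<^sub>1, v\<^sub>2\<close> are functions of the index \<open>j :: 2\<close>.\<close>

definition mod_score :: "(2 \<Rightarrow> nat) \<Rightarrow> (2 \<Rightarrow> real^2) \<Rightarrow> nat \<Rightarrow> real^2 \<Rightarrow> (nat \<Rightarrow> real^2) \<Rightarrow> real^2" where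
  "mod_score k v n \<theta> y =
     (\<chi> j. \<Sum>i<n. nabla j (k j - 1) (\<lambda>t. score t (y i)) \<theta> \<bullet> v j)"

definition mod_info :: "(2 \<Rightarrow> nat) \<Rightarrow> (2 \<Rightarrow> real^2) \<Rightarrow> nat \<Rightarrow> real^2 \<Rightarrow> real^2^2" where
  "mod_info k v n \<theta> = cov_matrix (sample_law n \<theta>) (mod_score k v n \<theta>)"

definition mod_score_stat :: "(2 \<Rightarrow> nat) \<Rightarrow> (2 \<Rightarrow> real^2) \<Rightarrow> nat \<Rightarrow> real^2 \<Rightarrow> (nat \<Rightarrow> real^2) \<Rightarrow> real" where
  "mod_score_stat k v n \<theta> y =
     mod_score k v n \<theta> y \<bullet> (matrix_inv (mod_info k v n \<theta>) *v mod_score k v n \<theta> y)"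

definition pos_def_matrix :: "real^'d^'d \<Rightarrow> bool" where
  "pos_def_matrix A \<longleftrightarrow> transpose A = A \<and> (\<forall>x. x \<noteq> 0 \<longrightarrow> 0 < x \<bullet> (A *v x))"

definition orthonormal_eigenvectors :: "real^'d^'d \<Rightarrow> ('d \<Rightarrow> real^'d) \<Rightarrow> bool" where
  "orthonormal_eigenvectors A v \<longleftrightarrow>
     (\<forall>i j. v i \<bullet> v j = (if i = j then 1 else 0)) \<and> (\<forall>j. \<exists>c. A *v v j = c *\<^sub>R v j)"

text \<open>\<open>smooth_order \<theta> K\<close>: \<open>K \<ge> 2\<close> is an order up to which, near \<open>\<theta>\<close>, the log-likelihood is
  smooth with locally uniformly bounded moments. The set \<open>A\<close> consists of almost every \<open>y\<close>, and
  continuity is joint continuity on \<open>ball \<theta> r \<times> A\<close>.\<close>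

definition smooth_order :: "real^2 \<Rightarrow> nat \<Rightarrow> bool" where
  "smooth_order \<theta> K \<longleftrightarrow> K \<ge> 2 \<and> (\<exists>r>0.
     (\<exists>A. (\<forall>\<theta>'\<in>param_space. AE y in obs_law \<theta>'. y \<in> A) \<and>
        (\<forall>y\<in>A. partials_exist_on K (\<lambda>t. loglik t y) (ball \<theta> r)) \<and>
        (\<forall>js. length js = K \<longrightarrow>
           continuous_on (ball \<theta> r \<times> A) (\<lambda>(t, y). partials js (\<lambda>t. loglik t y) t))) \<and>
     (\<exists>\<delta>>0. \<forall>js. length js \<le> K \<longrightarrow>
        (SUP (\<theta>'', \<theta>')\<in>(ball \<theta> r \<inter> param_space) \<times> ball \<theta> r.
           \<integral>\<^sup>+y. ennreal (\<bar>partials js (\<lambda>t. loglik t y) \<theta>'\<bar> powr (2 + \<delta>) * mixed_density \<theta>'' y) \<partial>lborel)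
        < \<infinity>))"

text \<open>The condition \<open>l + 2 \<le> k j\<close> is \<open>l \<le> k j - 2\<close> without truncated subtraction: it is void
  for \<open>k j = 1\<close>.\<close>

definition admissible :: "nat \<Rightarrow> nat \<Rightarrow> real^2 \<Rightarrow> (2 \<Rightarrow> nat) \<Rightarrow> (2 \<Rightarrow> real^2) \<Rightarrow> bool" where
  "admissible K n \<theta> k v \<longleftrightarrow>
     (\<forall>j. 1 \<le> k j) \<and> orthonormal_eigenvectors (info_n n \<theta>) v \<and>
     pos_def_matrix (mod_info k v n \<theta>) \<and>
     (\<forall>j l. l + 2 \<le> k j \<longrightarrow> (\<forall>\<theta>'\<in>param_space. \<theta>'$j = \<theta>$j \<longrightarrow>
        (\<forall>\<theta>''\<in>param_space. AE y in sample_law n \<theta>''.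
           nabla j l (\<lambda>t. score_n n t y) \<theta>' \<bullet> v j = 0))) \<and>
     smooth_order \<theta> K \<and> (\<forall>j. k j \<le> K)"

section \<open>Continuous extension, confidence region and chi-square quantile\<close>

definition cont_extension :: "nat \<Rightarrow> (nat \<Rightarrow> real^2) set \<Rightarrow> (real^2 \<Rightarrow> (nat \<Rightarrow> real^2) \<Rightarrow> real) \<Rightarrow> bool" where
  "cont_extension n \<Y> T \<longleftrightarrow>
     continuous_on (param_space \<times> \<Y>) (\<lambda>(\<theta>, y). T \<theta> y) \<and>
     (\<forall>\<theta>\<in>param_space. \<forall>y\<in>\<Y>. \<not> critical n \<theta> \<longrightarrow> T \<theta> y = score_stat n \<theta> y)"

definition chi_square :: "nat \<Rightarrow> real measure" where
  "chi_square d = distr (\<Pi>\<^sub>M i\<in>{..<d}. density lborel std_normal_density) borel (\<lambda>z. \<Sum>i<d. (z i)\<^sup>2)"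

definition quantile :: "real measure \<Rightarrow> real \<Rightarrow> real" where
  "quantile M p = Inf {x. p \<le> cdf M x}"

definition conf_region :: "(real^2 \<Rightarrow> (nat \<Rightarrow> real^2) \<Rightarrow> real) \<Rightarrow> real \<Rightarrow> (nat \<Rightarrow> real^2) \<Rightarrow> (real^2) set" where
  "conf_region T \<alpha> y = {\<theta>\<in>param_space. T \<theta> y \<le> quantile (chi_square 2) (1 - \<alpha>)}"

end

theory Submission
  imports Defs
begin

text \<open>The density of \<open>Y\<close> is even in \<open>\<lambda>\<close>, so the \<open>\<lambda>\<close>-score vanishes at \<open>\<lambda> = 0\<close>, to first order in \<open>\<lambda>\<close>.
  Integrating by parts in the mixing variable writes the score as \<open>diag(\<lambda>, 1) u\<close>, where \<open>u\<close> is given by a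
  formula that is continuous up to \<open>\<lambda> = 0\<close> and whose covariance matrix \<open>G\<close> is positive definite
  everywhere. Since \<open>s\<^sup>T I\<^sup>-\<^sup>1 s\<close> is invariant under invertible linear maps, with \<open>U\<^sub>n\<close> the sum of \<open>u\<close> over
  the sample, \<open>U\<^sub>n\<^sup>T (n G)\<^sup>-\<^sup>1 U\<^sub>n\<close> is the continuous extension of the score statistic. It also equals the
  modified statistic for every admissible choice, because each such modified score is a linear image
  of \<open>U\<^sub>n\<close>. On a compact set the third moments of the standardized \<open>u\<close> are bounded, which gives the chi-square
  limit along every sequence of parameters in it, and thus uniformly.\<close>

section \<open>Asymptotics of sums of independent planar vectors\<close>

text \<open>The obstacle is uniformity near \<open>\<theta>$1 = 0\<close>: the information matrix
  tends to a singular one, so its inverse is unbounded there, and the laws in a uniform coverage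
  statement move with n. Cancelling \<lambda> algebraically removes the first difficulty, since the
  inverse of what remains is bounded on compact sets. The cancellation rests on the weight 3 - w^2,
  the antiderivative of -2w that vanishes at both ends of the support of W. Densities depend on y
  only through s = y1 + y2. A derivative of order at most 2 in the rate costs at most a constant
  times (1 + s)^2 relative to the density, so third moments call for (1 + s)^6; this is the origin
  of the exponent 6. The moving laws are met by a limit theorem for triangular arrays. The planar
  limit is reached from one-dimensional characteristic functions by averaging over an independent
  Gaussian vector.\<close>

text \<open>If \<open>X\<close> is chi-square with two degrees of freedom, then \<open>exp (- X / 2)\<close> is uniform on \<open>{0..1}\<close>;
  on this compact interval convergence of moments suffices, by Weierstrass approximation.\<close>

lemma uniform_limit_of_moments:
  fixes \<mu> :: "nat \<Rightarrow> 'a measure" and U :: "nat \<Rightarrow> 'a \<Rightarrow> real"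
  assumes "\<And>n. prob_space (\<mu> n)" and [measurable]: "\<And>n. U n \<in> borel_measurable (\<mu> n)"
    and U01: "\<And>n x. 0 \<le> U n x" "\<And>n x. U n x \<le> 1"
    and moments: "\<And>k. (\<lambda>n. \<integral>x. U n x ^ k \<partial>\<mu> n) \<longlonglongrightarrow> 1 / (real k + 1)"
    and u: "0 \<le> u" "u \<le> 1"
  shows "(\<lambda>n. measure (\<mu> n) {x \<in> space (\<mu> n). u \<le> U n x}) \<longlonglongrightarrow> 1 - u"
proof -
  interpret \<mu>: prob_space "\<mu> n" for n by fact
  define M :: "real measure" where "M = uniform_measure lborel {0..1}"
  have prob_M: "prob_space M"
    unfolding M_def by (rule prob_space_uniform_measure) auto
  have sets_M[simp, measurable_cong]: "sets M = sets borel" by (simp add: M_def)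
  have [simp]: "space M = UNIV" by (simp add: M_def)
  interpret M: real_distribution M
    using prob_M by (simp add: real_distribution_def real_distribution_axioms_def)
  have AE_M: "AE x in M. x \<in> {0..1}"
    unfolding M_def by (rule AE_uniform_measureI) auto
  have M_power: "(\<integral>x. x ^ k \<partial>M) = 1 / (real k + 1)" for k
  proof -
    have "(\<integral>x. x ^ k \<partial>M) = (\<integral>x. indicator {0..1} x *\<^sub>R x ^ k \<partial>lborel)"
      proof -
      have "M = density lborel (\<lambda>x. ennreal (indicator {0..1} x))"
        unfolding M_def uniform_measure_def by (intro density_cong) (auto simp: indicator_def)
      then show ?thesis by (simp only:) (rule integral_density, auto)
    qed
    also have "\<dots> = (\<integral>x. x ^ k * indicator {0..1} x \<partial>lborel)" by (simp add: mult.commute)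
    also have "\<dots> = 1 / (real k + 1)" using integral_power[of 0 1 k] by (simp add: add.commute)
    finally show ?thesis .
  qed
  have lim_power: "(\<lambda>n. \<integral>x. U n x ^ k \<partial>\<mu> n) \<longlonglongrightarrow> (\<integral>x. x ^ k \<partial>M)" for k
    using moments M_power by simp
  have int_U: "integrable (\<mu> n) (\<lambda>x. f (U n x))" if "continuous_on {0..1} f" "f \<in> borel_measurable borel" for f :: "real \<Rightarrow> real" and n
  proof -
    have "bounded (f ` {0..1})" using that by (intro compact_imp_bounded compact_continuous_image) auto
    then obtain B where "\<forall>x\<in>{0..1}. norm (f x) \<le> B" unfolding bounded_iff by auto
    with U01 that show ?thesis by (intro \<mu>.integrable_const_bound[where B = B]) auto
  qed
  have int_M: "integrable M f" if "continuous_on {0..1} f" "f \<in> borel_measurable borel" for f :: "real \<Rightarrow> real"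
  proof -
    have "bounded (f ` {0..1})" using that by (intro compact_imp_bounded compact_continuous_image) auto
    then obtain B where "\<forall>x\<in>{0..1}. norm (f x) \<le> B" unfolding bounded_iff by auto
    with AE_M that show ?thesis by (intro M.integrable_const_bound[where B = B]) auto
  qed
  have lim_poly: "(\<lambda>n. \<integral>x. (\<Sum>k\<le>m. a k * U n x ^ k) \<partial>\<mu> n) \<longlonglongrightarrow> (\<integral>x. (\<Sum>k\<le>m. a k * x ^ k) \<partial>M)" for a :: "nat \<Rightarrow> real" and m
  proof -
    have "integrable (\<mu> n) (\<lambda>x. U n x ^ k)" for n k by (rule int_U) (auto intro!: continuous_intros)
    moreover have "integrable M (\<lambda>x. x ^ k)" for k by (rule int_M) (auto intro!: continuous_intros)
    ultimately show ?thesis by (simp add: Bochner_Integration.integral_sum) (intro tendsto_intros lim_power)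
  qed
  \<comment> \<open>Weierstrass approximation by a polynomial within e / 4 costs e / 4 on either
    side, and the polynomial moments converge up to e / 4.\<close>
  have lim_cont: "(\<lambda>n. \<integral>x. f (U n x) \<partial>\<mu> n) \<longlonglongrightarrow> (\<integral>x. f x \<partial>M)"
    if f: "continuous_on {0..1} f" "f \<in> borel_measurable borel" for f :: "real \<Rightarrow> real"
  proof (rule LIMSEQ_I)
    fix e :: real assume "0 < e"
    then have "0 < e / 4" by simp
    obtain p where p: "real_polynomial_function p" and pb: "\<And>x. x \<in> {0..1} \<Longrightarrow> \<bar>f x - p x\<bar> < e / 4"
      using Stone_Weierstrass_real_polynomial_function[of "{0..1}" f "e/4"] f \<open>0 < e / 4\<close> by auto
    obtain a m where p_eq: "p = (\<lambda>x. \<Sum>k\<le>m. a k * x ^ k)"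
      using p real_polynomial_function_iff_sum by blast
    have pc: "continuous_on {0..1} p" "p \<in> borel_measurable borel"
      unfolding p_eq by (auto intro!: continuous_intros)
    obtain N where N: "\<And>n. n \<ge> N \<Longrightarrow> norm ((\<integral>x. p (U n x) \<partial>\<mu> n) - (\<integral>x. p x \<partial>M)) < e / 4"
      using LIMSEQ_D[OF lim_poly \<open>0 < e / 4\<close>] unfolding p_eq by blast
    show "\<exists>N. \<forall>n\<ge>N. norm ((\<integral>x. f (U n x) \<partial>\<mu> n) - (\<integral>x. f x \<partial>M)) < e"
    proof (intro exI allI impI)
      fix n assume "n \<ge> N"
      have 1: "\<bar>(\<integral>x. f (U n x) \<partial>\<mu> n) - (\<integral>x. p (U n x) \<partial>\<mu> n)\<bar> \<le> e / 4"
      proof -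
        have "\<bar>\<integral>x. f (U n x) - p (U n x) \<partial>\<mu> n\<bar> \<le> (\<integral>x. \<bar>f (U n x) - p (U n x)\<bar> \<partial>\<mu> n)"
          by (rule integral_abs_bound)
        also have "\<dots> \<le> (\<integral>x. e / 4 \<partial>\<mu> n)"
          using U01 pb by (intro integral_mono) (auto intro!: integrable_abs Bochner_Integration.integrable_diff int_U[OF f] int_U[OF pc] less_imp_le)
        finally show ?thesis
          using int_U[OF f, of n] int_U[OF pc, of n] by (simp add: \<mu>.prob_space)
      qed
      have 2: "\<bar>(\<integral>x. f x \<partial>M) - (\<integral>x. p x \<partial>M)\<bar> \<le> e / 4"
      proof -
        have "\<bar>\<integral>x. f x - p x \<partial>M\<bar> \<le> (\<integral>x. \<bar>f x - p x\<bar> \<partial>M)" by (rule integral_abs_bound)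
        also have "\<dots> \<le> (\<integral>x. e / 4 \<partial>M)"
          using AE_M pb by (intro integral_mono_AE) (auto intro!: integrable_abs Bochner_Integration.integrable_diff int_M[OF f] int_M[OF pc] less_imp_le elim!: eventually_mono simp del: atLeastAtMost_iff)
        finally show ?thesis
          using int_M[OF f] int_M[OF pc] M.prob_space by simp
      qed
      show "norm ((\<integral>x. f (U n x) \<partial>\<mu> n) - (\<integral>x. f x \<partial>M)) < e"
        using 1 2 N[OF \<open>n \<ge> N\<close>] unfolding real_norm_def by linarith
    qed
  qed
  have conv: "weak_conv_m (\<lambda>n. distr (\<mu> n) borel (U n)) M"
  proof (rule integral_cts_step_conv_imp_weak_conv)
    show "real_distribution (distr (\<mu> n) borel (U n))" for n
      by (rule \<mu>.real_distribution_distr) simp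
    show "real_distribution M" ..
    fix x y :: real assume "x < y"
    have cts: "continuous_on UNIV (cts_step x y)"
      using \<open>x < y\<close> by (intro uniformly_continuous_imp_continuous cts_step_uniformly_continuous)
    then have [measurable]: "cts_step x y \<in> borel_measurable borel"
      by (rule borel_measurable_continuous_onI)
    show "(\<lambda>n. integral\<^sup>L (distr (\<mu> n) borel (U n)) (cts_step x y)) \<longlonglongrightarrow> integral\<^sup>L M (cts_step x y)"
      using lim_cont[of "cts_step x y"] cts by (simp add: integral_distr continuous_on_subset)
  qed
  have emeas: "measure M A = measure lborel ({0..1} \<inter> A)" if "A \<in> sets borel" for A
    unfolding M_def using that by (subst measure_uniform_measure) auto
  \<comment> \<open>The half-line is a continuity set: its frontier is one point, which the uniform
    law does not charge.\<close>
  have "(\<lambda>n. measure (distr (\<mu> n) borel (U n)) {u..}) \<longlonglongrightarrow> measure M {u..}"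
  proof (rule weak_conv_imp_continuity_set_conv[OF _ _ conv])
    show "real_distribution (distr (\<mu> n) borel (U n))" for n
      by (rule \<mu>.real_distribution_distr) simp
    show "emeasure M (frontier {u..}) = 0"
    proof -
      have "frontier {u..} = {u}"
        by (simp add: frontier_def interior_Ici[of "u - 1" u] interior_real_atLeast) auto
      then show ?thesis unfolding M_def by (simp add: emeasure_lborel_countable)
    qed
  qed (auto intro: M.real_distribution_axioms)
  moreover have "measure M {u..} = 1 - u"
    using u by (subst emeas) (auto simp: Int_atLeastAtMost atLeast_def[symmetric])
  moreover have "measure (distr (\<mu> n) borel (U n)) {u..} = measure (\<mu> n) {x \<in> space (\<mu> n). u \<le> U n x}" for n
    by (subst measure_distr) (auto intro!: arg_cong[where f = "measure _"])
  ultimately show ?thesis by simp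
qed

text \<open>The common law of the n summands may change with n, so this is a limit theorem for
  triangular arrays. The bound \<open>B\<close> makes the Taylor remainder of the characteristic
  function at 1 / sqrt n uniformly of order 1 / (n sqrt n), and passing to n-th powers multiplies it
  by n only.\<close>

lemma char_sum_limit:
  fixes M :: "nat \<Rightarrow> 'a measure" and Z :: "nat \<Rightarrow> 'a \<Rightarrow> real"
  assumes prob: "\<And>n. prob_space (M n)" and [measurable]: "\<And>n. Z n \<in> borel_measurable (M n)"
    and third: "\<And>n. integrable (M n) (\<lambda>x. \<bar>Z n x\<bar> ^ 3)" "\<And>n. (\<integral>x. \<bar>Z n x\<bar> ^ 3 \<partial>M n) \<le> B"
    and mean: "\<And>n. (\<integral>x. Z n x \<partial>M n) = 0"
    and var: "\<And>n. integrable (M n) (\<lambda>x. (Z n x)\<^sup>2)" "\<And>n. (\<integral>x. (Z n x)\<^sup>2 \<partial>M n) = v"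
  shows "(\<lambda>n. \<integral>\<omega>. iexp ((\<Sum>i<n. Z n (\<omega> i)) / sqrt n) \<partial>(\<Pi>\<^sub>M i\<in>{..<n}. M n)) \<longlonglongrightarrow> exp (- v / 2)"
proof -
  interpret M: prob_space "M n" for n by fact
  let ?\<phi> = "\<lambda>n. char (distr (M n) borel (Z n)) (1 / sqrt n)"
  have prod: "(\<integral>\<omega>. iexp ((\<Sum>i<n. Z n (\<omega> i)) / sqrt n) \<partial>(\<Pi>\<^sub>M i\<in>{..<n}. M n)) = ?\<phi> n ^ n" for n
  proof -
    interpret P: product_sigma_finite "\<lambda>_::nat. M n" by standard
    have "(\<integral>\<omega>. iexp ((\<Sum>i<n. Z n (\<omega> i)) / sqrt n) \<partial>(\<Pi>\<^sub>M i\<in>{..<n}. M n))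
      = (\<integral>\<omega>. (\<Prod>i<n. iexp (1 / sqrt n * Z n (\<omega> i))) \<partial>(\<Pi>\<^sub>M i\<in>{..<n}. M n))"
      by (simp add: exp_sum[symmetric] sum_divide_distrib sum_distrib_left)
    also have "\<dots> = (\<Prod>i<n. \<integral>x. iexp (1 / sqrt n * Z n x) \<partial>M n)"
      by (rule P.product_integral_prod) (auto intro!: M.integrable_const_bound[where B = 1])
    also have "\<dots> = ?\<phi> n ^ n"
      by (simp add: char_def integral_distr)
    finally show ?thesis .
  qed
  have v0: "0 \<le> v" unfolding var(2)[of 0, symmetric] by (rule integral_nonneg_AE) simp
  have main: "\<forall>\<^sub>F n in sequentially. norm (?\<phi> n ^ n - complex_of_real ((1 + (- v / 2) / n) ^ n)) \<le> B / 6 / sqrt n"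
  proof (rule eventually_sequentiallyI)
    \<comment> \<open>Once n is at least v, the number 1 - v / (2n) lies in the unit disc, as the
      comparison of n-th powers requires of both bases.\<close>
    fix n :: nat assume "n \<ge> nat \<lceil>v\<rceil> + 1"
    then have n: "real n \<ge> v" "n > 0" by linarith+
    have intZ: "integrable (M n) (Z n)"
      by (rule M.square_integrable_imp_integrable[OF _ var(1)]) simp
    have "norm (?\<phi> n - (1 - (1 / sqrt n)\<^sup>2 * v / 2)) \<le> ((1 / sqrt n)\<^sup>2 / 6) * (\<integral>x. min (6 * (Z n x)\<^sup>2) (\<bar>1 / sqrt n\<bar> * \<bar>Z n x\<bar> ^ 3) \<partial>M n)"
      by (rule M.char_approx3'[of _ _ v]) (use intZ var mean in auto)
    also have "\<dots> \<le> ((1 / sqrt n)\<^sup>2 / 6) * (\<integral>x. 1 / sqrt n * \<bar>Z n x\<bar> ^ 3 \<partial>M n)"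
    proof (intro mult_left_mono integral_mono)
      show "integrable (M n) (\<lambda>x. min (6 * (Z n x)\<^sup>2) (\<bar>1 / sqrt n\<bar> * \<bar>Z n x\<bar> ^ 3))"
        by (intro integrable_min integrable_mult_right var third)
    qed (auto intro!: integrable_mult_right third simp del: times_divide_eq_left)
    also have "\<dots> \<le> (1 / n / 6) * (1 / sqrt n * B)"
      using third[of n] by (auto simp: power_divide intro!: mult_left_mono divide_right_mono)
    finally have *: "norm (?\<phi> n - complex_of_real (1 + (- v / 2) / n)) \<le> (1 / n / 6) * (1 / sqrt n * B)"
      using n by (simp add: power_divide mult.commute)
    have "norm (?\<phi> n ^ n - complex_of_real (1 + (- v / 2) / n) ^ n) \<le> n * norm (?\<phi> n - complex_of_real (1 + (- v / 2) / n))"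
    proof (rule norm_power_diff)
      interpret D: real_distribution "distr (M n) borel (Z n)" by (rule M.real_distribution_distr) simp
      show "norm (?\<phi> n) \<le> 1" by (rule D.cmod_char_le_1)
      show "norm (complex_of_real (1 + (- v / 2) / n)) \<le> 1"
        unfolding norm_of_real using n v0 by (auto simp: abs_le_iff field_simps)
    qed
    also have "\<dots> \<le> n * ((1 / n / 6) * (1 / sqrt n * B))" by (intro mult_left_mono *) simp
    also have "\<dots> = B / 6 / sqrt n" using n by simp
    finally show "norm (?\<phi> n ^ n - complex_of_real ((1 + (- v / 2) / n) ^ n)) \<le> B / 6 / sqrt n" by simp
  qed
  have "(\<lambda>n. B / 6 / sqrt (real n)) \<longlonglongrightarrow> 0"
    by (intro tendsto_divide_0[OF tendsto_const] filterlim_at_top_imp_at_infinity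
        sqrt_at_top[THEN filterlim_compose] filterlim_real_sequentially)
  moreover have "(\<lambda>n. complex_of_real ((1 + (- v / 2) / n) ^ n)) \<longlonglongrightarrow> complex_of_real (exp (- v / 2))"
    by (rule isCont_tendsto_compose [OF _ tendsto_exp_limit_sequentially]) auto
  ultimately show ?thesis
    unfolding prod using Lim_transform[OF _ Lim_null_comparison[OF main]] by blast
qed


section \<open>Gaussian integrals in one and two dimensions\<close>

text \<open>Up to the factor 1 / sqrt (1 + k), the product of the two exponentials is the centred
  normal density with variance 1 / (1 + k).\<close>

lemma std_normal_exp_square:
  assumes "0 \<le> k"
  shows "(\<integral>z. exp (- (k * z\<^sup>2) / 2) \<partial>std_normal_distribution) = 1 / sqrt (1 + k)"
proof -
  have pos: "sqrt (1 + k) > 0" using assms by simp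
  have eq: "std_normal_density z *\<^sub>R exp (- (k * z\<^sup>2) / 2) = 1 / sqrt (1 + k) * normal_density 0 (1 / sqrt (1 + k)) z" for z
  proof -
    have "sqrt (2 * pi * (1 / sqrt (1 + k))\<^sup>2) = sqrt (2 * pi) / sqrt (1 + k)"
      using pos by (simp add: real_sqrt_mult real_sqrt_divide power_divide)
    moreover have "- (z - 0)\<^sup>2 / (2 * (1 / sqrt (1 + k))\<^sup>2) = - z\<^sup>2 / 2 + - (k * z\<^sup>2) / 2"
      using assms by (simp add: power_divide field_simps)
    ultimately show ?thesis
      using pos by (simp add: normal_density_def exp_add[symmetric])
  qed
  have "(\<integral>z. exp (- (k * z\<^sup>2) / 2) \<partial>std_normal_distribution) = (\<integral>z. std_normal_density z *\<^sub>R exp (- (k * z\<^sup>2) / 2) \<partial>lborel)"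
    by (rule integral_density) auto
  also have "\<dots> = 1 / sqrt (1 + k)"
    unfolding eq using pos by (subst integral_mult_right_zero) (simp add: integral_normal_density)
  finally show ?thesis .
qed

lemma std_normal_iexp: "(CLINT z|std_normal_distribution. iexp (t * z)) = exp (- t\<^sup>2 / 2)"
  using char_std_normal_distribution by (auto simp: char_def fun_eq_iff)

abbreviation std_normal2 :: "(real \<times> real) measure" where
  "std_normal2 \<equiv> std_normal_distribution \<Otimes>\<^sub>M std_normal_distribution"

lemma prob_space_std_normal: "prob_space std_normal_distribution"
  using real_dist_normal_dist by (simp add: real_distribution_def)

lemma prob_space_std_normal2: "prob_space std_normal2"
proof -
  interpret N: prob_space std_normal_distribution by (rule prob_space_std_normal)
  interpret pair_prob_space std_normal_distribution std_normal_distribution ..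
  show ?thesis by unfold_locales
qed

lemma std_normal2_iexp:
  "(CLINT g|std_normal2. iexp (fst g * a + snd g * b)) = exp (- (a\<^sup>2 + b\<^sup>2) / 2)"
proof -
  interpret N: prob_space std_normal_distribution by (rule prob_space_std_normal)
  interpret pair_prob_space std_normal_distribution std_normal_distribution ..
  have "(CLINT g|std_normal2. iexp (fst g * a + snd g * b)) = (CLINT x|std_normal_distribution. CLINT y|std_normal_distribution. iexp (x * a + y * b))"
    using integral_fst[of "\<lambda>x y. iexp (x * a + y * b)"] integrable_const_bound[where B = 1 and f = "\<lambda>g. iexp (fst g * a + snd g * b)"]
    by (simp add: case_prod_unfold)
  also have "\<dots> = (CLINT x|std_normal_distribution. iexp (a * x) * (CLINT y|std_normal_distribution. iexp (b * y)))"
    by (simp add: exp_add ring_distribs mult.commute)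
  also have "\<dots> = exp (- (a\<^sup>2 + b\<^sup>2) / 2)"
    unfolding std_normal_iexp integral_mult_left_zero
    by (simp flip: of_real_mult exp_add add: add_divide_distrib)
  finally show ?thesis .
qed

text \<open>At an integer \<open>k\<close> this value is the \<open>k\<close>-th moment of the
  uniform law on the unit interval, which is how the limit law is recognized later.\<close>

lemma std_normal2_exp_square:
  assumes "0 \<le> k"
  shows "(\<integral>g. exp (- (k * ((fst g)\<^sup>2 + (snd g)\<^sup>2)) / 2) \<partial>std_normal2) = 1 / (1 + k)"
proof -
  interpret N: prob_space std_normal_distribution by (rule prob_space_std_normal)
  interpret pair_prob_space std_normal_distribution std_normal_distribution ..
  have "(\<integral>g. exp (- (k * ((fst g)\<^sup>2 + (snd g)\<^sup>2)) / 2) \<partial>std_normal2)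
      = (\<integral>x. \<integral>y. exp (- (k * (x\<^sup>2 + y\<^sup>2)) / 2) \<partial>std_normal_distribution \<partial>std_normal_distribution)"
    using assms integral_fst[of "\<lambda>x y. exp (- (k * (x\<^sup>2 + y\<^sup>2)) / 2)"]
      integrable_const_bound[where B = 1 and f = "\<lambda>g. exp (- (k * ((fst g)\<^sup>2 + (snd g)\<^sup>2)) / 2)"]
    by (simp add: case_prod_unfold)
  also have "\<dots> = (\<integral>x. exp (- (k * x\<^sup>2) / 2) * (\<integral>y. exp (- (k * y\<^sup>2) / 2) \<partial>std_normal_distribution) \<partial>std_normal_distribution)"
    by (simp add: exp_add[symmetric] integral_mult_right_zero[symmetric] ring_distribs add_divide_distrib diff_divide_distrib del: integral_mult_right_zero)
  also have "\<dots> = 1 / (1 + k)"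
    unfolding integral_mult_left_zero std_normal_exp_square[OF assms] using assms by simp
  finally show ?thesis .
qed

section \<open>Squared norms of standardized planar sums\<close>

lemma abs_add_power3_le: "\<bar>a + b\<bar> ^ 3 \<le> 4 * (\<bar>a\<bar> ^ 3 + \<bar>b\<bar> ^ 3)" for a b :: real
proof -
  have "\<bar>a + b\<bar> ^ 3 \<le> (\<bar>a\<bar> + \<bar>b\<bar>) ^ 3" by (intro power_mono abs_triangle_ineq) auto
  also have "\<dots> = 4 * (\<bar>a\<bar> ^ 3 + \<bar>b\<bar> ^ 3) - 3 * (\<bar>a\<bar> + \<bar>b\<bar>) * (\<bar>a\<bar> - \<bar>b\<bar>)\<^sup>2" by algebra
  also have "\<dots> \<le> 4 * (\<bar>a\<bar> ^ 3 + \<bar>b\<bar> ^ 3)" by simp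
  finally show ?thesis .
qed

text \<open>A planar triangular array, standardized for each n, with one bound \<open>B\<close> on
  the third moments for all n. It is meant for \<open>M n\<close> being the law of an observation at
  the n-th member of a sequence of parameters.\<close>

locale standardized_pair =
  fixes M :: "nat \<Rightarrow> 'a measure" and X Y :: "nat \<Rightarrow> 'a \<Rightarrow> real" and B :: real
  assumes prob: "\<And>n. prob_space (M n)"
    and meas [measurable]: "\<And>n. X n \<in> borel_measurable (M n)" "\<And>n. Y n \<in> borel_measurable (M n)"
    and third: "\<And>n. integrable (M n) (\<lambda>x. \<bar>X n x\<bar> ^ 3)" "\<And>n. (\<integral>x. \<bar>X n x\<bar> ^ 3 \<partial>M n) \<le> B"
      "\<And>n. integrable (M n) (\<lambda>x. \<bar>Y n x\<bar> ^ 3)" "\<And>n. (\<integral>x. \<bar>Y n x\<bar> ^ 3 \<partial>M n) \<le> B"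
    and square: "\<And>n. integrable (M n) (\<lambda>x. (X n x)\<^sup>2)" "\<And>n. integrable (M n) (\<lambda>x. (Y n x)\<^sup>2)"
    and mean: "\<And>n. (\<integral>x. X n x \<partial>M n) = 0" "\<And>n. (\<integral>x. Y n x \<partial>M n) = 0"
    and cov: "\<And>n. (\<integral>x. (X n x)\<^sup>2 \<partial>M n) = 1" "\<And>n. (\<integral>x. (Y n x)\<^sup>2 \<partial>M n) = 1" "\<And>n. (\<integral>x. X n x * Y n x \<partial>M n) = 0"
begin

definition P :: "nat \<Rightarrow> (nat \<Rightarrow> 'a) measure" where "P n = (\<Pi>\<^sub>M i\<in>{..<n}. M n)"

definition R :: "nat \<Rightarrow> (nat \<Rightarrow> 'a) \<Rightarrow> real" where
  "R n \<omega> = ((\<Sum>i<n. X n (\<omega> i)) / sqrt n)\<^sup>2 + ((\<Sum>i<n. Y n (\<omega> i)) / sqrt n)\<^sup>2"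

lemma prob_P: "prob_space (P n)"
  unfolding P_def by (intro prob_space_PiM prob)

lemma measurable_R [measurable]: "R n \<in> borel_measurable (P n)"
proof -
  have [measurable]: "(\<lambda>\<omega>. X n (\<omega> i)) \<in> borel_measurable (P n)" "(\<lambda>\<omega>. Y n (\<omega> i)) \<in> borel_measurable (P n)" if "i \<in> {..<n}" for i
    unfolding P_def using that by measurable
  show ?thesis unfolding R_def[abs_def] by measurable
qed

text \<open>The Cramer-Wold step: since the pair is uncorrelated with unit variances, the
  combination has variance a^2 + b^2, and its third moment stays bounded.\<close>

lemma combination_limit:
  "(\<lambda>n. CLINT \<omega>|P n. iexp ((\<Sum>i<n. a * X n (\<omega> i) + b * Y n (\<omega> i)) / sqrt n)) \<longlonglongrightarrow> exp (- (a\<^sup>2 + b\<^sup>2) / 2)"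
  unfolding P_def
proof (rule char_sum_limit[where B = "4 * (\<bar>a\<bar> ^ 3 * B + \<bar>b\<bar> ^ 3 * B)"])
  fix n
  interpret prob_space "M n" by (rule prob)
  have [simp]: "integrable (M n) (X n)" "integrable (M n) (Y n)"
    by (rule square_integrable_imp_integrable[OF _ square(1)] square_integrable_imp_integrable[OF _ square(2)]; simp)+
  have [simp]: "integrable (M n) (\<lambda>x. X n x * Y n x)"
  proof (rule Bochner_Integration.integrable_bound[OF Bochner_Integration.integrable_add[OF square]])
    have "\<bar>x * y\<bar> \<le> x\<^sup>2 + y\<^sup>2" for x y :: real
      using sum_squares_bound[of "\<bar>x\<bar>" "\<bar>y\<bar>"] mult_nonneg_nonneg[of "\<bar>x\<bar>" "\<bar>y\<bar>"] unfolding abs_mult power2_abs by linarith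
    then show "AE x in M n. norm (X n x * Y n x) \<le> norm ((X n x)\<^sup>2 + (Y n x)\<^sup>2)" by simp
  qed simp
  have bound: "\<bar>a * X n x + b * Y n x\<bar> ^ 3 \<le> 4 * (\<bar>a\<bar> ^ 3 * \<bar>X n x\<bar> ^ 3 + \<bar>b\<bar> ^ 3 * \<bar>Y n x\<bar> ^ 3)" for x
    using abs_add_power3_le[of "a * X n x" "b * Y n x"] by (simp add: abs_mult power_mult_distrib)
  have int4: "integrable (M n) (\<lambda>x. 4 * (\<bar>a\<bar> ^ 3 * \<bar>X n x\<bar> ^ 3 + \<bar>b\<bar> ^ 3 * \<bar>Y n x\<bar> ^ 3))"
    by (intro integrable_mult_right Bochner_Integration.integrable_add third)
  show int3: "integrable (M n) (\<lambda>x. \<bar>a * X n x + b * Y n x\<bar> ^ 3)"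
    by (rule Bochner_Integration.integrable_bound[OF int4]) (use bound in \<open>auto intro!: AE_I2 order_trans[OF bound]\<close>)
  have "(\<integral>x. \<bar>a * X n x + b * Y n x\<bar> ^ 3 \<partial>M n) \<le> (\<integral>x. 4 * (\<bar>a\<bar> ^ 3 * \<bar>X n x\<bar> ^ 3 + \<bar>b\<bar> ^ 3 * \<bar>Y n x\<bar> ^ 3) \<partial>M n)"
    by (intro integral_mono int3 int4 bound)
  also have "\<dots> = 4 * (\<bar>a\<bar> ^ 3 * (\<integral>x. \<bar>X n x\<bar> ^ 3 \<partial>M n) + \<bar>b\<bar> ^ 3 * (\<integral>x. \<bar>Y n x\<bar> ^ 3 \<partial>M n))"
    by (simp add: third)
  also have "\<dots> \<le> 4 * (\<bar>a\<bar> ^ 3 * B + \<bar>b\<bar> ^ 3 * B)"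
    by (intro mult_left_mono add_mono third) auto
  finally show "(\<integral>x. \<bar>a * X n x + b * Y n x\<bar> ^ 3 \<partial>M n) \<le> 4 * (\<bar>a\<bar> ^ 3 * B + \<bar>b\<bar> ^ 3 * B)" .
  show "(\<integral>x. a * X n x + b * Y n x \<partial>M n) = 0" by (simp add: mean)
  have sq: "(a * X n x + b * Y n x)\<^sup>2 = a\<^sup>2 * (X n x)\<^sup>2 + b\<^sup>2 * (Y n x)\<^sup>2 + 2 * a * b * (X n x * Y n x)" for x by algebra
  show "integrable (M n) (\<lambda>x. (a * X n x + b * Y n x)\<^sup>2)" "(\<integral>x. (a * X n x + b * Y n x)\<^sup>2 \<partial>M n) = a\<^sup>2 + b\<^sup>2"
    unfolding sq by (simp_all add: square cov)
qed (auto intro: prob)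

text \<open>The Laplace transform of a squared norm is a Gaussian average of the characteristic function.\<close>

lemma exp_R_limit:
  assumes k: "0 \<le> k"
  shows "(\<lambda>n. \<integral>\<omega>. exp (- (k * R n \<omega>) / 2) \<partial>P n) \<longlonglongrightarrow> 1 / (1 + k)"
proof -
  interpret P: prob_space "P n" for n by (rule prob_P)
  interpret N: prob_space std_normal2 by (rule prob_space_std_normal2)
  let ?S = "\<lambda>n \<omega>. ((\<Sum>i<n. X n (\<omega> i)) / sqrt n, (\<Sum>i<n. Y n (\<omega> i)) / sqrt n)"
  let ?e = "\<lambda>n g \<omega>. iexp (fst g * (sqrt k * fst (?S n \<omega>)) + snd g * (sqrt k * snd (?S n \<omega>)))"
  have [measurable]: "(\<lambda>\<omega>. X n (\<omega> i)) \<in> borel_measurable (P n)" "(\<lambda>\<omega>. Y n (\<omega> i)) \<in> borel_measurable (P n)" if "i \<in> {..<n}" for i n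
    unfolding P_def using that by measurable
  \<comment> \<open>Averaging \<open>?e\<close> over the Gaussian vector g with the sample fixed
    returns exp (- k R / 2). With g fixed and the sample averaged, it is a characteristic function
    to which \<open>combination_limit\<close> applies. Fubini exchanges the two orders.\<close>
  have "complex_of_real (\<integral>\<omega>. exp (- (k * R n \<omega>) / 2) \<partial>P n) = (CLINT g|std_normal2. CLINT \<omega>|P n. ?e n g \<omega>)" for n
  proof -
    interpret PN: pair_prob_space "P n" std_normal2 ..
    have "complex_of_real (\<integral>\<omega>. exp (- (k * R n \<omega>) / 2) \<partial>P n) = (CLINT \<omega>|P n. complex_of_real (exp (- (k * R n \<omega>) / 2)))"
      by simp
    also have "\<dots> = (CLINT \<omega>|P n. CLINT g|std_normal2. ?e n g \<omega>)"
      unfolding std_normal2_iexp using k by (simp add: power_mult_distrib power_divide R_def ring_distribs)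
    also have "\<dots> = (CLINT g|std_normal2. CLINT \<omega>|P n. ?e n g \<omega>)"
      by (rule PN.Fubini_integral[symmetric]) (rule PN.integrable_const_bound[where B = 1], auto simp: case_prod_beta)
    finally show ?thesis .
  qed
  moreover have "(\<lambda>n. CLINT g|std_normal2. CLINT \<omega>|P n. ?e n g \<omega>) \<longlonglongrightarrow>
    (CLINT g|std_normal2. complex_of_real (exp (- (k * ((fst g)\<^sup>2 + (snd g)\<^sup>2)) / 2)))"
  proof (rule integral_dominated_convergence[where w = "\<lambda>_. 1"])
    fix n
    interpret PN: pair_prob_space std_normal2 "P n" ..
    show "(\<lambda>g. CLINT \<omega>|P n. ?e n g \<omega>) \<in> borel_measurable std_normal2"
      by measurable
    show "AE g in std_normal2. norm (CLINT \<omega>|P n. ?e n g \<omega>) \<le> 1"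
    proof (rule AE_I2)
      fix g
      have "norm (CLINT \<omega>|P n. ?e n g \<omega>) \<le> (\<integral>\<omega>. norm (?e n g \<omega>) \<partial>P n)" by (rule integral_norm_bound)
      also have "\<dots> = 1" by (simp add: P.prob_space)
      finally show "norm (CLINT \<omega>|P n. ?e n g \<omega>) \<le> 1" .
    qed
  next
    show "AE g in std_normal2. (\<lambda>n. CLINT \<omega>|P n. ?e n g \<omega>) \<longlonglongrightarrow> complex_of_real (exp (- (k * ((fst g)\<^sup>2 + (snd g)\<^sup>2)) / 2))"
    proof (rule AE_I2)
      fix g
      have "- ((sqrt k * fst g)\<^sup>2 + (sqrt k * snd g)\<^sup>2) / 2 = - (k * ((fst g)\<^sup>2 + (snd g)\<^sup>2)) / 2"
        using k by (simp add: power_mult_distrib ring_distribs)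
      moreover have "?e n g \<omega> = iexp ((\<Sum>i<n. sqrt k * fst g * X n (\<omega> i) + sqrt k * snd g * Y n (\<omega> i)) / sqrt n)" for n \<omega>
        by (simp add: sum.distrib sum_distrib_left[symmetric] add_divide_distrib mult_ac)
      ultimately show "(\<lambda>n. CLINT \<omega>|P n. ?e n g \<omega>) \<longlonglongrightarrow> complex_of_real (exp (- (k * ((fst g)\<^sup>2 + (snd g)\<^sup>2)) / 2))"
        using combination_limit[of "sqrt k * fst g" "sqrt k * snd g"] by simp
    qed
  qed auto
  moreover have "(CLINT g|std_normal2. complex_of_real (exp (- (k * ((fst g)\<^sup>2 + (snd g)\<^sup>2)) / 2))) = complex_of_real (1 / (1 + k))"
    using std_normal2_exp_square[OF k] by (simp only: integral_complex_of_real)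
  ultimately have "(\<lambda>n. complex_of_real (\<integral>\<omega>. exp (- (k * R n \<omega>) / 2) \<partial>P n)) \<longlonglongrightarrow> complex_of_real (1 / (1 + k))"
    by simp
  then show ?thesis by (simp only: tendsto_of_real_iff)
qed

text \<open>The moments of exp (- R / 2) are values of the Laplace transform of R at half-integers,
  so this variable is asymptotically uniform, and R \<le> q is an upper tail event for it.\<close>

lemma R_limit:
  assumes q: "0 \<le> q"
  shows "(\<lambda>n. measure (P n) {\<omega> \<in> space (P n). R n \<omega> \<le> q}) \<longlonglongrightarrow> 1 - exp (- q / 2)"
proof -
  have "(\<lambda>n. measure (P n) {\<omega> \<in> space (P n). exp (- q / 2) \<le> exp (- R n \<omega> / 2)}) \<longlonglongrightarrow> 1 - exp (- q / 2)"
  proof (rule uniform_limit_of_moments)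
    show "(\<lambda>n. \<integral>x. exp (- R n x / 2) ^ k \<partial>P n) \<longlonglongrightarrow> 1 / (real k + 1)" for k
      using exp_R_limit[of "real k"] by (simp add: exp_of_nat_mult[symmetric] add.commute)
    show "0 \<le> exp (- R n x / 2)" "exp (- R n x / 2) \<le> 1" for n x by (simp_all add: R_def)
  qed (use q in \<open>simp_all add: prob_P\<close>)
  then show ?thesis by simp
qed

end

section \<open>The chi-square law with two degrees of freedom\<close>

text \<open>The moment criterion is applied to a constant sequence: the limit of a constant is its
  value, so the asymptotic statement becomes an exact one.\<close>

lemma chi_square_2_measure:
  assumes "0 \<le> q"
  shows "measure (chi_square 2) {..q} = 1 - exp (- q / 2)"
proof -
  interpret N: prob_space std_normal_distribution by (rule prob_space_std_normal)
  interpret product_sigma_finite "\<lambda>_::nat. std_normal_distribution" by standard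
  let ?P = "\<Pi>\<^sub>M i\<in>{..<2::nat}. std_normal_distribution"
  let ?R = "\<lambda>z. \<Sum>i<2::nat. (z i)\<^sup>2 :: real"
  have [measurable]: "?R \<in> borel_measurable ?P" by measurable
  have "(\<lambda>n::nat. measure ?P {z \<in> space ?P. exp (- q / 2) \<le> exp (- ?R z / 2)}) \<longlonglongrightarrow> 1 - exp (- q / 2)"
  proof (rule uniform_limit_of_moments)
    show "prob_space ?P" by (intro prob_space_PiM N.prob_space_axioms)
    have "(\<integral>z. exp (- ?R z / 2) ^ k \<partial>?P) = 1 / (real k + 1)" for k
    proof -
      have "(\<integral>z. exp (- ?R z / 2) ^ k \<partial>?P) = (\<integral>z. (\<Prod>i<2. exp (- (k * (z i)\<^sup>2) / 2)) \<partial>?P)"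
        by (simp add: exp_sum[symmetric] exp_of_nat_mult[symmetric] sum_negf sum_distrib_left sum_divide_distrib)
      also have "\<dots> = (\<Prod>i<2::nat. \<integral>z. exp (- (k * z\<^sup>2) / 2) \<partial>std_normal_distribution)"
        by (rule product_integral_prod) (auto intro!: N.integrable_const_bound[where B = 1])
      also have "\<dots> = (\<Prod>i<2::nat. 1 / sqrt (1 + k))"
        using std_normal_exp_square[of "real k"] by simp
      also have "\<dots> = 1 / (real k + 1)" by (simp add: power_divide)
      finally show ?thesis .
    qed
    then show "(\<lambda>n::nat. \<integral>z. exp (- ?R z / 2) ^ k \<partial>?P) \<longlonglongrightarrow> 1 / (real k + 1)" for k by simp
  qed (use assms in \<open>auto intro!: sum_nonneg\<close>)
  then have "measure ?P {z \<in> space ?P. exp (- q / 2) \<le> exp (- ?R z / 2)} = 1 - exp (- q / 2)"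
    by (simp only: LIMSEQ_const_iff)
  then show ?thesis
    unfolding chi_square_def by (subst measure_distr) (auto simp: vimage_def Int_def conj_commute)
qed

lemma chi_square_2_quantile:
  assumes "0 < \<alpha>" "\<alpha> < 1"
  shows "quantile (chi_square 2) (1 - \<alpha>) = - 2 * ln \<alpha>"
proof -
  have "1 - \<alpha> \<le> cdf (chi_square 2) x \<longleftrightarrow> - 2 * ln \<alpha> \<le> x" for x
  proof (cases "0 \<le> x")
    case True
    have "1 - \<alpha> \<le> 1 - exp (- x / 2) \<longleftrightarrow> exp (- x / 2) \<le> \<alpha>" by linarith
    also have "\<dots> \<longleftrightarrow> - x / 2 \<le> ln \<alpha>" using assms by (metis exp_le_cancel_iff exp_ln)
    finally show ?thesis using True by (auto simp: cdf_def chi_square_2_measure)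
  next
    \<comment> \<open>For negative x the distribution function is 0, while the threshold - 2 ln
      \<alpha> is positive.\<close>
    case False
    interpret prob_space "chi_square 2" unfolding chi_square_def
      by (intro prob_space.prob_space_distr prob_space_PiM prob_space_std_normal) simp
    have "cdf (chi_square 2) x \<le> measure (chi_square 2) {..0}"
      using False unfolding cdf_def by (intro finite_measure_mono) (auto simp: chi_square_def)
    then have "cdf (chi_square 2) x \<le> 0" by (simp add: chi_square_2_measure)
    moreover have "ln \<alpha> < 0" using assms by simp
    then have "\<not> - 2 * ln \<alpha> \<le> x" using False by linarith
    ultimately show ?thesis using assms by auto
  qed
  then have "{x. 1 - \<alpha> \<le> cdf (chi_square 2) x} = {- 2 * ln \<alpha>..}" by auto
  then show ?thesis by (simp add: quantile_def)
qed

section \<open>Mixture integrals and their parameter derivatives\<close>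

text \<open>The \<open>m\<close>-th derivative of \<open>r\<^sup>2 * exp (- s * r)\<close> in \<open>r\<close>. Where a truncated exponent
  differs from the true one, its coefficient vanishes.\<close>

definition dens_deriv :: "nat \<Rightarrow> real \<Rightarrow> real \<Rightarrow> real" where
  "dens_deriv m r s = ((- s) ^ m * r\<^sup>2 + 2 * m * (- s) ^ (m - 1) * r + m * (m - 1) * (- s) ^ (m - 2)) * exp (- s * r)"

lemma dens_deriv_0: "dens_deriv 0 r s = r\<^sup>2 * exp (- s * r)"
  and dens_deriv_1: "dens_deriv 1 r s = (2 * r - s * r\<^sup>2) * exp (- s * r)"
  and dens_deriv_2: "dens_deriv 2 r s = (2 - 4 * r * s + r\<^sup>2 * s\<^sup>2) * exp (- s * r)"
  by (simp_all add: dens_deriv_def algebra_simps numeral_2_eq_2 power2_eq_square)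

lemma dens_deriv_has_field_derivative [derivative_intros]:
  assumes "(f has_field_derivative f') (at x within S)"
  shows "((\<lambda>x. dens_deriv m (f x) s) has_field_derivative dens_deriv (Suc m) (f x) s * f') (at x within S)"
proof -
  have "((\<lambda>r. dens_deriv m r s) has_field_derivative dens_deriv (Suc m) r s) (at r)" for r
  proof -
    consider "m = 0" | "m = 1" | k where "m = Suc (Suc k)"
      by (metis One_nat_def not0_implies_Suc)
    then show ?thesis
      by cases (auto simp: dens_deriv_def[abs_def] power2_eq_square algebra_simps intro!: derivative_eq_intros)
  qed
  from DERIV_chain2[OF this assms] show ?thesis .
qed

lemma continuous_on_dens_deriv [continuous_intros]:
  assumes "continuous_on A f" "continuous_on A g"
  shows "continuous_on A (\<lambda>x. dens_deriv m (f x) (g x))"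
  unfolding dens_deriv_def by (intro continuous_intros assms)

text \<open>The density is \<open>mixint 0 0\<close> on the quadrant. The family is closed under
  differentiation in \<theta>: every derivative raises \<open>m\<close>, and one in
  \<open>\<theta>$1\<close> also raises \<open>a\<close> through the inner derivative w. Integration
  runs over a compact interval, so that the Leibniz rule and continuity hold for all real
  parameters.\<close>

definition mixint :: "nat \<Rightarrow> nat \<Rightarrow> real^2 \<Rightarrow> real \<Rightarrow> real" where
  "mixint a m \<theta> s = integral {- sqrt 3..sqrt 3} (\<lambda>w. w ^ a * dens_deriv m (\<theta>$2 + \<theta>$1 * w) s) / (2 * sqrt 3)"

lemma continuous_on_mixint [continuous_intros]:
  fixes f :: "'a::topological_space \<Rightarrow> real^2"
  assumes "continuous_on A f" "continuous_on A g"
  shows "continuous_on A (\<lambda>x. mixint a m (f x) (g x))"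
proof -
  have "continuous_on (UNIV \<times> cbox (- sqrt 3) (sqrt 3)) (\<lambda>(p, w). w ^ a * dens_deriv m (fst p $ 2 + fst p $ 1 * w) (snd p))"
    unfolding case_prod_beta by (intro continuous_intros)
  then have "continuous_on (UNIV :: ((real^2) \<times> real) set) (\<lambda>p. integral (cbox (- sqrt 3) (sqrt 3)) (\<lambda>w. w ^ a * dens_deriv m (fst p $ 2 + fst p $ 1 * w) (snd p)))"
    by (rule integral_continuous_on_param)
  then have "continuous_on UNIV (\<lambda>p. mixint a m (fst p) (snd p))"
    unfolding mixint_def by (intro continuous_intros) (simp_all add: cbox_interval)
  from continuous_on_compose2[OF this, of A "\<lambda>x. (f x, g x)"] show ?thesis
    using assms by (auto intro!: continuous_intros)
qed

lemma mixint_has_derivative_param: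
  assumes e: "e = 1 \<or> e = 2"
  shows "((\<lambda>t. mixint a m (\<theta> + t *\<^sub>R axis e 1) s) has_field_derivative
    mixint (if e = 1 then Suc a else a) (Suc m) (\<theta> + t *\<^sub>R axis e 1) s) (at t)"
proof -
  let ?r = "\<lambda>t w. (\<theta> + t *\<^sub>R axis e 1) $ 2 + (\<theta> + t *\<^sub>R axis e 1) $ 1 * w :: real"
  have "((\<lambda>t. integral (cbox (- sqrt 3) (sqrt 3)) (\<lambda>w. w ^ a * dens_deriv m (?r t w) s)) has_field_derivative
    integral (cbox (- sqrt 3) (sqrt 3)) (\<lambda>w. w ^ (if e = 1 then Suc a else a) * dens_deriv (Suc m) (?r t w) s)) (at t within UNIV)"
  proof (rule leibniz_rule_field_derivative)
    fix t w
    have "((\<lambda>t. ?r t w) has_field_derivative (if e = 1 then w else 1)) (at t)"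
      using e by (auto simp: axis_def intro!: derivative_eq_intros)
    from DERIV_cmult[OF dens_deriv_has_field_derivative[OF this, of m s], of "w ^ a"]
    show "((\<lambda>t. w ^ a * dens_deriv m (?r t w) s) has_field_derivative w ^ (if e = 1 then Suc a else a) * dens_deriv (Suc m) (?r t w) s) (at t within UNIV)"
      by (simp add: mult_ac split: if_splits)
  next
    show "(\<lambda>w. w ^ a * dens_deriv m (?r t w) s) integrable_on cbox (- sqrt 3) (sqrt 3)" for t
      by (intro integrable_continuous continuous_intros)
    show "continuous_on (UNIV \<times> cbox (- sqrt 3) (sqrt 3)) (\<lambda>(t, w). w ^ (if e = 1 then Suc a else a) * dens_deriv (Suc m) (?r t w) s)"
      unfolding case_prod_beta by (intro continuous_intros)
  qed auto
  then have "((\<lambda>t. integral (cbox (- sqrt 3) (sqrt 3)) (\<lambda>w. w ^ a * dens_deriv m (?r t w) s) / (2 * sqrt 3)) has_field_derivative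
    integral (cbox (- sqrt 3) (sqrt 3)) (\<lambda>w. w ^ (if e = 1 then Suc a else a) * dens_deriv (Suc m) (?r t w) s) / (2 * sqrt 3)) (at t)"
    by (rule DERIV_cdivide)
  then show ?thesis by (simp only: mixint_def cbox_interval)
qed

section \<open>Bounds for mixture integrals on the extended parameter space\<close>

text \<open>This set is open and symmetric in the sign of \<open>\<theta>$1\<close>, so two-sided
  derivatives make sense at the boundary points of \<open>param_space\<close>.\<close>

definition ext_space :: "(real^2) set" where
  "ext_space = {\<theta>. sqrt 3 * \<bar>\<theta>$1\<bar> < \<theta>$2}"

lemma open_ext_space: "open ext_space"
  unfolding ext_space_def by (intro open_Collect_less continuous_intros)

lemma param_space_subset: "param_space \<subseteq> ext_space"
  by (auto simp: param_space_def ext_space_def)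

lemma ext_rate_bounds:
  assumes "w \<in> {- sqrt 3..sqrt 3}"
  shows "\<theta>$2 - sqrt 3 * \<bar>\<theta>$1\<bar> \<le> \<theta>$2 + \<theta>$1 * w" "\<theta>$2 + \<theta>$1 * w \<le> \<theta>$2 + sqrt 3 * \<bar>\<theta>$1\<bar>"
proof -
  have "\<bar>\<theta>$1 * w\<bar> \<le> sqrt 3 * \<bar>\<theta>$1\<bar>"
    using assms by (auto simp: abs_mult mult.commute[of "sqrt 3"] intro!: mult_left_mono)
  then show "\<theta>$2 - sqrt 3 * \<bar>\<theta>$1\<bar> \<le> \<theta>$2 + \<theta>$1 * w" "\<theta>$2 + \<theta>$1 * w \<le> \<theta>$2 + sqrt 3 * \<bar>\<theta>$1\<bar>" by auto
qed

lemma mixint_integrable: "(\<lambda>w. w ^ a * dens_deriv m (\<theta>$2 + \<theta>$1 * w) s) integrable_on {- sqrt 3..sqrt 3}"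
  by (rule integrable_continuous_interval) (intro continuous_intros)

lemma mixint_00_bounds:
  assumes "0 < r0" "r0 \<le> \<theta>$2 - sqrt 3 * \<bar>\<theta>$1\<bar>" "\<theta>$2 + sqrt 3 * \<bar>\<theta>$1\<bar> \<le> r1" "0 \<le> s"
  shows "r0\<^sup>2 * exp (- s * r1) \<le> mixint 0 0 \<theta> s" "mixint 0 0 \<theta> s \<le> r1\<^sup>2 * exp (- s * r0)"
proof -
  have r: "r0 \<le> \<theta>$2 + \<theta>$1 * w" "\<theta>$2 + \<theta>$1 * w \<le> r1" if "w \<in> {- sqrt 3..sqrt 3}" for w
    using ext_rate_bounds[OF that, of \<theta>] assms by auto
  have "integral {- sqrt 3..sqrt 3} (\<lambda>w. r0\<^sup>2 * exp (- s * r1)) \<le> integral {- sqrt 3..sqrt 3} (\<lambda>w. w ^ 0 * dens_deriv 0 (\<theta>$2 + \<theta>$1 * w) s)"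
  proof (rule integral_le)
    fix w assume w: "w \<in> {- sqrt 3..sqrt 3}"
    have "r0\<^sup>2 * exp (- s * r1) \<le> (\<theta>$2 + \<theta>$1 * w)\<^sup>2 * exp (- s * (\<theta>$2 + \<theta>$1 * w))"
      using r[OF w] assms by (intro mult_mono power_mono) (auto intro!: mult_left_mono)
    then show "r0\<^sup>2 * exp (- s * r1) \<le> w ^ 0 * dens_deriv 0 (\<theta>$2 + \<theta>$1 * w) s" by (simp add: dens_deriv_0)
  qed (auto intro: mixint_integrable[where a = 0, simplified])
  then show "r0\<^sup>2 * exp (- s * r1) \<le> mixint 0 0 \<theta> s"
    by (simp add: mixint_def field_simps)
  have "integral {- sqrt 3..sqrt 3} (\<lambda>w. w ^ 0 * dens_deriv 0 (\<theta>$2 + \<theta>$1 * w) s) \<le> integral {- sqrt 3..sqrt 3} (\<lambda>w. r1\<^sup>2 * exp (- s * r0))"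
  proof (rule integral_le)
    fix w assume w: "w \<in> {- sqrt 3..sqrt 3}"
    have "(\<theta>$2 + \<theta>$1 * w)\<^sup>2 * exp (- s * (\<theta>$2 + \<theta>$1 * w)) \<le> r1\<^sup>2 * exp (- s * r0)"
      using r[OF w] assms by (intro mult_mono power_mono) (auto intro!: mult_left_mono)
    then show "w ^ 0 * dens_deriv 0 (\<theta>$2 + \<theta>$1 * w) s \<le> r1\<^sup>2 * exp (- s * r0)" by (simp add: dens_deriv_0)
  qed (auto intro: mixint_integrable[where a = 0, simplified])
  then show "mixint 0 0 \<theta> s \<le> r1\<^sup>2 * exp (- s * r0)"
    by (simp add: mixint_def field_simps)
qed

text \<open>Here s may have any sign, which the bounds by extreme rates do not cover. The integrand
  is continuous and positive on a compact interval, hence bounded below by a positive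
  minimum.\<close>

lemma mixint_00_pos:
  assumes "\<theta> \<in> ext_space"
  shows "0 < mixint 0 0 \<theta> s"
proof -
  have "0 < integral {- sqrt 3..sqrt 3} (\<lambda>w. w ^ 0 * dens_deriv 0 (\<theta>$2 + \<theta>$1 * w) s)"
  proof -
    let ?f = "\<lambda>w. dens_deriv 0 (\<theta>$2 + \<theta>$1 * w) s"
    have "continuous_on {- sqrt 3..sqrt 3} ?f" by (intro continuous_intros)
    moreover have pos: "0 < ?f w" if "w \<in> {- sqrt 3..sqrt 3}" for w
      using ext_rate_bounds[OF that, of \<theta>] assms by (auto simp: dens_deriv_0 ext_space_def)
    moreover have "{- sqrt 3..sqrt 3} \<noteq> {}" by simp
    ultimately obtain w0 where w0: "w0 \<in> {- sqrt 3..sqrt 3}" "\<And>w. w \<in> {- sqrt 3..sqrt 3} \<Longrightarrow> ?f w0 \<le> ?f w"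
      using continuous_attains_inf[of "{- sqrt 3..sqrt 3}" ?f] by auto
    have "integral {- sqrt 3..sqrt 3} (\<lambda>w. ?f w0) \<le> integral {- sqrt 3..sqrt 3} ?f"
      by (rule integral_le) (use w0 in \<open>auto intro: mixint_integrable[where a = 0, simplified]\<close>)
    moreover have "0 < integral {- sqrt 3..sqrt 3} (\<lambda>w. ?f w0)" using pos[OF w0(1)] by simp
    ultimately show ?thesis by simp
  qed
  then show ?thesis by (simp add: mixint_def)
qed

text \<open>Divided by r^2 exp (- s r), the m-th derivative is at most (2 / r + s)^m in absolute
  value, and 2 / r + s is at most (1 + 2 / r0) (1 + s). The factor 3 is the largest value of |w|^a
  for a \<le> 2 on the support of W.\<close>

lemma weighted_dens_deriv_le:
  assumes "0 < r0" "r0 \<le> \<theta>$2 - sqrt 3 * \<bar>\<theta>$1\<bar>" "0 \<le> s" "a \<le> 2" "m \<le> 2" and w: "w \<in> {- sqrt 3..sqrt 3}"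
  shows "\<bar>w ^ a * dens_deriv m (\<theta>$2 + \<theta>$1 * w) s\<bar> \<le> 3 * (1 + 2 / r0)\<^sup>2 * (1 + s) ^ m * dens_deriv 0 (\<theta>$2 + \<theta>$1 * w) s"
proof -
  define r where "r = \<theta>$2 + \<theta>$1 * w"
  have r: "r0 \<le> r" "0 < r" using ext_rate_bounds[OF w, of \<theta>] assms unfolding r_def by auto
  have wa: "\<bar>w ^ a\<bar> \<le> 3"
  proof -
    have "\<bar>w\<bar> ^ a \<le> sqrt 3 ^ a" using w by (intro power_mono) auto
    also have "\<dots> \<le> sqrt 3 ^ 2" using assms by (intro power_increasing) auto
    finally show ?thesis by (simp add: power_abs)
  qed
  have inv: "1 / r \<le> 1 / r0" using r assms by (simp add: frac_le)
  have hm: "\<bar>dens_deriv m r s\<bar> \<le> (1 + 2 / r0)\<^sup>2 * (1 + s) ^ m * dens_deriv 0 r s"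
  proof -
    consider "m = 0" | "m = 1" | "m = 2" using assms by linarith
    then show ?thesis
    proof cases
      case 1
      have "1 * dens_deriv 0 r s \<le> (1 + 2 / r0)\<^sup>2 * dens_deriv 0 r s"
        using assms by (intro mult_right_mono) (auto simp: dens_deriv_0 intro!: one_le_power)
      moreover have "0 \<le> dens_deriv 0 r s" by (simp add: dens_deriv_0)
      ultimately show ?thesis using 1 by simp
    next
      case 2
      have "\<bar>2 * r - s * r\<^sup>2\<bar> \<le> 2 * r + s * r\<^sup>2" using assms r by (simp add: abs_le_iff)
      also have "\<dots> = (2 * (1 / r) + s) * r\<^sup>2" using r by (simp add: field_simps power2_eq_square)
      also have "\<dots> \<le> (2 * (1 / r0) + s) * r\<^sup>2" using inv by (intro mult_right_mono) auto
      also have "\<dots> \<le> ((1 + 2 / r0)\<^sup>2 * (1 + s)) * r\<^sup>2"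
      proof (intro mult_right_mono)
        have "2 * (1 / r0) + s \<le> (1 + 2 / r0) * (1 + s)" using assms by (simp add: field_simps)
        also have "\<dots> \<le> (1 + 2 / r0)\<^sup>2 * (1 + s)" using assms by (intro mult_right_mono) (auto simp: power2_eq_square field_simps)
        finally show "2 * (1 / r0) + s \<le> (1 + 2 / r0)\<^sup>2 * (1 + s)" .
      qed simp
      finally show ?thesis using 2 by (simp add: dens_deriv_1[simplified] dens_deriv_0 abs_mult)
    next
      case 3
      have "\<bar>2 - 4 * r * s + r\<^sup>2 * s\<^sup>2\<bar> \<le> 2 + 4 * r * s + r\<^sup>2 * s\<^sup>2" using assms r by (simp add: abs_le_iff)
      also have "\<dots> \<le> (2 * (1 / r) + s)\<^sup>2 * r\<^sup>2" using r assms by (simp add: field_simps power2_eq_square)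
      also have "\<dots> \<le> ((1 + 2 / r0) * (1 + s))\<^sup>2 * r\<^sup>2"
      proof (intro mult_right_mono power_mono)
        have "2 * (1 / r) + s \<le> 2 * (1 / r0) + s" using inv by simp
        also have "\<dots> \<le> (1 + 2 / r0) * (1 + s)" using assms by (simp add: field_simps)
        finally show "2 * (1 / r) + s \<le> (1 + 2 / r0) * (1 + s)" .
      qed (use r assms in auto)
      finally show ?thesis using 3 by (simp add: dens_deriv_2 dens_deriv_0 abs_mult power_mult_distrib)
    qed
  qed
  have "\<bar>w ^ a * dens_deriv m r s\<bar> \<le> 3 * ((1 + 2 / r0)\<^sup>2 * (1 + s) ^ m * dens_deriv 0 r s)"
    unfolding abs_mult by (intro mult_mono wa hm) auto
  then show ?thesis unfolding r_def by simp
qed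

text \<open>The factor in \<open>weighted_dens_deriv_le\<close> is free of w and survives the
  integration; so ratios of mixture integrals, and with them derivatives of the log-density, grow
  only polynomially in s.\<close>

lemma mixint_le:
  assumes "0 < r0" "r0 \<le> \<theta>$2 - sqrt 3 * \<bar>\<theta>$1\<bar>" "0 \<le> s" "a \<le> 2" "m \<le> 2"
  shows "\<bar>mixint a m \<theta> s\<bar> \<le> 3 * (1 + 2 / r0)\<^sup>2 * (1 + s) ^ m * mixint 0 0 \<theta> s"
proof -
  let ?I = "{- sqrt 3..sqrt 3}" and ?C = "3 * (1 + 2 / r0)\<^sup>2 * (1 + s) ^ m"
  have "norm (integral ?I (\<lambda>w. w ^ a * dens_deriv m (\<theta>$2 + \<theta>$1 * w) s)) \<le> integral ?I (\<lambda>w. ?C * dens_deriv 0 (\<theta>$2 + \<theta>$1 * w) s)"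
    by (rule integral_norm_bound_integral[OF mixint_integrable])
      (use weighted_dens_deriv_le[OF assms] in \<open>auto intro!: integrable_continuous_interval continuous_intros\<close>)
  then show ?thesis by (simp add: mixint_def field_simps)
qed

text \<open>Integration by parts of -2w times \<open>dens_deriv 1\<close> with the antiderivative 3
  - w^2: the constant 3 kills both boundary terms, and differentiating \<open>dens_deriv 1\<close>
  along the rate produces the factor \<open>\<theta>$1\<close>.\<close>

lemma mixint_by_parts: "2 * mixint 1 1 \<theta> s = \<theta>$1 * (3 * mixint 0 2 \<theta> s - mixint 2 2 \<theta> s)"
proof -
  let ?I = "{- sqrt 3..sqrt 3}" and ?r = "\<lambda>w. \<theta>$2 + \<theta>$1 * w"
  have "((\<lambda>w. \<theta>$1 * (3 * (w ^ 0 * dens_deriv 2 (?r w) s) - w ^ 2 * dens_deriv 2 (?r w) s) - 2 * (w ^ 1 * dens_deriv 1 (?r w) s)) has_integral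
     (3 - (sqrt 3)\<^sup>2) * dens_deriv 1 (?r (sqrt 3)) s - (3 - (- sqrt 3)\<^sup>2) * dens_deriv 1 (?r (- sqrt 3)) s) ?I"
  proof (rule fundamental_theorem_of_calculus)
    fix w
    show "((\<lambda>w. (3 - w\<^sup>2) * dens_deriv 1 (?r w) s) has_vector_derivative
      \<theta>$1 * (3 * (w ^ 0 * dens_deriv 2 (?r w) s) - w ^ 2 * dens_deriv 2 (?r w) s) - 2 * (w ^ 1 * dens_deriv 1 (?r w) s)) (at w within ?I)"
      unfolding has_real_derivative_iff_has_vector_derivative[symmetric]
      by (auto intro!: derivative_eq_intros simp: algebra_simps numeral_2_eq_2)
  qed simp
  then have zero: "integral ?I (\<lambda>w. \<theta>$1 * (3 * (w ^ 0 * dens_deriv 2 (?r w) s) - w ^ 2 * dens_deriv 2 (?r w) s) - 2 * (w ^ 1 * dens_deriv 1 (?r w) s)) = 0"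
    by (simp add: integral_unique)
  have "((\<lambda>w. \<theta>$1 * (3 * (w ^ 0 * dens_deriv 2 (?r w) s) - w ^ 2 * dens_deriv 2 (?r w) s) - 2 * (w ^ 1 * dens_deriv 1 (?r w) s)) has_integral
     \<theta>$1 * (3 * integral ?I (\<lambda>w. w ^ 0 * dens_deriv 2 (?r w) s) - integral ?I (\<lambda>w. w ^ 2 * dens_deriv 2 (?r w) s)) - 2 * integral ?I (\<lambda>w. w ^ 1 * dens_deriv 1 (?r w) s)) ?I"
    by (intro has_integral_diff has_integral_mult_right integrable_integral mixint_integrable)
  from integral_unique[OF this, symmetric] zero have "\<theta>$1 * (3 * integral ?I (\<lambda>w. w ^ 0 * dens_deriv 2 (?r w) s) - integral ?I (\<lambda>w. w ^ 2 * dens_deriv 2 (?r w) s)) - 2 * integral ?I (\<lambda>w. w ^ 1 * dens_deriv 1 (?r w) s) = 0"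
    by (rule trans)
  then show ?thesis by (simp add: mixint_def field_simps)
qed

section \<open>The marginal law of an observation\<close>

lemma lborel_vec2_product:
  fixes f g :: "real \<Rightarrow> real"
  assumes f: "integrable lborel f" and g: "integrable lborel g"
  shows "integrable lborel (\<lambda>y::real^2. f (y$1) * g (y$2))"
    and "(\<integral>y. f (y$1) * g (y$2) \<partial>(lborel :: (real^2) measure)) = (\<integral>x. f x \<partial>lborel) * (\<integral>x. g x \<partial>lborel)"
proof -
  interpret product_sigma_finite "\<lambda>_::real^2. lborel :: real measure" by standard
  have [measurable]: "f \<in> borel_measurable borel" "g \<in> borel_measurable borel"
    using f g by auto
  have Basis: "(Basis :: (real^2) set) = {axis 1 1, axis 2 1}"
    by (auto simp: Basis_vec_def UNIV_2)
  have ne: "axis 1 1 \<noteq> (axis 2 1 :: real^2)" by (simp add: axis_eq_axis)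
  \<comment> \<open>Lebesgue measure on the plane is the image of a product measure over
    \<open>Basis\<close>, so the two factors have to be indexed by basis vectors.\<close>
  define F where "F b = (if b = axis 1 1 then f else g)" for b :: "real^2"
  let ?P = "\<Pi>\<^sub>M b\<in>(Basis :: (real^2) set). (lborel :: real measure)"
  let ?e = "\<lambda>z::real^2 \<Rightarrow> real. \<Sum>b\<in>Basis. z b *\<^sub>R b"
  have [measurable]: "?e \<in> borel_measurable ?P" by measurable
  have e: "f (?e z $ 1) * g (?e z $ 2) = (\<Prod>b\<in>Basis. F b (z b))" for z
    using ne by (simp add: Basis F_def axis_def)
  have F: "integrable lborel (F b)" for b using f g by (simp add: F_def)
  have 1: "(\<integral>y. f (y$1) * g (y$2) \<partial>(lborel :: (real^2) measure)) = (\<integral>z. f (?e z $ 1) * g (?e z $ 2) \<partial>?P)"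
    by (subst lborel_eq) (rule integral_distr, auto)
  also have "\<dots> = (\<Prod>b\<in>Basis. \<integral>x. F b x \<partial>lborel)"
    unfolding e by (rule product_integral_prod) (use F in auto)
  also have "\<dots> = (\<integral>x. f x \<partial>lborel) * (\<integral>x. g x \<partial>lborel)"
    using ne by (simp add: Basis F_def)
  finally show "(\<integral>y. f (y$1) * g (y$2) \<partial>(lborel :: (real^2) measure)) = (\<integral>x. f x \<partial>lborel) * (\<integral>x. g x \<partial>lborel)" .
  have "integrable ?P (\<lambda>z. f (?e z $ 1) * g (?e z $ 2))"
    unfolding e by (rule product_integrable_prod) (use F in auto)
  then show "integrable lborel (\<lambda>y::real^2. f (y$1) * g (y$2))"
    by (subst lborel_eq) (subst integrable_distr_eq, auto)
qed

lemma exponential_density_moment: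
  assumes "0 < l"
  shows "has_bochner_integral lborel (\<lambda>x. exponential_density l x * x ^ i) (fact i / l ^ i)"
proof (rule has_bochner_integral_nn_integral)
  show "AE x in lborel. 0 \<le> exponential_density l x * x ^ i"
    using assms by (auto simp: exponential_density_def)
  show "(\<integral>\<^sup>+x. ennreal (exponential_density l x * x ^ i) \<partial>lborel) = ennreal (fact i / l ^ i)"
    using nn_integral_erlang_ith_moment[OF assms, of 0 i] by simp
qed (use assms in auto)

definition ysum :: "real^2 \<Rightarrow> real" where "ysum y = y$1 + y$2"

definition quadrant :: "(real^2) set" where "quadrant = {y. 0 \<le> y$1 \<and> 0 \<le> y$2}"

lemma ysum_nonneg: "y \<in> quadrant \<Longrightarrow> 0 \<le> ysum y"
  by (simp add: quadrant_def ysum_def)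

lemma continuous_on_ysum [continuous_intros]:
  "continuous_on A f \<Longrightarrow> continuous_on A (\<lambda>x. ysum (f x))"
  unfolding ysum_def by (intro continuous_intros)

lemma measurable_ysum [measurable]: "ysum \<in> borel_measurable borel"
  by (intro borel_measurable_continuous_onI continuous_intros)

lemma sets_quadrant [measurable]: "quadrant \<in> sets borel"
proof -
  have "closed quadrant" unfolding quadrant_def by (intro closed_Collect_conj closed_Collect_le continuous_intros)
  then show ?thesis by auto
qed

lemma cond_density_eq:
  "cond_density \<theta> w y = indicator quadrant y * dens_deriv 0 (\<theta>$2 + \<theta>$1 * w) (ysum y)"
  by (auto simp: cond_density_def exponential_density_def quadrant_def ysum_def dens_deriv_0 UNIV_2 power2_eq_square
      exp_add[symmetric] algebra_simps indicator_def)

text \<open>The joint density of two independent exponential variables with rate \<open>r\<close>,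
  in the form that shows its dependence on the sum.\<close>

definition exp2 :: "real \<Rightarrow> real^2 \<Rightarrow> real" where
  "exp2 r y = indicator quadrant y * dens_deriv 0 r (ysum y)"

lemma exp2_eq: "exp2 r y = exponential_density r (y$1) * exponential_density r (y$2)"
  using cond_density_eq[of "vector [0, r]" 0 y] by (simp add: exp2_def cond_density_def UNIV_2)

lemma exp2_moment:
  assumes "0 < r"
  shows "has_bochner_integral lborel (\<lambda>y. (y$1) ^ i * (y$2) ^ j * exp2 r y) (fact i / r ^ i * (fact j / r ^ j))"
proof -
  note i = exponential_density_moment[OF assms, of i, THEN has_bochner_integral_iff[THEN iffD1]]
  note j = exponential_density_moment[OF assms, of j, THEN has_bochner_integral_iff[THEN iffD1]]
  have eq: "(y$1) ^ i * (y$2) ^ j * exp2 r y = (exponential_density r (y$1) * (y$1) ^ i) * (exponential_density r (y$2) * (y$2) ^ j)" for y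
    by (simp add: exp2_eq mult_ac)
  show ?thesis
    unfolding has_bochner_integral_iff eq
    using lborel_vec2_product[OF conjunct1[OF i] conjunct1[OF j]] conjunct2[OF i] conjunct2[OF j] by simp
qed

text \<open>These are the derivatives in r of the total mass, which is constantly 1. No interchange
  of limits is used: the derivative is the density times a polynomial in y, and the moments of the
  exponential law cancel.\<close>

lemma integral_dens_deriv:
  assumes "0 < r" "m = 1 \<or> m = 2"
  shows "has_bochner_integral lborel (\<lambda>y. indicator quadrant y * dens_deriv m r (ysum y)) 0"
proof -
  note M = exp2_moment[OF assms(1)]
  have "has_bochner_integral lborel (\<lambda>y. 2 / r * ((y$1) ^ 0 * (y$2) ^ 0 * exp2 r y) - ((y$1) ^ 1 * (y$2) ^ 0 * exp2 r y) - ((y$1) ^ 0 * (y$2) ^ 1 * exp2 r y))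
     (2 / r * (fact 0 / r ^ 0 * (fact 0 / r ^ 0)) - (fact 1 / r ^ 1 * (fact 0 / r ^ 0)) - (fact 0 / r ^ 0 * (fact 1 / r ^ 1)))"
    by (intro has_bochner_integral_diff has_bochner_integral_mult_right M)
  moreover have "2 / r * ((y$1) ^ 0 * (y$2) ^ 0 * exp2 r y) - ((y$1) ^ 1 * (y$2) ^ 0 * exp2 r y) - ((y$1) ^ 0 * (y$2) ^ 1 * exp2 r y)
     = indicator quadrant y * dens_deriv 1 r (ysum y)" for y
    using assms by (simp add: exp2_def dens_deriv_0 dens_deriv_1[simplified] ysum_def field_simps power2_eq_square)
  moreover have "has_bochner_integral lborel (\<lambda>y. 2 / r\<^sup>2 * ((y$1) ^ 0 * (y$2) ^ 0 * exp2 r y) - 4 / r * ((y$1) ^ 1 * (y$2) ^ 0 * exp2 r y) - 4 / r * ((y$1) ^ 0 * (y$2) ^ 1 * exp2 r y)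
      + ((y$1) ^ 2 * (y$2) ^ 0 * exp2 r y) + 2 * ((y$1) ^ 1 * (y$2) ^ 1 * exp2 r y) + ((y$1) ^ 0 * (y$2) ^ 2 * exp2 r y))
     (2 / r\<^sup>2 * (fact 0 / r ^ 0 * (fact 0 / r ^ 0)) - 4 / r * (fact 1 / r ^ 1 * (fact 0 / r ^ 0)) - 4 / r * (fact 0 / r ^ 0 * (fact 1 / r ^ 1))
      + (fact 2 / r ^ 2 * (fact 0 / r ^ 0)) + 2 * (fact 1 / r ^ 1 * (fact 1 / r ^ 1)) + (fact 0 / r ^ 0 * (fact 2 / r ^ 2)))"
    by (intro has_bochner_integral_diff has_bochner_integral_add has_bochner_integral_mult_right M)
  moreover have "2 / r\<^sup>2 * ((y$1) ^ 0 * (y$2) ^ 0 * exp2 r y) - 4 / r * ((y$1) ^ 1 * (y$2) ^ 0 * exp2 r y) - 4 / r * ((y$1) ^ 0 * (y$2) ^ 1 * exp2 r y)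
      + ((y$1) ^ 2 * (y$2) ^ 0 * exp2 r y) + 2 * ((y$1) ^ 1 * (y$2) ^ 1 * exp2 r y) + ((y$1) ^ 0 * (y$2) ^ 2 * exp2 r y)
     = indicator quadrant y * dens_deriv 2 r (ysum y)" for y
    using assms by (simp add: exp2_def dens_deriv_0 dens_deriv_2 ysum_def field_simps power2_eq_square)
  ultimately show ?thesis using assms by (auto simp: field_simps power2_eq_square)
qed

lemma integral_mixing_law:
  fixes f :: "real \<Rightarrow> real"
  assumes "continuous_on UNIV f"
  shows "(\<integral>w. f w \<partial>mixing_law) = integral {- sqrt 3..sqrt 3} f / (2 * sqrt 3)"
proof -
  have [measurable]: "f \<in> borel_measurable borel" by (rule borel_measurable_continuous_onI) fact
  have "(\<integral>w. f w \<partial>mixing_law) = (\<integral>w. (indicator {- sqrt 3<..<sqrt 3} w / (2 * sqrt 3)) *\<^sub>R f w \<partial>lborel)"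
  proof -
    have "mixing_law = density lborel (\<lambda>w. ennreal (indicator {- sqrt 3<..<sqrt 3} w / (2 * sqrt 3)))"
      unfolding mixing_law_def uniform_measure_def
      by (intro density_cong) (auto simp: indicator_def divide_ennreal[symmetric])
    from arg_cong[OF this, of "\<lambda>M. integral\<^sup>L M f"] show ?thesis
      by (rule trans) (rule integral_density, auto)
  qed
  also have "\<dots> = (LINT w:{- sqrt 3<..<sqrt 3}|lborel. f w) / (2 * sqrt 3)"
    unfolding set_lebesgue_integral_def by (subst integral_divide_zero[symmetric]) (simp add: mult.commute)
  also have "(LINT w:{- sqrt 3<..<sqrt 3}|lborel. f w) = integral {- sqrt 3<..<sqrt 3} f"
  proof (rule set_borel_integral_eq_integral)
    have "set_integrable lborel {- sqrt 3..sqrt 3} f"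
      unfolding set_integrable_def by (intro borel_integrable_compact continuous_on_subset[OF assms]) auto
    then show "set_integrable lborel {- sqrt 3<..<sqrt 3} f"
      by (rule set_integrable_subset) auto
  qed
  finally show ?thesis by (simp add: integral_open_interval_real)
qed

lemma mixed_density_eq: "mixed_density \<theta> y = indicator quadrant y * mixint 0 0 \<theta> (ysum y)"
  unfolding mixed_density_def cond_density_eq integral_mult_right_zero
  by (subst integral_mixing_law) (auto simp: mixint_def intro!: continuous_intros)

lemma mixint_eq_mixing_law: "mixint a m \<theta> s = (\<integral>w. w ^ a * dens_deriv m (\<theta>$2 + \<theta>$1 * w) s \<partial>mixing_law)"
  by (subst integral_mixing_law) (auto simp: mixint_def intro!: continuous_intros)

text \<open>Half of the exponential decay absorbs the polynomial, and the other half is a multiple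
  of the density with rate r / 2.\<close>

lemma envelope_integrable:
  assumes "0 < r"
  shows "integrable lborel (\<lambda>y. indicator quadrant y * ((1 + ysum y) ^ 6 * exp (- ysum y * r)))"
proof -
  \<comment> \<open>The value 12 / r is chosen so that 1 + s \<le> k (1 + x / 6) with x = s r / 2,
    because (1 + x / 6)^6 \<le> exp x is available.\<close>
  define k where "k = max 1 (12 / r)"
  have k: "1 \<le> k" "12 / r \<le> k" by (simp_all add: k_def)
  have int: "integrable lborel (\<lambda>y. k ^ 6 * (4 / r\<^sup>2) * ((y$1) ^ 0 * (y$2) ^ 0 * exp2 (r / 2) y))"
    using exp2_moment[of "r / 2" 0 0] assms by (intro integrable_mult_right) (simp add: has_bochner_integral_iff)
  show ?thesis
  proof (rule Bochner_Integration.integrable_bound[OF int])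
    show "AE y in lborel. norm (indicator quadrant y * ((1 + ysum y) ^ 6 * exp (- ysum y * r))) \<le> norm (k ^ 6 * (4 / r\<^sup>2) * ((y$1) ^ 0 * (y$2) ^ 0 * exp2 (r / 2) y))"
    proof (rule AE_I2)
      fix y :: "real^2"
      show "norm (indicator quadrant y * ((1 + ysum y) ^ 6 * exp (- ysum y * r))) \<le> norm (k ^ 6 * (4 / r\<^sup>2) * ((y$1) ^ 0 * (y$2) ^ 0 * exp2 (r / 2) y))"
      proof (cases "y \<in> quadrant")
        case True
        define s where "s = ysum y"
        have s: "0 \<le> s" using ysum_nonneg[OF True] by (simp add: s_def)
        have "1 + s \<le> k * (1 + (s * (r / 2)) / real 6)"
        proof -
          have "12 / r * (s * r / 12) \<le> k * (s * r / 12)" using k s assms by (intro mult_right_mono) auto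
          then have "s \<le> k * (s * r / 12)" using assms by simp
          then show ?thesis using k by (simp add: ring_distribs)
        qed
        then have "(1 + s) ^ 6 \<le> (k * (1 + (s * (r / 2)) / real 6)) ^ 6" using s by (intro power_mono) auto
        also have "\<dots> = k ^ 6 * (1 + (s * (r / 2)) / real 6) ^ 6" by (rule power_mult_distrib)
        also have "\<dots> \<le> k ^ 6 * exp (s * (r / 2))"
        proof (rule mult_left_mono)
          have "0 \<le> s * (r / 2)" using s assms by simp
          then have "- real 6 \<le> s * (r / 2)" by linarith
          then show "(1 + (s * (r / 2)) / real 6) ^ 6 \<le> exp (s * (r / 2))"
            by (intro exp_ge_one_plus_x_over_n_power_n) auto
        qed (use k in simp)
        finally have "(1 + s) ^ 6 * exp (- s * r) \<le> k ^ 6 * exp (s * (r / 2)) * exp (- s * r)"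
          by (rule mult_right_mono) simp
        also have "\<dots> = k ^ 6 * exp (- s * (r / 2))"
          by (simp add: exp_add[symmetric] mult.assoc)
        finally show ?thesis using True assms k s
          by (simp add: exp2_def dens_deriv_0 abs_mult s_def[symmetric] power2_eq_square)
      qed (simp add: exp2_def)
    qed
  qed simp
qed

section \<open>Bounds uniform over compact parameter sets\<close>

text \<open>The rates at \<theta> lie between \<open>r0\<close> and \<open>r1\<close> for every w in
  the support. Estimates that depend on \<theta> only through this pair are uniform over a compact
  set.\<close>

definition rates :: "real \<Rightarrow> real \<Rightarrow> real^2 \<Rightarrow> bool" where
  "rates r0 r1 \<theta> \<longleftrightarrow> 0 < r0 \<and> r0 \<le> \<theta>$2 - sqrt 3 * \<bar>\<theta>$1\<bar> \<and> \<theta>$2 + sqrt 3 * \<bar>\<theta>$1\<bar> \<le> r1"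

lemma rates_ext_space: "rates r0 r1 \<theta> \<Longrightarrow> \<theta> \<in> ext_space"
  by (auto simp: rates_def ext_space_def)

lemma rates_self: "\<theta> \<in> ext_space \<Longrightarrow> rates (\<theta>$2 - sqrt 3 * \<bar>\<theta>$1\<bar>) (\<theta>$2 + sqrt 3 * \<bar>\<theta>$1\<bar>) \<theta>"
  by (auto simp: rates_def ext_space_def)

lemma rates_compact:
  assumes "compact C" "C \<subseteq> ext_space"
  obtains r0 r1 where "0 < r0" "\<And>\<theta>. \<theta> \<in> C \<Longrightarrow> rates r0 r1 \<theta>"
proof (cases "C = {}")
  case False
  obtain x where x: "x \<in> C" "\<And>\<theta>. \<theta> \<in> C \<Longrightarrow> x$2 - sqrt 3 * \<bar>x$1\<bar> \<le> \<theta>$2 - sqrt 3 * \<bar>\<theta>$1\<bar>"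
    using continuous_attains_inf[OF assms(1) False, of "\<lambda>\<theta>. \<theta>$2 - sqrt 3 * \<bar>\<theta>$1\<bar>"]
    by (force intro: continuous_intros)
  obtain z where z: "z \<in> C" "\<And>\<theta>. \<theta> \<in> C \<Longrightarrow> \<theta>$2 + sqrt 3 * \<bar>\<theta>$1\<bar> \<le> z$2 + sqrt 3 * \<bar>z$1\<bar>"
    using continuous_attains_sup[OF assms(1) False, of "\<lambda>\<theta>. \<theta>$2 + sqrt 3 * \<bar>\<theta>$1\<bar>"]
    by (force intro: continuous_intros)
  show thesis
    using that[of "x$2 - sqrt 3 * \<bar>x$1\<bar>" "z$2 + sqrt 3 * \<bar>z$1\<bar>"] x z assms(2)
    by (auto simp: rates_def ext_space_def)
qed (use that[of 1] in auto)

lemma mixint_bound: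
  assumes "rates r0 r1 \<theta>" "0 \<le> s" "a \<le> 2" "m \<le> 2"
  shows "\<bar>mixint a m \<theta> s\<bar> \<le> 3 * (1 + 2 / r0)\<^sup>2 * (1 + s) ^ m * mixint 0 0 \<theta> s"
  using assms by (intro mixint_le) (auto simp: rates_def)

lemma mixint_00_le:
  assumes "rates r0 r1 \<theta>" "0 \<le> s"
  shows "mixint 0 0 \<theta> s \<le> r1\<^sup>2 * exp (- s * r0)" "r0\<^sup>2 * exp (- s * r1) \<le> mixint 0 0 \<theta> s"
  using assms mixint_00_bounds[of r0 \<theta> r1 s] by (auto simp: rates_def)

lemma measurable_mixint [measurable]: "(\<lambda>s. mixint a m \<theta> s) \<in> borel_measurable borel"
  by (intro borel_measurable_continuous_onI continuous_intros)

definition envelope :: "real \<Rightarrow> real^2 \<Rightarrow> real" where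
  "envelope r y = indicator quadrant y * ((1 + ysum y) ^ 6 * exp (- ysum y * r))"

lemma integrable_envelope: "0 < r \<Longrightarrow> integrable lborel (envelope r)"
  unfolding envelope_def[abs_def] by (rule envelope_integrable)

lemma measurable_envelope [measurable]: "envelope r \<in> borel_measurable borel"
  unfolding envelope_def[abs_def] by measurable

lemma envelope_nonneg: "0 \<le> envelope r y"
  by (auto simp: envelope_def indicator_def ysum_nonneg)

lemma mixed_density_envelope:
  assumes "rates r0 r1 \<theta>"
  shows "0 \<le> mixed_density \<theta> y" "mixed_density \<theta> y * (1 + ysum y) ^ 6 \<le> r1\<^sup>2 * envelope r0 y"
  using mixint_00_le[OF assms, of "ysum y"] ysum_nonneg[of y] mixint_00_pos[OF rates_ext_space[OF assms], of "ysum y"]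
  by (auto simp: mixed_density_eq envelope_def indicator_def less_imp_le mult_ac intro: mult_left_mono)

text \<open>After exchanging the integrals over y and w, the inner one is zero by
  \<open>integral_dens_deriv\<close>; the envelope justifies the exchange. This is the source of the
  mean zero property of the score.\<close>

lemma integral_mixint_quadrant:
  assumes r: "rates r0 r1 \<theta>" and a: "a \<le> 2" and m: "m = 1 \<or> m = 2"
  shows "integrable lborel (\<lambda>y. indicator quadrant y * mixint a m \<theta> (ysum y))"
    and "(\<integral>y. indicator quadrant y * mixint a m \<theta> (ysum y) \<partial>lborel) = 0"
proof -
  interpret mix: prob_space mixing_law by (rule prob_space_mixing_law)
  interpret pair_sigma_finite mixing_law "lborel :: (real^2) measure" ..
  define K where "K = 3 * (1 + 2 / r0)\<^sup>2 * r1\<^sup>2"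
  let ?f = "\<lambda>w y. indicator quadrant y * (w ^ a * dens_deriv m (\<theta>$2 + \<theta>$1 * w) (ysum y))"
  have K: "0 \<le> K" by (simp add: K_def)
  have bound: "norm (?f w y) \<le> K * envelope r0 y" if w: "w \<in> {- sqrt 3..sqrt 3}" for w y
  proof (cases "y \<in> quadrant")
    case True
    note s = ysum_nonneg[OF True]
    define \<rho> where "\<rho> = \<theta>$2 + \<theta>$1 * w"
    have \<rho>: "r0 \<le> \<rho>" "\<rho> \<le> r1" "0 < r0"
      using ext_rate_bounds[OF w, of \<theta>] r by (auto simp: rates_def \<rho>_def)
    have h0: "dens_deriv 0 \<rho> (ysum y) \<le> r1\<^sup>2 * exp (- ysum y * r0)"
      unfolding dens_deriv_0 using \<rho> s by (intro mult_mono power_mono) (auto intro!: mult_left_mono)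
    have "norm (w ^ a * dens_deriv m \<rho> (ysum y)) \<le> 3 * (1 + 2 / r0)\<^sup>2 * (1 + ysum y) ^ m * dens_deriv 0 \<rho> (ysum y)"
      using weighted_dens_deriv_le[of r0 \<theta> "ysum y" a m w] r a m s w by (auto simp: rates_def \<rho>_def)
    also have "\<dots> \<le> 3 * (1 + 2 / r0)\<^sup>2 * (1 + ysum y) ^ 6 * (r1\<^sup>2 * exp (- ysum y * r0))"
      using s m \<rho> by (intro mult_mono h0 power_increasing) (auto simp: dens_deriv_0)
    finally show ?thesis using True by (simp add: envelope_def K_def \<rho>_def mult_ac)
  qed (simp add: envelope_def)
  have AEw: "AE w in mixing_law. w \<in> {- sqrt 3..sqrt 3}"
    using AE_mixing_law by eventually_elim auto
  have [measurable]: "(\<lambda>(w, y). ?f w y) \<in> borel_measurable (mixing_law \<Otimes>\<^sub>M lborel)"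
    unfolding dens_deriv_def by measurable
  have env: "integrable lborel (\<lambda>y. K * envelope r0 y)"
    using r by (intro integrable_mult_right integrable_envelope) (auto simp: rates_def)
  have inty: "integrable lborel (?f w)" if w: "w \<in> {- sqrt 3..sqrt 3}" for w
  proof (rule Bochner_Integration.integrable_bound[OF env])
    show "AE y in lborel. norm (?f w y) \<le> norm (K * envelope r0 y)"
      using bound[OF w] K envelope_nonneg by (auto simp: abs_mult abs_of_nonneg)
    show "?f w \<in> borel_measurable lborel" unfolding dens_deriv_def by measurable
  qed
  have int: "integrable (mixing_law \<Otimes>\<^sub>M lborel) (\<lambda>(w, y). ?f w y)"
  proof (rule Fubini_integrable)
    show "integrable mixing_law (\<lambda>w. \<integral>y. norm (case (w, y) of (w, y) \<Rightarrow> ?f w y) \<partial>lborel)"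
    proof (rule mix.integrable_const_bound[where B = "\<integral>y. K * envelope r0 y \<partial>lborel"])
      show "AE w in mixing_law. norm (\<integral>y. norm (case (w, y) of (w, y) \<Rightarrow> ?f w y) \<partial>lborel) \<le> (\<integral>y. K * envelope r0 y \<partial>lborel)"
        using AEw
      proof eventually_elim
        case (elim w)
        have "(\<integral>y. norm (?f w y) \<partial>lborel) \<le> (\<integral>y. K * envelope r0 y \<partial>lborel)"
          by (intro integral_mono integrable_norm inty env bound elim)
        then show ?case by simp
      qed
    qed measurable
    show "AE w in mixing_law. integrable lborel (\<lambda>y. case (w, y) of (w, y) \<Rightarrow> ?f w y)"
      using AEw by eventually_elim (simp add: inty)
  qed measurable
  have eq: "(\<integral>w. ?f w y \<partial>mixing_law) = indicator quadrant y * mixint a m \<theta> (ysum y)" for y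
    by (simp only: integral_mult_right_zero mixint_eq_mixing_law)
  show "integrable lborel (\<lambda>y. indicator quadrant y * mixint a m \<theta> (ysum y))"
    using integrable_snd[OF int] by (simp only: eq)
  have "(\<integral>y. indicator quadrant y * mixint a m \<theta> (ysum y) \<partial>lborel) = (\<integral>w. \<integral>y. ?f w y \<partial>lborel \<partial>mixing_law)"
    using Fubini_integral[OF int] by (simp only: eq)
  also have "\<dots> = (\<integral>w. 0 \<partial>mixing_law)"
  proof (rule integral_cong_AE)
    show "AE w in mixing_law. (\<integral>y. ?f w y \<partial>lborel) = 0"
      using AEw
    proof eventually_elim
      case (elim w)
      have "has_bochner_integral lborel (\<lambda>y. indicator quadrant y * dens_deriv m (\<theta>$2 + \<theta>$1 * w) (ysum y)) 0"
        using ext_rate_bounds[OF elim, of \<theta>] r m by (intro integral_dens_deriv) (auto simp: rates_def)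
      then have "(\<integral>y. w ^ a * (indicator quadrant y * dens_deriv m (\<theta>$2 + \<theta>$1 * w) (ysum y)) \<partial>lborel) = 0"
        by (simp add: has_bochner_integral_iff)
      then show ?case by (simp only: mult_ac)
    qed
  qed auto
  finally show "(\<integral>y. indicator quadrant y * mixint a m \<theta> (ysum y) \<partial>lborel) = 0" by simp
qed

text \<open>The partial derivatives of the log-likelihood, the one in \<open>\<theta>$1\<close> divided by \<open>\<theta>$1\<close>: the quotient
  is put into the form given by \<open>mixint_by_parts\<close>, which makes sense at \<open>\<theta>$1 = 0\<close>.\<close>

definition nscore :: "2 \<Rightarrow> real^2 \<Rightarrow> real \<Rightarrow> real" where
  "nscore j \<theta> s = (if j = 1 then (3 * mixint 0 2 \<theta> s - mixint 2 2 \<theta> s) / 2 else mixint 0 1 \<theta> s) / mixint 0 0 \<theta> s"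

lemma continuous_on_nscore:
  fixes f :: "'a::topological_space \<Rightarrow> real^2"
  assumes "continuous_on A f" "continuous_on A g" "f ` A \<subseteq> ext_space"
  shows "continuous_on A (\<lambda>x. nscore j (f x) (g x))"
proof -
  have "\<forall>x\<in>A. mixint 0 0 (f x) (g x) \<noteq> 0"
    using assms(3) mixint_00_pos by (metis image_subset_iff less_irrefl)
  then show ?thesis
    unfolding nscore_def by (cases "j = 1") (auto intro!: continuous_intros assms(1,2))
qed

lemma measurable_nscore [measurable]: "(\<lambda>s. nscore j \<theta> s) \<in> borel_measurable borel"
  unfolding nscore_def by measurable

lemma nscore_bound:
  assumes r: "rates r0 r1 \<theta>" and s: "0 \<le> s"
  shows "\<bar>nscore j \<theta> s\<bar> \<le> 6 * (1 + 2 / r0)\<^sup>2 * (1 + s)\<^sup>2"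
proof -
  have pos: "0 < mixint 0 0 \<theta> s" by (rule mixint_00_pos) (rule rates_ext_space[OF r])
  note b = mixint_bound[OF r s]
  have "\<bar>mixint 0 1 \<theta> s\<bar> \<le> 3 * (1 + 2 / r0)\<^sup>2 * (1 + s) ^ 1 * mixint 0 0 \<theta> s" by (rule b) auto
  also have "\<dots> \<le> 6 * (1 + 2 / r0)\<^sup>2 * (1 + s)\<^sup>2 * mixint 0 0 \<theta> s"
    using s pos by (intro mult_right_mono mult_mono power_increasing) auto
  finally have 2: "\<bar>mixint 0 1 \<theta> s\<bar> \<le> 6 * (1 + 2 / r0)\<^sup>2 * (1 + s)\<^sup>2 * mixint 0 0 \<theta> s" .
  \<comment> \<open>Each second-order integral carries the constant 3 from
    \<open>mixint_bound\<close>, and (3 * 3 + 3) / 2 = 6.\<close>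
  have "\<bar>(3 * mixint 0 2 \<theta> s - mixint 2 2 \<theta> s) / 2\<bar> \<le> (3 * \<bar>mixint 0 2 \<theta> s\<bar> + \<bar>mixint 2 2 \<theta> s\<bar>) / 2"
    using abs_triangle_ineq4[of "3 * mixint 0 2 \<theta> s" "mixint 2 2 \<theta> s"] by (simp add: abs_mult)
  also have "\<dots> \<le> 6 * (1 + 2 / r0)\<^sup>2 * (1 + s)\<^sup>2 * mixint 0 0 \<theta> s"
    using b[of 0 2] b[of 2 2] by simp
  finally show ?thesis using 2 pos by (auto simp: nscore_def abs_mult pos_divide_le_eq)
qed

lemma measurable_mixed_density [measurable]: "mixed_density \<theta> \<in> borel_measurable borel"
  unfolding mixed_density_eq[abs_def] by measurable

lemma mixed_density_nonneg: "\<theta> \<in> ext_space \<Longrightarrow> 0 \<le> mixed_density \<theta> y"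
  using mixint_00_pos[of \<theta> "ysum y"] by (simp add: mixed_density_eq indicator_def)

lemma sets_obs_law [simp, measurable_cong]: "sets (obs_law \<theta>) = sets borel"
  by (simp add: obs_law_def)

lemma space_obs_law [simp]: "space (obs_law \<theta>) = UNIV"
  by (simp add: obs_law_def)

lemma integral_obs_law:
  fixes g :: "real^2 \<Rightarrow> real"
  assumes \<theta>: "\<theta> \<in> param_space" and [measurable]: "g \<in> borel_measurable borel"
  shows "(\<integral>y. g y \<partial>obs_law \<theta>) = (\<integral>y. mixed_density \<theta> y * g y \<partial>lborel)"
    and "integrable (obs_law \<theta>) g \<longleftrightarrow> integrable lborel (\<lambda>y. mixed_density \<theta> y * g y)"
  using mixed_density_nonneg[of \<theta>] param_space_subset \<theta>
  unfolding obs_law_eq_density[OF \<theta>]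
  by (subst integral_density integrable_density; auto)+

lemma prob_space_obs_law:
  assumes \<theta>: "\<theta> \<in> param_space"
  shows "prob_space (obs_law \<theta>)"
proof
  interpret mix: prob_space mixing_law by (rule prob_space_mixing_law)
  interpret pair_sigma_finite mixing_law "lborel :: (real^2) measure" ..
  have [measurable]: "(\<lambda>(w, y). ennreal (cond_density \<theta> w y)) \<in> borel_measurable (mixing_law \<Otimes>\<^sub>M lborel)"
    using measurable_cond_density[of \<theta>] by measurable
  have "emeasure (obs_law \<theta>) (space (obs_law \<theta>)) = (\<integral>\<^sup>+y. ennreal (mixed_density \<theta> y) \<partial>lborel)"
    unfolding obs_law_eq_density[OF \<theta>] by (subst emeasure_density) auto
  also have "\<dots> = (\<integral>\<^sup>+y. \<integral>\<^sup>+w. ennreal (cond_density \<theta> w y) \<partial>mixing_law \<partial>lborel)"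
    by (simp add: nn_integral_cond_density[OF \<theta>])
  also have "\<dots> = (\<integral>\<^sup>+w. \<integral>\<^sup>+y. ennreal (cond_density \<theta> w y) \<partial>lborel \<partial>mixing_law)"
    by (rule Fubini') simp
  also have "\<dots> = (\<integral>\<^sup>+w. 1 \<partial>mixing_law)"
  proof (rule nn_integral_cong_AE)
    show "AE w in mixing_law. (\<integral>\<^sup>+y. ennreal (cond_density \<theta> w y) \<partial>lborel) = 1"
      using AE_mixing_law
    proof eventually_elim
      case (elim w)
      note r = rate_bounds(1)[OF \<theta> elim]
      have "has_bochner_integral lborel (\<lambda>y. (y$1) ^ 0 * (y$2) ^ 0 * exp2 (\<theta>$2 + \<theta>$1 * w) y) 1"
        using exp2_moment[OF r, of 0 0] by simp
      then have "(\<integral>\<^sup>+y. ennreal (exp2 (\<theta>$2 + \<theta>$1 * w) y) \<partial>lborel) = 1"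
        by (subst nn_integral_eq_integral) (auto simp: has_bochner_integral_iff, simp add: exp2_def dens_deriv_0)
      then show ?case by (simp only: cond_density_eq exp2_def)
    qed
  qed
  finally show "emeasure (obs_law \<theta>) (space (obs_law \<theta>)) = 1"
    by (simp add: mix.emeasure_space_1[simplified])
qed

section \<open>Covariance of the normalized score\<close>

lemma AE_obs_law_quadrant:
  assumes \<theta>: "\<theta> \<in> param_space"
  shows "AE y in obs_law \<theta>. y \<in> quadrant"
  unfolding obs_law_eq_density[OF \<theta>]
  by (subst AE_density) (auto simp: mixed_density_eq indicator_def)

text \<open>The envelope dominates density times sixth power, and the resulting bound sees \<theta>
  only through \<open>r0\<close> and \<open>r1\<close>. This later gives third moments bounded along
  a whole sequence of parameters.\<close>

lemma obs_law_integrable: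
  fixes g :: "real^2 \<Rightarrow> real"
  assumes \<theta>: "\<theta> \<in> param_space" and r: "rates r0 r1 \<theta>" and [measurable]: "g \<in> borel_measurable borel"
    and K: "0 \<le> K" and g: "\<And>y. y \<in> quadrant \<Longrightarrow> \<bar>g y\<bar> \<le> K * (1 + ysum y) ^ 6"
  shows "integrable (obs_law \<theta>) g"
    and "(\<integral>y. g y \<partial>obs_law \<theta>) \<le> K * r1\<^sup>2 * (\<integral>y. envelope r0 y \<partial>lborel)"
proof -
  note md = mixed_density_envelope[OF r]
  have bound: "\<bar>mixed_density \<theta> y * g y\<bar> \<le> K * r1\<^sup>2 * envelope r0 y" for y
  proof (cases "y \<in> quadrant")
    case True
    have "\<bar>mixed_density \<theta> y * g y\<bar> \<le> mixed_density \<theta> y * (K * (1 + ysum y) ^ 6)"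
      using g[OF True] md(1) by (simp add: abs_mult mult_left_mono)
    also have "\<dots> = K * (mixed_density \<theta> y * (1 + ysum y) ^ 6)" by simp
    also have "\<dots> \<le> K * (r1\<^sup>2 * envelope r0 y)" by (intro mult_left_mono md K)
    finally show ?thesis by simp
  qed (simp add: mixed_density_eq envelope_nonneg K)
  have env: "integrable lborel (\<lambda>y. K * r1\<^sup>2 * envelope r0 y)"
    using r by (intro integrable_mult_right integrable_envelope) (auto simp: rates_def)
  have int: "integrable lborel (\<lambda>y. mixed_density \<theta> y * g y)"
    by (rule Bochner_Integration.integrable_bound[OF env])
      (use bound order_trans[OF bound abs_ge_self] in auto)
  show "integrable (obs_law \<theta>) g" using int by (simp add: integral_obs_law[OF \<theta>])
  have "(\<integral>y. g y \<partial>obs_law \<theta>) = (\<integral>y. mixed_density \<theta> y * g y \<partial>lborel)"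
    by (simp add: integral_obs_law[OF \<theta>])
  also have "\<dots> \<le> (\<integral>y. K * r1\<^sup>2 * envelope r0 y \<partial>lborel)"
    by (intro integral_mono int env) (use bound order_trans[OF abs_ge_self bound] in auto)
  finally show "(\<integral>y. g y \<partial>obs_law \<theta>) \<le> K * r1\<^sup>2 * (\<integral>y. envelope r0 y \<partial>lborel)" by simp
qed

lemma nscore_power_bound:
  assumes r: "rates r0 r1 \<theta>" and s: "0 \<le> s" and "p \<le> 3"
  shows "\<bar>nscore j \<theta> s\<bar> ^ p \<le> (6 * (1 + 2 / r0)\<^sup>2) ^ p * (1 + s) ^ 6"
proof -
  have "\<bar>nscore j \<theta> s\<bar> ^ p \<le> (6 * (1 + 2 / r0)\<^sup>2 * (1 + s)\<^sup>2) ^ p"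
    by (intro power_mono nscore_bound[OF r s]) auto
  also have "\<dots> = (6 * (1 + 2 / r0)\<^sup>2) ^ p * (1 + s) ^ (2 * p)" by (simp add: power_mult_distrib power_mult)
  also have "\<dots> \<le> (6 * (1 + 2 / r0)\<^sup>2) ^ p * (1 + s) ^ 6"
    using assms by (intro mult_left_mono power_increasing) auto
  finally show ?thesis .
qed

lemma nscore_product_bound:
  assumes r: "rates r0 r1 \<theta>" and s: "0 \<le> s"
  shows "\<bar>nscore i \<theta> s * nscore j \<theta> s\<bar> \<le> (6 * (1 + 2 / r0)\<^sup>2)\<^sup>2 * (1 + s) ^ 6"
proof -
  have "\<bar>nscore i \<theta> s * nscore j \<theta> s\<bar> \<le> (6 * (1 + 2 / r0)\<^sup>2 * (1 + s)\<^sup>2) * (6 * (1 + 2 / r0)\<^sup>2 * (1 + s)\<^sup>2)"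
    unfolding abs_mult by (intro mult_mono nscore_bound[OF r s]) auto
  also have "\<dots> = (6 * (1 + 2 / r0)\<^sup>2)\<^sup>2 * (1 + s) ^ 4" by algebra
  also have "\<dots> \<le> (6 * (1 + 2 / r0)\<^sup>2)\<^sup>2 * (1 + s) ^ 6"
    using s by (intro mult_left_mono power_increasing) auto
  finally show ?thesis .
qed

lemma nscore_integrable:
  assumes \<theta>: "\<theta> \<in> param_space"
  shows "integrable (obs_law \<theta>) (\<lambda>y. nscore j \<theta> (ysum y))"
    and "integrable (obs_law \<theta>) (\<lambda>y. nscore i \<theta> (ysum y) * nscore j \<theta> (ysum y))"
proof -
  have "\<theta> \<in> ext_space" using \<theta> param_space_subset by auto
  note r = rates_self[OF this]
  let ?K = "6 * (1 + 2 / (\<theta>$2 - sqrt 3 * \<bar>\<theta>$1\<bar>))\<^sup>2"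
  have "\<bar>nscore j \<theta> (ysum y)\<bar> \<le> ?K * (1 + ysum y) ^ 6" if "y \<in> quadrant" for y
    using nscore_power_bound[OF r ysum_nonneg[OF that], of 1 j] by simp
  from obs_law_integrable(1)[OF \<theta> r _ _ this]
  show "integrable (obs_law \<theta>) (\<lambda>y. nscore j \<theta> (ysum y))" by simp
  have "\<bar>nscore i \<theta> (ysum y) * nscore j \<theta> (ysum y)\<bar> \<le> ?K\<^sup>2 * (1 + ysum y) ^ 6" if "y \<in> quadrant" for y
    by (rule nscore_product_bound[OF r ysum_nonneg[OF that]])
  from obs_law_integrable(1)[OF \<theta> r _ _ this]
  show "integrable (obs_law \<theta>) (\<lambda>y. nscore i \<theta> (ysum y) * nscore j \<theta> (ysum y))" by simp
qed

lemma nscore_mean: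
  assumes \<theta>: "\<theta> \<in> param_space"
  shows "(\<integral>y. nscore j \<theta> (ysum y) \<partial>obs_law \<theta>) = 0"
proof -
  have E: "\<theta> \<in> ext_space" using \<theta> param_space_subset by auto
  note r = rates_self[OF E]
  have pos: "mixint 0 0 \<theta> s \<noteq> 0" for s using mixint_00_pos[OF E, of s] by simp
  have "(\<integral>y. nscore j \<theta> (ysum y) \<partial>obs_law \<theta>) = (\<integral>y. mixed_density \<theta> y * nscore j \<theta> (ysum y) \<partial>lborel)"
    by (simp add: integral_obs_law[OF \<theta>])
  also have "\<dots> = (if j = 1 then (\<integral>y. (3 * (indicator quadrant y * mixint 0 2 \<theta> (ysum y)) - indicator quadrant y * mixint 2 2 \<theta> (ysum y)) / 2 \<partial>lborel)
     else (\<integral>y. indicator quadrant y * mixint 0 1 \<theta> (ysum y) \<partial>lborel))"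
    using pos by (auto intro!: Bochner_Integration.integral_cong simp: nscore_def mixed_density_eq algebra_simps)
  also have "\<dots> = 0"
    using integral_mixint_quadrant[OF r, of 0 2] integral_mixint_quadrant[OF r, of 2 2] integral_mixint_quadrant[OF r, of 0 1] by simp
  finally show ?thesis .
qed

definition gram :: "real^2 \<Rightarrow> real^2^2" where
  "gram \<theta> = (\<chi> i j. \<integral>y. nscore i \<theta> (ysum y) * nscore j \<theta> (ysum y) \<partial>obs_law \<theta>)"

lemma gram_sym: "gram \<theta> $ i $ j = gram \<theta> $ j $ i"
  by (simp add: gram_def mult.commute)

text \<open>A convergent sequence together with its limit is compact, so a single pair of rates,
  hence a single envelope, dominates all integrands along it.\<close>

lemma continuous_on_gram: "continuous_on param_space (\<lambda>\<theta>. gram \<theta> $ i $ j)"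
  unfolding continuous_on_sequentially comp_def
proof (intro ballI allI impI, elim conjE)
  fix x :: "nat \<Rightarrow> real^2" and a
  assume a: "a \<in> param_space" and xP: "\<forall>n. x n \<in> param_space" and lim: "x \<longlonglongrightarrow> a"
  have "insert a (range x) \<subseteq> ext_space" using a xP param_space_subset by auto
  with compact_sequence_with_limit[OF lim] obtain r0 r1
    where r0: "0 < r0" and r: "\<And>\<theta>. \<theta> \<in> insert a (range x) \<Longrightarrow> rates r0 r1 \<theta>" by (rule rates_compact) blast
  let ?f = "\<lambda>\<theta> y. mixed_density \<theta> y * (nscore i \<theta> (ysum y) * nscore j \<theta> (ysum y))"
  have eq: "gram \<theta> $ i $ j = (\<integral>y. ?f \<theta> y \<partial>lborel)" if "\<theta> \<in> param_space" for \<theta>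
    using that by (simp add: gram_def integral_obs_law)
  let ?K = "(6 * (1 + 2 / r0)\<^sup>2)\<^sup>2 * r1\<^sup>2"
  have "(\<lambda>n. \<integral>y. ?f (x n) y \<partial>lborel) \<longlonglongrightarrow> (\<integral>y. ?f a y \<partial>lborel)"
  proof (rule integral_dominated_convergence[where w = "\<lambda>y. ?K * envelope r0 y"])
    show "integrable lborel (\<lambda>y. ?K * envelope r0 y)"
      using r0 by (intro integrable_mult_right integrable_envelope)
    show "AE y in lborel. (\<lambda>n. ?f (x n) y) \<longlonglongrightarrow> ?f a y"
    proof (rule AE_I2)
      fix y
      have cont: "continuous_on ext_space (\<lambda>\<theta>. ?f \<theta> y)"
        unfolding mixed_density_eq by (intro continuous_intros continuous_on_nscore) auto
      show "(\<lambda>n. ?f (x n) y) \<longlonglongrightarrow> ?f a y"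
        by (rule continuous_on_tendsto_compose[OF cont lim])
          (use a xP param_space_subset in \<open>auto intro: always_eventually\<close>)
    qed
    show "AE y in lborel. norm (?f (x n) y) \<le> ?K * envelope r0 y" for n
    proof (rule AE_I2)
      fix y
      note rn = r[of "x n"]
      show "norm (?f (x n) y) \<le> ?K * envelope r0 y"
      proof (cases "y \<in> quadrant")
        case True
        have "norm (?f (x n) y) \<le> mixed_density (x n) y * ((6 * (1 + 2 / r0)\<^sup>2)\<^sup>2 * (1 + ysum y) ^ 6)"
          using nscore_product_bound[OF rn ysum_nonneg[OF True], of i j] mixed_density_envelope(1)[OF rn, of y]
          by (simp add: abs_mult mult_left_mono)
        also have "\<dots> = (6 * (1 + 2 / r0)\<^sup>2)\<^sup>2 * (mixed_density (x n) y * (1 + ysum y) ^ 6)" by simp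
        also have "\<dots> \<le> (6 * (1 + 2 / r0)\<^sup>2)\<^sup>2 * (r1\<^sup>2 * envelope r0 y)"
          using mixed_density_envelope(2)[OF rn, of y] by (intro mult_left_mono) auto
        finally show ?thesis by simp
      qed (simp add: mixed_density_eq envelope_nonneg)
    qed
  qed auto
  then show "(\<lambda>n. gram (x n) $ i $ j) \<longlonglongrightarrow> gram a $ i $ j"
    using a xP by (simp add: eq)
qed

section \<open>Linear independence of the components of the normalized score\<close>

lemma has_integral_power_sym:
  "((\<lambda>w. w ^ k) has_integral (sqrt 3 ^ Suc k - (- sqrt 3) ^ Suc k) / real (Suc k)) {- sqrt 3..sqrt 3}"
proof -
  have "((\<lambda>w. w ^ k) has_integral sqrt 3 ^ Suc k / real (Suc k) - (- sqrt 3) ^ Suc k / real (Suc k)) {- sqrt 3..sqrt 3}"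
  proof (rule fundamental_theorem_of_calculus)
    fix w :: real
    have "((\<lambda>w. w ^ Suc k / real (Suc k)) has_real_derivative real (Suc k) * w ^ k / real (Suc k)) (at w within {- sqrt 3..sqrt 3})"
      by (rule DERIV_cdivide) (auto intro!: derivative_eq_intros simp del: of_nat_Suc power_Suc)
    then show "((\<lambda>w. w ^ Suc k / real (Suc k)) has_vector_derivative w ^ k) (at w within {- sqrt 3..sqrt 3})"
      by (simp add: has_real_derivative_iff_has_vector_derivative[symmetric] del: of_nat_Suc power_Suc)
  qed simp
  then show ?thesis by (simp only: diff_divide_distrib)
qed

text \<open>The odd moments of W vanish, and its second moment is 1 because the support ends at the
  square root of 3.\<close>

lemma has_integral_cubic:
  fixes b0 b1 b2 b3 :: real
  shows "((\<lambda>w. b0 + b1 * w + b2 * w ^ 2 + b3 * w ^ 3) has_integral 2 * sqrt 3 * (b0 + b2)) {- sqrt 3..sqrt 3}"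
proof -
  let ?m = "\<lambda>k. (sqrt 3 ^ Suc k - (- sqrt 3) ^ Suc k) / real (Suc k)"
  have "((\<lambda>w. b0 * w ^ 0 + b1 * w ^ 1 + b2 * w ^ 2 + b3 * w ^ 3) has_integral b0 * ?m 0 + b1 * ?m 1 + b2 * ?m 2 + b3 * ?m 3) {- sqrt 3..sqrt 3}"
    by (intro has_integral_add has_integral_mult_right has_integral_power_sym)
  moreover have "b0 * ?m 0 + b1 * ?m 1 + b2 * ?m 2 + b3 * ?m 3 = 2 * sqrt 3 * (b0 + b2)"
    by (simp add: numeral_2_eq_2 numeral_3_eq_3 algebra_simps)
  ultimately show ?thesis by simp
qed

text \<open>The value and the slope of the combination at \<open>s = 0\<close> give two linear equations for \<open>a1, a2\<close>
  whose determinant is a multiple of \<open>(\<theta>$2)\<^sup>2 - (\<theta>$1)\<^sup>2\<close>.\<close>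

lemma mixint_combination_eq_0:
  assumes \<theta>: "\<theta> \<in> ext_space"
    and zero: "\<And>s. 0 \<le> s \<Longrightarrow> a1 * ((3 * mixint 0 2 \<theta> s - mixint 2 2 \<theta> s) / 2) + a2 * mixint 0 1 \<theta> s = 0"
  shows "a1 = 0 \<and> a2 = 0"
proof -
  let ?I = "{- sqrt 3..sqrt 3}" and ?r = "\<lambda>w. \<theta>$2 + \<theta>$1 * w"
  let ?f = "\<lambda>s w. a1 * (3 - w\<^sup>2) * dens_deriv 2 (?r w) s + 2 * a2 * dens_deriv 1 (?r w) s"
  \<comment> \<open>This is the derivative of \<open>?f\<close> in s; at s = 0 both are polynomials
    in w of degree at most 3, ready for \<open>has_integral_cubic\<close>.\<close>
  let ?g = "\<lambda>s w. a1 * (3 - w\<^sup>2) * ((- 4 * ?r w + 2 * (?r w)\<^sup>2 * s - ?r w * (2 - 4 * ?r w * s + (?r w)\<^sup>2 * s\<^sup>2)) * exp (- s * ?r w))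
     + 2 * a2 * ((- (?r w)\<^sup>2 - ?r w * (2 * ?r w - s * (?r w)\<^sup>2)) * exp (- s * ?r w))"
  define F where "F s = integral (cbox (- sqrt 3) (sqrt 3)) (?f s)" for s
  have F0: "F s = 0" if s: "0 \<le> s" for s
  proof -
    have 1: "((\<lambda>w. a1 * (3 * (w ^ 0 * dens_deriv 2 (?r w) s) - w ^ 2 * dens_deriv 2 (?r w) s) + 2 * a2 * (w ^ 0 * dens_deriv 1 (?r w) s)) has_integral
      a1 * (3 * integral ?I (\<lambda>w. w ^ 0 * dens_deriv 2 (?r w) s) - integral ?I (\<lambda>w. w ^ 2 * dens_deriv 2 (?r w) s)) + 2 * a2 * integral ?I (\<lambda>w. w ^ 0 * dens_deriv 1 (?r w) s)) ?I"
      by (intro has_integral_add has_integral_diff has_integral_mult_right integrable_integral mixint_integrable)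
    have 2: "a1 * (3 * integral ?I (\<lambda>w. w ^ 0 * dens_deriv 2 (?r w) s) - integral ?I (\<lambda>w. w ^ 2 * dens_deriv 2 (?r w) s)) + 2 * a2 * integral ?I (\<lambda>w. w ^ 0 * dens_deriv 1 (?r w) s)
      = 2 * (2 * sqrt 3) * (a1 * ((3 * mixint 0 2 \<theta> s - mixint 2 2 \<theta> s) / 2) + a2 * mixint 0 1 \<theta> s)"
      by (simp add: mixint_def field_simps)
    have 3: "a1 * (3 * (w ^ 0 * dens_deriv 2 (?r w) s) - w ^ 2 * dens_deriv 2 (?r w) s) + 2 * a2 * (w ^ 0 * dens_deriv 1 (?r w) s) = ?f s w" for w
      by (simp add: algebra_simps)
    have "(?f s has_integral 0) ?I" using 1 unfolding 2 3 zero[OF s] by simp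
    then show ?thesis by (simp add: F_def integral_unique)
  qed
  have "(F has_field_derivative integral (cbox (- sqrt 3) (sqrt 3)) (?g 0)) (at 0 within UNIV)"
    unfolding F_def[abs_def]
  proof (rule leibniz_rule_field_derivative)
    show "((\<lambda>s. ?f s w) has_field_derivative ?g s w) (at s within UNIV)" for s w
      unfolding dens_deriv_1 dens_deriv_2 by (auto intro!: derivative_eq_intros simp: algebra_simps power2_eq_square)
    show "?f s integrable_on cbox (- sqrt 3) (sqrt 3)" for s
      by (intro integrable_continuous continuous_intros)
    show "continuous_on (UNIV \<times> cbox (- sqrt 3) (sqrt 3)) (\<lambda>(s, w). ?g s w)"
      unfolding case_prod_beta by (intro continuous_intros)
  qed auto
  then have DF: "(F has_field_derivative integral (cbox (- sqrt 3) (sqrt 3)) (?g 0)) (at 0)" by simp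
  \<comment> \<open>\<open>F\<close> is known to vanish only for nonnegative s, so the argument is
    one-sided: a nonzero slope at 0 would make \<open>F\<close> nonzero immediately to the
    right.\<close>
  have dF0: "integral (cbox (- sqrt 3) (sqrt 3)) (?g 0) = 0"
  proof (rule ccontr)
    assume "integral (cbox (- sqrt 3) (sqrt 3)) (?g 0) \<noteq> 0"
    then consider "integral (cbox (- sqrt 3) (sqrt 3)) (?g 0) > 0" | "integral (cbox (- sqrt 3) (sqrt 3)) (?g 0) < 0" by linarith
    then show False
    proof cases
      case 1
      obtain d where d: "d > 0" "\<forall>e>0. e < d \<longrightarrow> F 0 < F (0 + e)" using DERIV_pos_inc_right[OF DF 1] by blast
      then have "F 0 < F (0 + d / 2)" by (intro d(2)[rule_format]) auto
      then show False using F0[of 0] F0[of "0 + d / 2"] d(1) by simp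
    next
      case 2
      obtain d where d: "d > 0" "\<forall>e>0. e < d \<longrightarrow> F 0 > F (0 + e)" using DERIV_neg_dec_right[OF DF 2] by blast
      then have "F 0 > F (0 + d / 2)" by (intro d(2)[rule_format]) auto
      then show False using F0[of 0] F0[of "0 + d / 2"] d(1) by simp
    qed
  qed
  have "(?f 0 has_integral 2 * sqrt 3 * ((6 * a1 + 4 * a2 * \<theta>$2) + - 2 * a1)) ?I"
  proof (rule has_integral_eq[OF _ has_integral_cubic])
    show "6 * a1 + 4 * a2 * \<theta>$2 + 4 * a2 * \<theta>$1 * w + - 2 * a1 * w ^ 2 + 0 * w ^ 3 = ?f 0 w" for w
      unfolding dens_deriv_1 dens_deriv_2 by (simp add: algebra_simps)
  qed
  then have 1: "a1 = - a2 * \<theta>$2" using F0[of 0] by (simp add: F_def integral_unique)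
  have "(?g 0 has_integral 2 * sqrt 3 * ((- 18 * a1 * \<theta>$2 - 6 * a2 * (\<theta>$2)\<^sup>2) + (6 * a1 * \<theta>$2 - 6 * a2 * (\<theta>$1)\<^sup>2))) ?I"
  proof (rule has_integral_eq[OF _ has_integral_cubic])
    show "- 18 * a1 * \<theta>$2 - 6 * a2 * (\<theta>$2)\<^sup>2 + (- 18 * a1 * \<theta>$1 - 12 * a2 * \<theta>$2 * \<theta>$1) * w
      + (6 * a1 * \<theta>$2 - 6 * a2 * (\<theta>$1)\<^sup>2) * w ^ 2 + 6 * a1 * \<theta>$1 * w ^ 3 = ?g 0 w" for w
      by (simp add: algebra_simps power2_eq_square power3_eq_cube)
  qed
  from integral_unique[OF this] dF0 have "2 * sqrt 3 * ((- 18 * a1 * \<theta>$2 - 6 * a2 * (\<theta>$2)\<^sup>2) + (6 * a1 * \<theta>$2 - 6 * a2 * (\<theta>$1)\<^sup>2)) = 0"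
    by (simp only: cbox_interval)
  then have "((- 18 * a1 * \<theta>$2 - 6 * a2 * (\<theta>$2)\<^sup>2) + (6 * a1 * \<theta>$2 - 6 * a2 * (\<theta>$1)\<^sup>2)) = 0"
    by (simp only: mult_eq_0_iff) simp
  then have 2: "2 * a1 * \<theta>$2 + a2 * ((\<theta>$2)\<^sup>2 + (\<theta>$1)\<^sup>2) = 0"
    by (simp only: ring_distribs)
  have "a2 * ((\<theta>$1)\<^sup>2 - (\<theta>$2)\<^sup>2) = 0" using 2 unfolding 1 by (simp add: algebra_simps power2_eq_square)
  moreover have "(\<theta>$1)\<^sup>2 < (\<theta>$2)\<^sup>2"
  proof -
    have "1 * \<bar>\<theta>$1\<bar> \<le> sqrt 3 * \<bar>\<theta>$1\<bar>" by (intro mult_right_mono) auto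
    then have "\<bar>\<theta>$1\<bar> < \<theta>$2" using \<theta> by (auto simp: ext_space_def)
    then have "\<bar>\<theta>$1\<bar>\<^sup>2 < (\<theta>$2)\<^sup>2" by (intro power_strict_mono) auto
    then show ?thesis by simp
  qed
  ultimately show ?thesis using 1 by auto
qed

text \<open>The form is the second moment of a linear combination. If it vanished, the numerator of
  that combination would be zero almost everywhere on the quadrant, by continuity for all s \<ge> 0,
  and \<open>mixint_combination_eq_0\<close> would force both coefficients to be 0.\<close>

lemma gram_pos:
  assumes \<theta>: "\<theta> \<in> param_space" and "a1 \<noteq> 0 \<or> a2 \<noteq> 0"
  shows "0 < a1\<^sup>2 * gram \<theta> $ 1 $ 1 + 2 * a1 * a2 * gram \<theta> $ 1 $ 2 + a2\<^sup>2 * gram \<theta> $ 2 $ 2"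
proof -
  have E: "\<theta> \<in> ext_space" using \<theta> param_space_subset by auto
  let ?u = "\<lambda>j y. nscore j \<theta> (ysum y)"
  let ?X = "\<lambda>y. a1 * ?u 1 y + a2 * ?u 2 y"
  have sq: "(?X y)\<^sup>2 = a1\<^sup>2 * (?u 1 y * ?u 1 y) + 2 * a1 * a2 * (?u 1 y * ?u 2 y) + a2\<^sup>2 * (?u 2 y * ?u 2 y)" for y
    by (simp add: power2_eq_square algebra_simps)
  note int = nscore_integrable(2)[OF \<theta>]
  have intX: "integrable (obs_law \<theta>) (\<lambda>y. (?X y)\<^sup>2)"
    unfolding sq by (intro Bochner_Integration.integrable_add integrable_mult_right int)
  have eq: "(\<integral>y. (?X y)\<^sup>2 \<partial>obs_law \<theta>) = a1\<^sup>2 * gram \<theta> $ 1 $ 1 + 2 * a1 * a2 * gram \<theta> $ 1 $ 2 + a2\<^sup>2 * gram \<theta> $ 2 $ 2"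
    unfolding sq by (simp add: gram_def int)
  have "(\<integral>y. (?X y)\<^sup>2 \<partial>obs_law \<theta>) \<noteq> 0"
  proof
    assume "(\<integral>y. (?X y)\<^sup>2 \<partial>obs_law \<theta>) = 0"
    then have "AE y in obs_law \<theta>. (?X y)\<^sup>2 = 0"
      using integral_nonneg_eq_0_iff_AE[OF intX] by simp
    then have AE0: "AE y in lborel. 0 < mixed_density \<theta> y \<longrightarrow> ?X y = 0"
      unfolding obs_law_eq_density[OF \<theta>] by (subst (asm) AE_density) auto
    define F where "F s = a1 * ((3 * mixint 0 2 \<theta> s - mixint 2 2 \<theta> s) / 2) + a2 * mixint 0 1 \<theta> s" for s
    have FX: "?X y = F (ysum y) / mixint 0 0 \<theta> (ysum y)" for y
      by (simp add: nscore_def F_def add_divide_distrib)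
    have contF: "continuous_on UNIV F" unfolding F_def by (auto intro!: continuous_intros)
    let ?S = "{y::real^2. 0 < y$1 \<and> 0 < y$2}" and ?C = "{y. F (ysum y) = 0}"
    have "AE y in lebesgue. y \<in> ?S \<longrightarrow> y \<in> ?C"
    proof (rule AE_completion)
      show "AE y in lborel. y \<in> ?S \<longrightarrow> y \<in> ?C"
        using AE0
      proof eventually_elim
        case (elim y)
        show ?case
        proof
          assume "y \<in> ?S"
          then have "0 < mixed_density \<theta> y"
            using mixint_00_pos[OF E] by (auto simp: mixed_density_eq quadrant_def)
          with elim show "y \<in> ?C" unfolding FX using mixint_00_pos[OF E, of "ysum y"] by auto
        qed
      qed
    qed
    moreover have "open ?S" by (intro open_Collect_conj open_Collect_less continuous_intros)
    moreover have "closed ?C"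
      by (intro closed_Collect_eq continuous_on_compose2[OF contF] continuous_intros) auto
    \<comment> \<open>A closed set that contains almost every point of an open set contains all of
      it.\<close>
    ultimately have C: "y \<in> ?C" if "y \<in> ?S" for y
      using mem_closed_if_AE_lebesgue_open[of ?S ?C y] that by simp
    have F0: "F s = 0" if "0 < s" for s
    proof -
      have "(vector [s / 2, s / 2] :: real^2) \<in> ?C" using that by (intro C) simp
      then show ?thesis by (simp add: ysum_def)
    qed
    \<comment> \<open>The open quadrant attains only positive sums, so the value at 0 comes from the
      limit from the right.\<close>
    have "F 0 = 0"
    proof (rule ccontr)
      assume "F 0 \<noteq> 0"
      have "(F \<longlongrightarrow> F 0) (at_right 0)"
        using contF by (auto simp: continuous_on_def intro: tendsto_within_subset)
      moreover have "(F \<longlongrightarrow> 0) (at_right 0)"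
        by (rule tendsto_eventually) (auto simp: eventually_at_right_field F0 intro: exI[of _ 1])
      ultimately show False using tendsto_unique[of "at_right (0::real)" F] \<open>F 0 \<noteq> 0\<close> by auto
    qed
    then have "F s = 0" if "0 \<le> s" for s using F0[of s] that by (cases "s = 0") auto
    from mixint_combination_eq_0[OF E, of a1 a2] this assms(2) show False unfolding F_def by auto
  qed
  moreover have "0 \<le> (\<integral>y. (?X y)\<^sup>2 \<partial>obs_law \<theta>)" by simp
  ultimately show ?thesis unfolding eq by simp
qed

section \<open>Derivatives of the log-likelihood\<close>

text \<open>Only parameters near \<theta> enter a partial derivative, so formulas valid on the open
  cone can be differentiated again there.\<close>

lemma partial_cong_open:
  assumes "open U" "\<theta> \<in> U" "\<And>t. t \<in> U \<Longrightarrow> f t = g t"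
  shows "partial e f \<theta> = partial e g \<theta>"
    and "((\<lambda>t. f (\<theta> + t *\<^sub>R axis e 1)) has_field_derivative D) (at 0) \<longleftrightarrow> ((\<lambda>t. g (\<theta> + t *\<^sub>R axis e 1)) has_field_derivative D) (at 0)"
proof -
  have "((\<lambda>t::real. \<theta> + t *\<^sub>R axis e 1) \<longlongrightarrow> \<theta> + 0 *\<^sub>R axis e 1) (nhds 0)"
    by (intro tendsto_intros filterlim_ident)
  then have "\<forall>\<^sub>F t in nhds 0. \<theta> + t *\<^sub>R axis e 1 \<in> U"
    by (rule topological_tendstoD) (use assms in auto)
  then have ev: "\<forall>\<^sub>F t in nhds 0. f (\<theta> + t *\<^sub>R axis e 1) = g (\<theta> + t *\<^sub>R axis e 1)"
    by eventually_elim (rule assms(3))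
  show "partial e f \<theta> = partial e g \<theta>"
    unfolding partial_def by (rule deriv_cong_ev[OF ev refl])
  show "((\<lambda>t. f (\<theta> + t *\<^sub>R axis e 1)) has_field_derivative D) (at 0) \<longleftrightarrow> ((\<lambda>t. g (\<theta> + t *\<^sub>R axis e 1)) has_field_derivative D) (at 0)"
    by (rule DERIV_cong_ev[OF refl ev refl])
qed

text \<open>Off the quadrant the density is 0 and the convention ln 0 = 0 gives the value 0, so the
  identity holds at every y.\<close>

lemma loglik_eq:
  "loglik \<theta> y = indicator quadrant y * ln (mixint 0 0 \<theta> (ysum y))"
  by (simp add: loglik_def mixed_density_eq indicator_def)

text \<open>The power of w that one derivative in direction \<open>e\<close> contributes to a
  mixture integral.\<close>

definition lam_deg :: "2 \<Rightarrow> nat" where "lam_deg e = (if e = 1 then 1 else 0)"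

definition dlog :: "2 \<Rightarrow> real^2 \<Rightarrow> real \<Rightarrow> real" where
  "dlog e \<theta> s = mixint (lam_deg e) 1 \<theta> s / mixint 0 0 \<theta> s"

definition ddlog :: "2 \<Rightarrow> 2 \<Rightarrow> real^2 \<Rightarrow> real \<Rightarrow> real" where
  "ddlog d e \<theta> s = mixint (lam_deg d + lam_deg e) 2 \<theta> s / mixint 0 0 \<theta> s - dlog d \<theta> s * dlog e \<theta> s"

lemma mixint_deriv0:
  "((\<lambda>t. mixint a m (\<theta> + t *\<^sub>R axis e 1) s) has_field_derivative mixint (lam_deg e + a) (Suc m) \<theta> s) (at 0)"
  using mixint_has_derivative_param[of e a m \<theta> s 0] exhaust_2[of e] by (auto simp: lam_deg_def split: if_splits)

lemma loglik_deriv: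
  assumes "\<theta> \<in> ext_space"
  shows "((\<lambda>t. loglik (\<theta> + t *\<^sub>R axis e 1) y) has_field_derivative indicator quadrant y * dlog e \<theta> (ysum y)) (at 0)"
  unfolding loglik_eq dlog_def
  by (rule DERIV_cmult, rule DERIV_cong, rule DERIV_chain'[OF mixint_deriv0 DERIV_ln_divide])
    (use mixint_00_pos[OF assms] in \<open>auto simp: field_simps\<close>)

lemma partial_loglik:
  "\<theta> \<in> ext_space \<Longrightarrow> partial e (\<lambda>t. loglik t y) \<theta> = indicator quadrant y * dlog e \<theta> (ysum y)"
  unfolding partial_def by (rule DERIV_imp_deriv) (rule loglik_deriv)

lemma partial_loglik_deriv:
  assumes "\<theta> \<in> ext_space"
  shows "((\<lambda>t. partial e (\<lambda>t. loglik t y) (\<theta> + t *\<^sub>R axis d 1)) has_field_derivative indicator quadrant y * ddlog d e \<theta> (ysum y)) (at 0)"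
proof -
  have nz: "mixint 0 0 \<theta> (ysum y) \<noteq> 0" using mixint_00_pos[OF assms, of "ysum y"] by simp
  have "((\<lambda>t. indicator quadrant y * dlog e (\<theta> + t *\<^sub>R axis d 1) (ysum y)) has_field_derivative indicator quadrant y * ddlog d e \<theta> (ysum y)) (at 0)"
    unfolding dlog_def
    by (rule DERIV_cmult, rule DERIV_cong, rule DERIV_divide[OF mixint_deriv0 mixint_deriv0])
      (use nz in \<open>auto simp: ddlog_def dlog_def field_simps numeral_2_eq_2\<close>)
  then show ?thesis
    by (subst partial_cong_open(2)[OF open_ext_space assms partial_loglik])
qed

lemma partial_partial_loglik:
  "\<theta> \<in> ext_space \<Longrightarrow> partial d (partial e (\<lambda>t. loglik t y)) \<theta> = indicator quadrant y * ddlog d e \<theta> (ysum y)"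
  unfolding partial_def[of d] by (rule DERIV_imp_deriv) (rule partial_loglik_deriv)

text \<open>The indicator matches the zero log-likelihood off the quadrant, so that the
  factorization of the score holds at every y and not just almost surely. Continuity arguments use
  \<open>nscore\<close>, which has no indicator.\<close>

definition nsc :: "real^2 \<Rightarrow> real^2 \<Rightarrow> real^2" where
  "nsc \<theta> y = (\<chi> j. indicator quadrant y * nscore j \<theta> (ysum y))"

definition rescale :: "real^2 \<Rightarrow> real^2^2" where
  "rescale \<theta> = (\<chi> i j. if i = j then if i = 1 then \<theta>$1 else 1 else 0)"

lemma rescale_mult: "(rescale \<theta> *v x) $ 1 = \<theta>$1 * x$1" "(rescale \<theta> *v x) $ 2 = x$2"
  by (simp_all add: rescale_def matrix_vector_mult_def sum_2)

lemma dlog_eq: "dlog 1 \<theta> s = \<theta>$1 * nscore 1 \<theta> s" "dlog 2 \<theta> s = nscore 2 \<theta> s"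
proof -
  have "mixint 1 1 \<theta> s = \<theta>$1 * ((3 * mixint 0 2 \<theta> s - mixint 2 2 \<theta> s) / 2)"
    using mixint_by_parts[of \<theta> s] by simp
  then show "dlog 1 \<theta> s = \<theta>$1 * nscore 1 \<theta> s"
    by (simp only: dlog_def nscore_def lam_deg_def simp_thms if_True times_divide_eq_right)
qed (simp add: dlog_def nscore_def lam_deg_def)

lemma score_eq:
  assumes "\<theta> \<in> ext_space"
  shows "score \<theta> y = rescale \<theta> *v nsc \<theta> y"
  using assms by (simp add: vec_eq_iff forall_2 score_def grad_def partial_loglik rescale_mult dlog_eq nsc_def)

lemma score_n_nth:
  assumes "\<theta> \<in> ext_space"
  shows "score_n n \<theta> y $ e = (\<Sum>i<n. score \<theta> (y i) $ e)"
proof -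
  have "((\<lambda>t. \<Sum>i<n. loglik (\<theta> + t *\<^sub>R axis e 1) (y i)) has_field_derivative (\<Sum>i<n. indicator quadrant (y i) * dlog e \<theta> (ysum (y i)))) (at 0)"
    by (intro DERIV_sum loglik_deriv assms)
  then have "partial e (\<lambda>t. loglik_n n t y) \<theta> = (\<Sum>i<n. indicator quadrant (y i) * dlog e \<theta> (ysum (y i)))"
    unfolding partial_def loglik_n_def by (rule DERIV_imp_deriv)
  then show ?thesis
    using assms by (simp only: score_n_def grad_def score_def partial_loglik vec_lambda_beta)
qed

definition nsum :: "nat \<Rightarrow> real^2 \<Rightarrow> (nat \<Rightarrow> real^2) \<Rightarrow> real^2" where
  "nsum n \<theta> y = (\<Sum>i<n. nsc \<theta> (y i))"

lemma score_n_eq: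
  assumes "\<theta> \<in> ext_space"
  shows "score_n n \<theta> y = rescale \<theta> *v nsum n \<theta> y"
  using assms by (simp add: vec_eq_iff forall_2 score_n_nth score_eq rescale_mult nsum_def sum_distrib_left)

section \<open>Derivatives on the line \<open>\<theta>$1 = 0\<close>\<close>

text \<open>On this line the rate no longer depends on w, and the second moment of W is 1, so the
  weights 1 and w^2 give the same value.\<close>

lemma mixint_axis:
  assumes "\<theta>$1 = 0"
  shows "mixint 0 m \<theta> s = dens_deriv m (\<theta>$2) s" "mixint 2 m \<theta> s = dens_deriv m (\<theta>$2) s"
proof -
  show "mixint 0 m \<theta> s = dens_deriv m (\<theta>$2) s" using assms by (simp add: mixint_def)
  have "((\<lambda>w::real. w\<^sup>2) has_integral sqrt 3 ^ 3 / 3 - (- sqrt 3) ^ 3 / 3) {- sqrt 3..sqrt 3}"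
    by (rule fundamental_theorem_of_calculus)
      (auto simp: has_real_derivative_iff_has_vector_derivative[symmetric] power2_eq_square intro!: derivative_eq_intros)
  then have "integral {- sqrt 3..sqrt 3} (\<lambda>w::real. w\<^sup>2) = 2 * sqrt 3"
    by (simp add: integral_unique power3_eq_cube)
  then show "mixint 2 m \<theta> s = dens_deriv m (\<theta>$2) s" using assms by (simp add: mixint_def)
qed

text \<open>The \<lambda>-score is \<lambda> times \<open>nscore 1\<close>, so its
  \<lambda>-derivative at \<lambda> = 0 should be \<open>nscore 1\<close> itself. In formulas, the
  first-order term drops out by \<open>mixint_by_parts\<close>, and (3 - 1) / 2 = 1 matches the
  weights.\<close>

lemma ddlog_axis:
  assumes "\<theta>$1 = 0"
  shows "ddlog 1 1 \<theta> s = nscore 1 \<theta> s"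
  using mixint_by_parts[of \<theta> s] mixint_axis[OF assms]
  by (simp add: ddlog_def dlog_def nscore_def lam_deg_def assms numeral_2_eq_2[symmetric])

text \<open>One extra derivative in \<lambda> recovers the component of the normalized score that
  the score itself loses on this line; hence the order 2 in the modified score.\<close>

lemma partial_score_axis:
  assumes "\<theta> \<in> ext_space" "\<theta>$1 = 0"
  shows "partial 1 (\<lambda>t. score t y $ 1) \<theta> = nsc \<theta> y $ 1"
    and "partial 1 (\<lambda>t. score_n n t z $ 1) \<theta> = nsum n \<theta> z $ 1"
proof -
  have D: "((\<lambda>t. score (\<theta> + t *\<^sub>R axis 1 1) y $ 1) has_field_derivative nsc \<theta> y $ 1) (at 0)" for y
    using partial_loglik_deriv[OF assms(1), of 1 y 1] ddlog_axis[OF assms(2)]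
    by (simp add: score_def grad_def nsc_def)
  show "partial 1 (\<lambda>t. score t y $ 1) \<theta> = nsc \<theta> y $ 1"
    unfolding partial_def by (rule DERIV_imp_deriv[OF D])
  have "((\<lambda>t. \<Sum>i<n. score (\<theta> + t *\<^sub>R axis 1 1) (z i) $ 1) has_field_derivative (\<Sum>i<n. nsc \<theta> (z i) $ 1)) (at 0)"
    by (intro DERIV_sum D)
  then have "partial 1 (\<lambda>t. \<Sum>i<n. score t (z i) $ 1) \<theta> = (\<Sum>i<n. nsc \<theta> (z i) $ 1)"
    unfolding partial_def by (rule DERIV_imp_deriv)
  moreover have "partial 1 (\<lambda>t. score_n n t z $ 1) \<theta> = partial 1 (\<lambda>t. \<Sum>i<n. score t (z i) $ 1) \<theta>"
    by (rule partial_cong_open(1)[OF open_ext_space assms(1) score_n_nth])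
  ultimately show "partial 1 (\<lambda>t. score_n n t z $ 1) \<theta> = nsum n \<theta> z $ 1"
    by (simp add: nsum_def)
qed

text \<open>Moves in direction 2 stay on the line, and for small steps inside the open cone, so each
  iterate differentiates a function that is locally zero.\<close>

lemma partial2_iterate_axis:
  assumes "\<theta>$1 = 0" and f: "\<And>t. t \<in> ext_space \<Longrightarrow> t$1 = 0 \<Longrightarrow> f t = 0" and "\<theta> \<in> ext_space"
  shows "(partial 2 ^^ l) f \<theta> = 0"
  using assms(1,3)
proof (induction l arbitrary: \<theta>)
  case (Suc l)
  have "((\<lambda>t::real. \<theta> + t *\<^sub>R axis 2 1) \<longlongrightarrow> \<theta> + 0 *\<^sub>R axis 2 1) (nhds 0)"
    by (intro tendsto_intros filterlim_ident)
  then have "\<forall>\<^sub>F t in nhds 0. \<theta> + t *\<^sub>R axis 2 1 \<in> ext_space"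
    using topological_tendstoD[of _ _ "nhds 0" ext_space] open_ext_space Suc.prems by auto
  then have "\<forall>\<^sub>F t in nhds 0. (partial 2 ^^ l) f (\<theta> + t *\<^sub>R axis 2 1) = 0"
    by eventually_elim (use Suc in \<open>auto simp: axis_def\<close>)
  then have "deriv (\<lambda>t. (partial 2 ^^ l) f (\<theta> + t *\<^sub>R axis 2 1)) 0 = deriv (\<lambda>_. 0) (0::real)"
    by (rule deriv_cong_ev) simp
  then show ?case by (simp add: partial_def[of 2 "(partial 2 ^^ l) f"])
qed (use f in auto)

section \<open>Moments of log-likelihood derivatives up to order two\<close>

lemma dlog_bound:
  assumes r: "rates r0 r1 \<theta>" and s: "0 \<le> s"
  shows "\<bar>dlog e \<theta> s\<bar> \<le> 3 * (1 + 2 / r0)\<^sup>2 * (1 + s)"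
  using mixint_bound[OF r s, of "lam_deg e" 1] mixint_00_pos[OF rates_ext_space[OF r], of s]
  by (simp add: dlog_def abs_mult pos_divide_le_eq lam_deg_def)

lemma ddlog_bound:
  assumes r: "rates r0 r1 \<theta>" and s: "0 \<le> s"
  shows "\<bar>ddlog d e \<theta> s\<bar> \<le> (3 * (1 + 2 / r0)\<^sup>2 + (3 * (1 + 2 / r0)\<^sup>2)\<^sup>2) * (1 + s)\<^sup>2"
proof -
  have "\<bar>mixint (lam_deg d + lam_deg e) 2 \<theta> s / mixint 0 0 \<theta> s\<bar> \<le> 3 * (1 + 2 / r0)\<^sup>2 * (1 + s)\<^sup>2"
    using mixint_bound[OF r s, of "lam_deg d + lam_deg e" 2] mixint_00_pos[OF rates_ext_space[OF r], of s]
    by (simp add: abs_mult pos_divide_le_eq lam_deg_def)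
  moreover have "\<bar>dlog d \<theta> s * dlog e \<theta> s\<bar> \<le> (3 * (1 + 2 / r0)\<^sup>2 * (1 + s)) * (3 * (1 + 2 / r0)\<^sup>2 * (1 + s))"
    unfolding abs_mult by (intro mult_mono dlog_bound[OF r s]) (use s in auto)
  moreover have "(3 * (1 + 2 / r0)\<^sup>2 * (1 + s)) * (3 * (1 + 2 / r0)\<^sup>2 * (1 + s)) = (3 * (1 + 2 / r0)\<^sup>2)\<^sup>2 * (1 + s)\<^sup>2"
    by algebra
  ultimately have "\<bar>mixint (lam_deg d + lam_deg e) 2 \<theta> s / mixint 0 0 \<theta> s\<bar> + \<bar>dlog d \<theta> s * dlog e \<theta> s\<bar>
    \<le> 3 * (1 + 2 / r0)\<^sup>2 * (1 + s)\<^sup>2 + (3 * (1 + 2 / r0)\<^sup>2)\<^sup>2 * (1 + s)\<^sup>2" by linarith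
  then show ?thesis
    unfolding ddlog_def ring_distribs(2) using abs_triangle_ineq4 order_trans by blast
qed

text \<open>The bounds of the density by the extreme rates have logarithms that are affine in
  s.\<close>

lemma ln_mixint_bound:
  assumes r: "rates r0 r1 \<theta>" and s: "0 \<le> s"
  shows "\<bar>ln (mixint 0 0 \<theta> s)\<bar> \<le> (2 * \<bar>ln r0\<bar> + 2 * \<bar>ln r1\<bar> + r1) * (1 + s)"
proof -
  have r01: "0 < r0" "0 < r1" "r0 \<le> r1"
  proof -
    have "0 \<le> sqrt 3 * \<bar>\<theta>$1\<bar>" by simp
    then show "0 < r0" "0 < r1" "r0 \<le> r1" using r unfolding rates_def by linarith+
  qed
  note pos = mixint_00_pos[OF rates_ext_space[OF r], of s]
  have "ln (mixint 0 0 \<theta> s) \<le> ln (r1\<^sup>2 * exp (- s * r0))"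
    using mixint_00_le(1)[OF r s] pos r01 by (subst ln_le_cancel_iff) auto
  also have "\<dots> = 2 * ln r1 - s * r0" using r01 by (simp add: ln_mult ln_realpow)
  finally have 1: "ln (mixint 0 0 \<theta> s) \<le> 2 * ln r1 - s * r0" .
  have "2 * ln r0 - s * r1 = ln (r0\<^sup>2 * exp (- s * r1))" using r01 by (simp add: ln_mult ln_realpow)
  also have "\<dots> \<le> ln (mixint 0 0 \<theta> s)"
    using mixint_00_le(2)[OF r s] pos r01 by (subst ln_le_cancel_iff) auto
  finally have 2: "2 * ln r0 - s * r1 \<le> ln (mixint 0 0 \<theta> s)" .
  have "0 \<le> s * r0" "0 \<le> s * r1" "0 \<le> s * \<bar>ln r0\<bar>" "0 \<le> s * \<bar>ln r1\<bar>" using r01 s by auto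
  then show ?thesis using 1 2 r01 by (simp add: algebra_simps)
qed

lemma partials_cases:
  assumes "length js \<le> 2"
  obtains "js = []" | j where "js = [j]" | i j where "js = [i, j]"
  using assms by (cases js rule: remdups_adj.cases) (auto simp: Suc_le_eq)

lemma partials_loglik_bound:
  assumes r: "rates r0 r1 \<theta>" and y: "y \<in> quadrant" and js: "length js \<le> 2"
  shows "\<bar>partials js (\<lambda>t. loglik t y) \<theta>\<bar> \<le>
    (2 * \<bar>ln r0\<bar> + 2 * \<bar>ln r1\<bar> + \<bar>r1\<bar> + (3 * (1 + 2 / r0)\<^sup>2 + (3 * (1 + 2 / r0)\<^sup>2)\<^sup>2)) * (1 + ysum y)\<^sup>2"
    (is "_ \<le> (?A + ?B) * _")
proof -
  note E = rates_ext_space[OF r] and s = ysum_nonneg[OF y]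
  have AB: "0 \<le> ?A" "0 \<le> ?B" by auto
  have s1: "0 \<le> (1 + ysum y)\<^sup>2" "1 + ysum y \<le> (1 + ysum y)\<^sup>2"
    using s by (auto simp: power2_eq_square)
  have A: "c * (1 + ysum y)\<^sup>2 \<le> (?A + ?B) * (1 + ysum y)\<^sup>2" if "c \<le> ?A + ?B" for c
    using that s1 by (intro mult_right_mono)
  show ?thesis
    using js
  proof (cases js rule: partials_cases)
    case 1
    have "\<bar>ln (mixint 0 0 \<theta> (ysum y))\<bar> \<le> (2 * \<bar>ln r0\<bar> + 2 * \<bar>ln r1\<bar> + r1) * (1 + ysum y)"
      by (rule ln_mixint_bound[OF r s])
    also have "\<dots> \<le> ?A * (1 + ysum y)\<^sup>2" using s1 s by (intro mult_mono) auto
    also have "\<dots> \<le> (?A + ?B) * (1 + ysum y)\<^sup>2" using AB by (intro A) simp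
    finally show ?thesis using 1 y by (simp add: partials_def loglik_eq)
  next
    case (2 j)
    have "\<bar>dlog j \<theta> (ysum y)\<bar> \<le> 3 * (1 + 2 / r0)\<^sup>2 * (1 + ysum y)" by (rule dlog_bound[OF r s])
    also have "\<dots> \<le> 3 * (1 + 2 / r0)\<^sup>2 * (1 + ysum y)\<^sup>2" using s1 by (intro mult_left_mono) auto
    also have "\<dots> \<le> (?A + ?B) * (1 + ysum y)\<^sup>2" using AB(1) by (intro A) simp
    finally show ?thesis using 2 y E by (simp add: partials_def partial_loglik)
  next
    case (3 i j)
    have "\<bar>ddlog i j \<theta> (ysum y)\<bar> \<le> ?B * (1 + ysum y)\<^sup>2" by (rule ddlog_bound[OF r s])
    also have "\<dots> \<le> (?A + ?B) * (1 + ysum y)\<^sup>2" using AB(1) by (intro A) simp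
    finally show ?thesis using 3 y E by (simp add: partials_def partial_partial_loglik)
  qed
qed

lemma continuous_on_ddlog:
  fixes f :: "'a::topological_space \<Rightarrow> real^2"
  assumes "continuous_on A f" "continuous_on A g" "f ` A \<subseteq> ext_space"
  shows "continuous_on A (\<lambda>x. ddlog d e (f x) (g x))"
proof -
  have "\<forall>x\<in>A. mixint 0 0 (f x) (g x) \<noteq> 0"
    using assms(3) mixint_00_pos by (metis image_subset_iff less_irrefl)
  then show ?thesis
    unfolding ddlog_def dlog_def by (intro continuous_intros assms(1,2)) auto
qed

text \<open>Order 2 is the largest order used in the constructed admissible choice. With \<delta> =
  1 the exponent 2 + \<delta> is 3, and the cube of a bound in (1 + s)^2 is exactly what the
  envelope absorbs.\<close>

lemma smooth_order_2:
  assumes \<theta>: "\<theta> \<in> param_space"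
  shows "smooth_order \<theta> 2"
proof -
  obtain r where r: "0 < r" "cball \<theta> r \<subseteq> ext_space"
    using open_ext_space \<theta> param_space_subset by (meson open_contains_cball subsetD)
  obtain r0 r1 where r0: "0 < r0" and rates: "\<And>t. t \<in> cball \<theta> r \<Longrightarrow> rates r0 r1 t"
    using rates_compact[OF compact_cball r(2)] by blast
  have ball: "ball \<theta> r \<subseteq> ext_space" using r(2) ball_subset_cball by blast
  let ?C = "2 * \<bar>ln r0\<bar> + 2 * \<bar>ln r1\<bar> + \<bar>r1\<bar> + (3 * (1 + 2 / r0)\<^sup>2 + (3 * (1 + 2 / r0)\<^sup>2)\<^sup>2)"
  have C: "0 \<le> ?C" by auto
  have exist: "partials_exist_on 2 (\<lambda>t. loglik t y) (ball \<theta> r)" for y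
    unfolding partials_exist_on_def
  proof (intro allI impI ballI)
    fix js :: "2 list" and j t assume "length js < 2" and t: "t \<in> ball \<theta> r"
    then have "length js \<le> 2" "t \<in> ext_space" using ball by auto
    then show "(\<lambda>x. partials js (\<lambda>t. loglik t y) (t + x *\<^sub>R axis j 1)) field_differentiable at 0"
      using \<open>length js < 2\<close> loglik_deriv[of t j y] partial_loglik_deriv[of t _ y j]
      by (cases js rule: partials_cases) (auto simp: partials_def field_differentiable_def)
  qed
  have cont: "continuous_on (ball \<theta> r \<times> quadrant) (\<lambda>(t, y). partials js (\<lambda>t. loglik t y) t)"
    if js: "length js = 2" for js
  proof -
    have "length js \<le> 2" using js by simp
    then obtain i j where ij: "js = [i, j]" by (cases js rule: partials_cases) (use js in auto)
    have "continuous_on (ball \<theta> r \<times> quadrant) (\<lambda>p. ddlog i j (fst p) (ysum (snd p)))"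
      using ball by (intro continuous_on_ddlog continuous_intros) auto
    then show ?thesis
      by (rule continuous_on_eq) (use ball in \<open>auto simp: ij partials_def partial_partial_loglik subset_eq\<close>)
  qed
  have moment: "(\<integral>\<^sup>+y. ennreal (\<bar>partials js (\<lambda>t. loglik t y) \<theta>'\<bar> powr (2 + 1) * mixed_density \<theta>'' y) \<partial>lborel)
      \<le> ennreal (?C ^ 3 * r1\<^sup>2 * (\<integral>y. envelope r0 y \<partial>lborel))"
    if js: "length js \<le> 2" and t: "\<theta>'' \<in> ball \<theta> r" "\<theta>' \<in> ball \<theta> r" for js \<theta>' \<theta>''
  proof -
    have rt: "rates r0 r1 \<theta>''" "rates r0 r1 \<theta>'" using t rates by auto
    have "(\<integral>\<^sup>+y. ennreal (\<bar>partials js (\<lambda>t. loglik t y) \<theta>'\<bar> powr (2 + 1) * mixed_density \<theta>'' y) \<partial>lborel)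
      \<le> (\<integral>\<^sup>+y. ennreal (?C ^ 3 * r1\<^sup>2 * envelope r0 y) \<partial>lborel)"
    proof (intro nn_integral_mono ennreal_leI)
      fix y
      show "\<bar>partials js (\<lambda>t. loglik t y) \<theta>'\<bar> powr (2 + 1) * mixed_density \<theta>'' y \<le> ?C ^ 3 * r1\<^sup>2 * envelope r0 y"
      proof (cases "y \<in> quadrant")
        case True
        \<comment> \<open>The case x = 0 is separate: both kinds of power have the value 0
          there.\<close>
        have pow: "x powr (2 + 1) = x ^ 3" if "0 \<le> x" for x :: real
          using that by (cases "x = 0") (auto simp: powr_numeral)
        have "\<bar>partials js (\<lambda>t. loglik t y) \<theta>'\<bar> ^ 3 \<le> (?C * (1 + ysum y)\<^sup>2) ^ 3"
          by (intro power_mono partials_loglik_bound[OF rt(2) True js]) auto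
        also have "\<dots> = ?C ^ 3 * (1 + ysum y) ^ 6"
          by (simp only: power_mult_distrib power_mult[symmetric]) simp
        finally have "\<bar>partials js (\<lambda>t. loglik t y) \<theta>'\<bar> powr (2 + 1) * mixed_density \<theta>'' y \<le> ?C ^ 3 * (1 + ysum y) ^ 6 * mixed_density \<theta>'' y"
          unfolding pow[OF abs_ge_zero] by (rule mult_right_mono) (rule mixed_density_envelope(1)[OF rt(1)])
        also have "\<dots> = ?C ^ 3 * (mixed_density \<theta>'' y * (1 + ysum y) ^ 6)" by (simp only: mult_ac)
        also have "\<dots> \<le> ?C ^ 3 * (r1\<^sup>2 * envelope r0 y)"
          using C by (intro mult_left_mono mixed_density_envelope(2)[OF rt(1)] zero_le_power)
        finally show ?thesis by (simp only: mult_ac)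
      next
        case False
        have "0 \<le> ?C ^ 3 * r1\<^sup>2 * envelope r0 y"
          using C by (intro mult_nonneg_nonneg zero_le_power envelope_nonneg zero_le_power2)
        then show ?thesis using False by (simp add: mixed_density_eq)
      qed
    qed
    also have "\<dots> = ennreal (\<integral>y. ?C ^ 3 * r1\<^sup>2 * envelope r0 y \<partial>lborel)"
      using C by (intro nn_integral_eq_integral integrable_mult_right integrable_envelope r0 AE_I2
          mult_nonneg_nonneg zero_le_power envelope_nonneg zero_le_power2)
    finally show ?thesis by (simp only: integral_mult_right_zero)
  qed
  have sup: "(SUP (\<theta>'', \<theta>')\<in>(ball \<theta> r \<inter> param_space) \<times> ball \<theta> r.
           \<integral>\<^sup>+y. ennreal (\<bar>partials js (\<lambda>t. loglik t y) \<theta>'\<bar> powr (2 + 1) * mixed_density \<theta>'' y) \<partial>lborel) < \<infinity>"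
    if js: "length js \<le> 2" for js
  proof (rule le_less_trans[OF SUP_least])
    show "ennreal (?C ^ 3 * r1\<^sup>2 * (\<integral>y. envelope r0 y \<partial>lborel)) < \<infinity>" by simp
  qed (use moment[OF js] in auto)
  show ?thesis
    unfolding smooth_order_def
  proof (rule conjI, simp, rule exI[of _ r], intro conjI)
    show "\<exists>A. (\<forall>\<theta>'\<in>param_space. AE y in obs_law \<theta>'. y \<in> A) \<and>
        (\<forall>y\<in>A. partials_exist_on 2 (\<lambda>t. loglik t y) (ball \<theta> r)) \<and>
        (\<forall>js. length js = 2 \<longrightarrow> continuous_on (ball \<theta> r \<times> A) (\<lambda>(t, y). partials js (\<lambda>t. loglik t y) t))"
      using exist cont AE_obs_law_quadrant by (intro exI[of _ quadrant]) blast
    show "\<exists>\<delta>>0. \<forall>js. length js \<le> 2 \<longrightarrow>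
        (SUP (\<theta>'', \<theta>')\<in>(ball \<theta> r \<inter> param_space) \<times> ball \<theta> r.
           \<integral>\<^sup>+y. ennreal (\<bar>partials js (\<lambda>t. loglik t y) \<theta>'\<bar> powr (2 + \<delta>) * mixed_density \<theta>'' y) \<partial>lborel) < \<infinity>"
      by (intro exI[of _ "1::real"] conjI allI impI sup zero_less_one)
  qed (rule r(1))
qed

section \<open>Quadratic forms and covariance matrices\<close>

lemma invertible_iff_kernel:
  fixes A :: "real^'n^'n"
  shows "invertible A \<longleftrightarrow> (\<forall>x. A *v x = 0 \<longrightarrow> x = 0)"
  by (simp add: invertible_left_inverse matrix_left_invertible_ker)

lemma pos_def_invertible:
  fixes A :: "real^'n^'n"
  assumes "pos_def_matrix A"
  shows "invertible A"
  unfolding invertible_iff_kernel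
proof (intro allI impI)
  fix x :: "real^'n" assume "A *v x = 0"
  then have "x \<bullet> (A *v x) = 0" by simp
  then show "x = 0" using assms by (auto simp: pos_def_matrix_def)
qed

lemma pos_def_congruence:
  fixes A P :: "real^'n^'n"
  assumes A: "pos_def_matrix A" and P: "invertible P"
  shows "pos_def_matrix (P ** A ** transpose P)"
  unfolding pos_def_matrix_def
proof (intro conjI allI impI)
  show "transpose (P ** A ** transpose P) = P ** A ** transpose P"
    using A by (simp add: matrix_transpose_mul matrix_mul_assoc pos_def_matrix_def)
  fix x :: "real^'n" assume "x \<noteq> 0"
  moreover have "invertible (transpose P)" using P by (rule transpose_invertible)
  ultimately have "transpose P *v x \<noteq> 0" by (auto simp: invertible_iff_kernel)
  then have "0 < (transpose P *v x) \<bullet> (A *v (transpose P *v x))"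
    using A by (auto simp: pos_def_matrix_def)
  then show "0 < x \<bullet> (P ** A ** transpose P *v x)"
    by (metis dot_lmul_matrix inner_commute matrix_vector_mul_assoc transpose_matrix_vector)
qed

text \<open>A right inverse of the product yields one of its left factor. For an arbitrary
  admissible choice this is how invertibility of the linear map is obtained, since only its
  covariance matrix is known to be positive definite.\<close>

lemma invertible_congruence_factor:
  fixes A P :: "real^'n^'n"
  assumes "invertible (P ** A ** transpose P)"
  shows "invertible P"
proof -
  obtain B where "(P ** A ** transpose P) ** B = mat 1" using assms by (auto simp: invertible_def)
  then have "P ** (A ** transpose P ** B) = mat 1" by (simp add: matrix_mul_assoc)
  then show ?thesis by (auto simp: invertible_right_inverse)
qed

lemma matrix_inv_mult_vector:
  fixes A :: "real^'n^'n"
  assumes "invertible A"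
  shows "A *v (matrix_inv A *v x) = x" "matrix_inv A *v (A *v x) = x"
proof -
  have "A ** matrix_inv A = mat 1 \<and> matrix_inv A ** A = mat 1"
    unfolding matrix_inv_def using assms unfolding invertible_def by (rule someI_ex)
  then show "A *v (matrix_inv A *v x) = x" "matrix_inv A *v (A *v x) = x"
    by (simp_all add: matrix_vector_mul_assoc)
qed

text \<open>Let z solve P A P^T z = P s. Cancelling P gives P^T z = A^-1 s, and moving P across the
  inner product turns the left form into the right one.\<close>

lemma quadratic_form_congruence:
  fixes A P :: "real^'n^'n"
  assumes A: "invertible A" and P: "invertible P"
  shows "(P *v s) \<bullet> (matrix_inv (P ** A ** transpose P) *v (P *v s)) = s \<bullet> (matrix_inv A *v s)"
proof -
  have Pt: "invertible (transpose P)" using P by (rule transpose_invertible)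
  have PAP: "invertible (P ** A ** transpose P)" by (intro invertible_mult P A Pt)
  define z where "z = matrix_inv (P ** A ** transpose P) *v (P *v s)"
  have "P *v (A *v (transpose P *v z)) = (P ** A ** transpose P) *v z"
    by (simp only: matrix_vector_mul_assoc matrix_mul_assoc)
  also have "\<dots> = P *v s" unfolding z_def by (rule matrix_inv_mult_vector(1)[OF PAP])
  finally have "P *v (A *v (transpose P *v z)) = P *v s" .
  then have "A *v (transpose P *v z) = s" using matrix_inv_mult_vector(2)[OF P] by metis
  then have "transpose P *v z = matrix_inv A *v s" using matrix_inv_mult_vector(2)[OF A] by metis
  moreover have "(P *v s) \<bullet> z = s \<bullet> (transpose P *v z)"
    by (metis dot_lmul_matrix inner_commute transpose_matrix_vector)
  ultimately show ?thesis by (simp add: z_def)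
qed

text \<open>Cramer's rule; a rational expression in the entries makes continuity in the parameter
  visible, which \<open>matrix_inv\<close> does not.\<close>

lemma quadratic_form_2:
  fixes A :: "real^2^2"
  assumes sym: "A$1$2 = A$2$1" and det: "A$1$1 * A$2$2 - A$1$2 * A$1$2 \<noteq> 0" and inv: "invertible A"
  shows "s \<bullet> (matrix_inv A *v s) = (A$2$2 * (s$1)\<^sup>2 - 2 * A$1$2 * s$1 * s$2 + A$1$1 * (s$2)\<^sup>2) / (A$1$1 * A$2$2 - A$1$2 * A$1$2)"
proof -
  define z where "z = matrix_inv A *v s"
  have "A *v z = s" unfolding z_def by (rule matrix_inv_mult_vector[OF inv])
  then have s: "s$1 = A$1$1 * z$1 + A$1$2 * z$2" "s$2 = A$1$2 * z$1 + A$2$2 * z$2"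
    using sym by (auto simp: matrix_vector_mult_def sum_2)
  have "A$2$2 * (s$1)\<^sup>2 - 2 * A$1$2 * s$1 * s$2 + A$1$1 * (s$2)\<^sup>2
      = (s$1 * z$1 + s$2 * z$2) * (A$1$1 * A$2$2 - A$1$2 * A$1$2)"
    unfolding s by algebra
  then show ?thesis using det by (simp add: z_def[symmetric] inner_vec_def sum_2)
qed

lemma pos_def_2I:
  fixes A :: "real^2^2"
  assumes "A$1$2 = A$2$1"
    and "\<And>a b. a \<noteq> 0 \<or> b \<noteq> 0 \<Longrightarrow> 0 < a\<^sup>2 * A$1$1 + 2 * a * b * A$1$2 + b\<^sup>2 * A$2$2"
  shows "pos_def_matrix A"
  unfolding pos_def_matrix_def
proof (intro conjI allI impI)
  show "transpose A = A" using assms(1) by (simp add: transpose_def vec_eq_iff forall_2)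
  fix x :: "real^2" assume "x \<noteq> 0"
  then have "x$1 \<noteq> 0 \<or> x$2 \<noteq> 0" by (simp add: vec_eq_iff forall_2)
  from assms(2)[OF this] show "0 < x \<bullet> (A *v x)"
    using assms(1) by (simp add: inner_vec_def matrix_vector_mult_def sum_2 algebra_simps power2_eq_square)
qed

text \<open>An explicit eigenvector for the larger eigenvalue and its rotation by a right angle. A
  diagonal matrix is treated apart because the explicit vector may be zero there.\<close>

lemma symmetric_2_eigenvectors:
  fixes A :: "real^2^2"
  assumes sym: "A$1$2 = A$2$1"
  obtains v where "orthonormal_eigenvectors A v"
proof (cases "A$1$2 = 0")
  case True
  have "orthonormal_eigenvectors A (\<lambda>j. axis j 1)"
    unfolding orthonormal_eigenvectors_def
  proof (intro conjI allI)
    show "axis i 1 \<bullet> (axis j 1 :: real^2) = (if i = j then 1 else 0)" for i j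
      by (simp add: inner_axis_axis)
    show "\<exists>c. A *v axis j 1 = c *\<^sub>R axis j 1" for j
      using True sym exhaust_2[of j]
      by (intro exI[of _ "A$j$j"]) (auto simp: vec_eq_iff forall_2 matrix_vector_mult_def sum_2 axis_def)
  qed
  then show thesis by (rule that)
next
  case False
  define a b d where "a = A$1$1" and "b = A$1$2" and "d = A$2$2"
  define q where "q = sqrt ((a - d)\<^sup>2 + 4 * b\<^sup>2)"
  \<comment> \<open>The larger root of the characteristic polynomial; the other one is a + d -
    \<mu>, by the trace.\<close>
  define \<mu> where "\<mu> = ((a + d) + q) / 2"
  have \<mu>: "\<mu>\<^sup>2 = (a + d) * \<mu> - a * d + b\<^sup>2"
  proof -
    have "2 * \<mu> - (a + d) = q" by (simp add: \<mu>_def field_simps)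
    then have "(2 * \<mu> - (a + d))\<^sup>2 = (a - d)\<^sup>2 + 4 * b\<^sup>2" by (simp add: q_def)
    then show ?thesis by (simp add: power2_eq_square algebra_simps)
  qed
  define N where "N = sqrt (b\<^sup>2 + (\<mu> - a)\<^sup>2)"
  have N: "0 < N" "N\<^sup>2 = b\<^sup>2 + (\<mu> - a)\<^sup>2"
    using False by (auto simp: N_def b_def add_pos_nonneg)
  define v :: "2 \<Rightarrow> real^2" where "v j = (if j = 1 then vector [b / N, (\<mu> - a) / N] else vector [- (\<mu> - a) / N, b / N])" for j
  have "orthonormal_eigenvectors A v"
    unfolding orthonormal_eigenvectors_def
  proof (intro conjI allI)
    have 1: "b / N * (b / N) + (\<mu> - a) / N * ((\<mu> - a) / N) = 1"
    proof -
      have "b / N * (b / N) + (\<mu> - a) / N * ((\<mu> - a) / N) = (b\<^sup>2 + (\<mu> - a)\<^sup>2) / N\<^sup>2"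
        by (simp add: power2_eq_square add_divide_distrib)
      also have "\<dots> = 1" unfolding N(2)[symmetric] using N(1) by simp
      finally show ?thesis .
    qed
    show "v i \<bullet> v j = (if i = j then 1 else 0)" for i j
    proof -
      have 2: "b * (a - \<mu>) / (N * N) + (\<mu> - a) * b / (N * N) = 0" "(a - \<mu>) * b / (N * N) + b * (\<mu> - a) / (N * N) = 0"
        by (simp_all add: add_divide_distrib[symmetric] algebra_simps)
      have 3: "(a - \<mu>) * (a - \<mu>) / (N * N) + b * b / (N * N) = 1"
        using 1 by (simp add: algebra_simps)
      show ?thesis using exhaust_2[of i] exhaust_2[of j] 1 2 3 by (auto simp: v_def inner_vec_def sum_2)
    qed
    show "\<exists>c. A *v v j = c *\<^sub>R v j" for j
    proof (cases "j = 1")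
      case True
      have "a * b + b * (\<mu> - a) = \<mu> * b" "b * b + d * (\<mu> - a) = \<mu> * (\<mu> - a)"
        using \<mu> by (simp_all add: algebra_simps power2_eq_square)
      then have "A *v v j = \<mu> *\<^sub>R v j"
        using True sym
        by (simp add: v_def vec_eq_iff forall_2 matrix_vector_mult_def sum_2 a_def[symmetric] b_def[symmetric] d_def[symmetric] add_divide_distrib[symmetric])
      then show ?thesis by blast
    next
      case False
      have "a * - (\<mu> - a) + b * b = (a + d - \<mu>) * - (\<mu> - a)" "b * - (\<mu> - a) + d * b = (a + d - \<mu>) * b"
        using \<mu> by (simp_all add: algebra_simps power2_eq_square)
      then have "A *v v j = (a + d - \<mu>) *\<^sub>R v j"
        using False sym
        by (simp add: v_def vec_eq_iff forall_2 matrix_vector_mult_def sum_2 a_def[symmetric] b_def[symmetric] d_def[symmetric] add_divide_distrib[symmetric] diff_divide_distrib[symmetric])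
      then show ?thesis by blast
    qed
  qed
  then show thesis by (rule that)
qed

section \<open>Covariance of linear images and of sums\<close>

lemma cov_matrix_linear:
  fixes S :: "'a \<Rightarrow> real^'n" and P A :: "real^'n^'n"
  assumes mean: "\<And>i. has_bochner_integral M (\<lambda>y. S y $ i) 0"
    and cov: "\<And>i j. has_bochner_integral M (\<lambda>y. S y $ i * S y $ j) (A $ i $ j)"
  shows "cov_matrix M (\<lambda>y. P *v S y) = P ** A ** transpose P"
proof -
  have m: "(\<integral>y. (P *v S y) $ i \<partial>M) = 0" for i
  proof -
    have "has_bochner_integral M (\<lambda>y. \<Sum>k\<in>UNIV. P $ i $ k * S y $ k) (\<Sum>k\<in>UNIV. P $ i $ k * 0)"
      by (intro has_bochner_integral_sum has_bochner_integral_mult_right mean)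
    then show ?thesis by (simp add: matrix_vector_mult_def has_bochner_integral_iff)
  qed
  have "(\<integral>y. (P *v S y) $ i * (P *v S y) $ j \<partial>M) = (P ** A ** transpose P) $ i $ j" for i j
  proof -
    have "has_bochner_integral M (\<lambda>y. \<Sum>l\<in>UNIV. \<Sum>k\<in>UNIV. P $ j $ l * (P $ i $ k * (S y $ k * S y $ l)))
        (\<Sum>l\<in>UNIV. \<Sum>k\<in>UNIV. P $ j $ l * (P $ i $ k * A $ k $ l))"
      by (intro has_bochner_integral_sum has_bochner_integral_mult_right cov)
    moreover have "(P *v S y) $ i * (P *v S y) $ j = (\<Sum>l\<in>UNIV. \<Sum>k\<in>UNIV. P $ j $ l * (P $ i $ k * (S y $ k * S y $ l)))" for y
    proof -
      have "(P *v S y) $ i * (P *v S y) $ j = (\<Sum>l\<in>UNIV. \<Sum>k\<in>UNIV. (P $ i $ k * S y $ k) * (P $ j $ l * S y $ l))"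
        by (simp only: matrix_vector_mult_def vec_lambda_beta sum_product) (rule sum.swap)
      then show ?thesis by (simp only: mult_ac)
    qed
    moreover have "(P ** A ** transpose P) $ i $ j = (\<Sum>l\<in>UNIV. \<Sum>k\<in>UNIV. P $ j $ l * (P $ i $ k * A $ k $ l))"
      by (simp add: matrix_matrix_mult_def transpose_def sum_distrib_left mult_ac)
    ultimately show ?thesis by (simp add: has_bochner_integral_iff)
  qed
  then show ?thesis by (simp add: cov_matrix_def m vec_eq_iff)
qed

text \<open>Independence leaves only the n diagonal terms of the double sum. Each term is integrated
  as a product over all coordinates, most of whose factors are 1.\<close>

lemma PiM_sum_covariance:
  fixes f g :: "'a \<Rightarrow> real" and n :: nat and c :: real
  assumes M: "prob_space M" and f: "has_bochner_integral M f 0" and g: "has_bochner_integral M g 0"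
    and fg: "has_bochner_integral M (\<lambda>x. f x * g x) c"
  shows "has_bochner_integral (\<Pi>\<^sub>M i\<in>{..<n}. M) (\<lambda>\<omega>. \<Sum>i<n. f (\<omega> i)) 0"
    and "has_bochner_integral (\<Pi>\<^sub>M i\<in>{..<n}. M) (\<lambda>\<omega>. (\<Sum>i<n. f (\<omega> i)) * (\<Sum>i<n. g (\<omega> i))) (n * c)"
proof -
  interpret M: prob_space M by fact
  interpret product_sigma_finite "\<lambda>_::nat. M" by standard
  let ?P = "\<Pi>\<^sub>M i\<in>{..<n}. M"
  have one: "has_bochner_integral M (\<lambda>x. 1 :: real) 1"
    by (simp add: has_bochner_integral_iff M.prob_space)
  have prod: "has_bochner_integral ?P (\<lambda>\<omega>. \<Prod>k<n. F k (\<omega> k)) (\<Prod>k<n. I k)"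
    if "\<And>k. has_bochner_integral M (F k) (I k)" for F :: "nat \<Rightarrow> 'a \<Rightarrow> real" and I
    using that product_integrable_prod[of "{..<n}" F] product_integral_prod[of "{..<n}" F]
    by (simp add: has_bochner_integral_iff)
  have single: "has_bochner_integral ?P (\<lambda>\<omega>. f (\<omega> i)) 0" if "i < n" for i
  proof -
    have "has_bochner_integral ?P (\<lambda>\<omega>. \<Prod>k<n. (if k = i then f else (\<lambda>_. 1)) (\<omega> k)) (\<Prod>k<n. if k = i then 0 else 1)"
      by (rule prod) (use f one in auto)
    moreover have "(\<Prod>k<n. (if k = i then f else (\<lambda>_. 1)) (\<omega> k)) = f (\<omega> i)" for \<omega>
    proof -
      have "(\<Prod>k<n. (if k = i then f else (\<lambda>_. 1)) (\<omega> k)) = (\<Prod>k<n. if k = i then f (\<omega> k) else 1)"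
        by (intro prod.cong) auto
      then show ?thesis using that by (simp add: prod.delta)
    qed
    ultimately show ?thesis using that by (simp add: prod.delta)
  qed
  have "has_bochner_integral ?P (\<lambda>\<omega>. \<Sum>i<n. f (\<omega> i)) (\<Sum>i<n. 0)"
    by (intro has_bochner_integral_sum single) simp
  then show "has_bochner_integral ?P (\<lambda>\<omega>. \<Sum>i<n. f (\<omega> i)) 0" by simp
  have pair: "has_bochner_integral ?P (\<lambda>\<omega>. f (\<omega> i) * g (\<omega> j)) (if i = j then c else 0)" if ij: "i < n" "j < n" for i j
  proof -
    \<comment> \<open>The two conditional factors merge to f g at coordinate i when i = j, and
      otherwise place f at i and g at j.\<close>
    let ?F = "\<lambda>k x. (if k = i then f x else 1) * (if k = j then g x else 1)"
    let ?I = "\<lambda>k. if k = i \<and> k = j then c else if k = i \<or> k = j then 0 else (1::real)"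
    have "has_bochner_integral ?P (\<lambda>\<omega>. \<Prod>k<n. ?F k (\<omega> k)) (\<Prod>k<n. ?I k)"
      by (rule prod) (use f g fg one in auto)
    moreover have "(\<Prod>k<n. ?F k (\<omega> k)) = f (\<omega> i) * g (\<omega> j)" for \<omega>
      using ij by (simp add: prod.distrib prod.delta)
    moreover have "(\<Prod>k<n. ?I k) = (if i = j then c else 0)"
    proof (cases "i = j")
      case True
      then have "(\<Prod>k<n. ?I k) = (\<Prod>k<n. if k = i then c else 1)" by (intro prod.cong) auto
      then show ?thesis using True ij by (simp add: prod.delta)
    next
      case False
      then show ?thesis using ij by (auto intro!: prod_zero bexI[of _ i])
    qed
    ultimately show ?thesis by simp
  qed
  have "has_bochner_integral ?P (\<lambda>\<omega>. \<Sum>i<n. \<Sum>j<n. f (\<omega> i) * g (\<omega> j)) (\<Sum>i<n. \<Sum>j<n. if i = j then c else 0)"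
    by (intro has_bochner_integral_sum pair) auto
  moreover have "(\<Sum>i<n. \<Sum>j<n. if i = j then c else 0) = n * c" by simp
  ultimately show "has_bochner_integral ?P (\<lambda>\<omega>. (\<Sum>i<n. f (\<omega> i)) * (\<Sum>i<n. g (\<omega> i))) (n * c)"
    by (simp only: sum_product)
qed

section \<open>Information, critical points and admissible choices\<close>

lemma param_space_ext: "\<theta> \<in> param_space \<Longrightarrow> \<theta> \<in> ext_space"
  using param_space_subset by blast

lemma measurable_nsc [measurable]: "(\<lambda>y. nsc \<theta> y $ j) \<in> borel_measurable borel"
  unfolding nsc_def by simp

lemma nsc_moments:
  assumes \<theta>: "\<theta> \<in> param_space"
  shows "has_bochner_integral (obs_law \<theta>) (\<lambda>y. nsc \<theta> y $ j) 0"
    and "has_bochner_integral (obs_law \<theta>) (\<lambda>y. nsc \<theta> y $ i * nsc \<theta> y $ j) (gram \<theta> $ i $ j)"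
proof -
  have "has_bochner_integral (obs_law \<theta>) (\<lambda>y. nscore j \<theta> (ysum y)) 0"
    using nscore_integrable[OF \<theta>] nscore_mean[OF \<theta>] by (simp add: has_bochner_integral_iff)
  moreover have "AE y in obs_law \<theta>. nsc \<theta> y $ j = nscore j \<theta> (ysum y)" for j
    using AE_obs_law_quadrant[OF \<theta>] by eventually_elim (simp add: nsc_def)
  ultimately show "has_bochner_integral (obs_law \<theta>) (\<lambda>y. nsc \<theta> y $ j) 0"
    by (subst has_bochner_integral_cong_AE) auto
  have "has_bochner_integral (obs_law \<theta>) (\<lambda>y. nscore i \<theta> (ysum y) * nscore j \<theta> (ysum y)) (gram \<theta> $ i $ j)"
    using nscore_integrable[OF \<theta>] by (simp add: has_bochner_integral_iff gram_def)
  moreover have "AE y in obs_law \<theta>. nsc \<theta> y $ i * nsc \<theta> y $ j = nscore i \<theta> (ysum y) * nscore j \<theta> (ysum y)"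
    using AE_obs_law_quadrant[OF \<theta>] by eventually_elim (simp add: nsc_def)
  ultimately show "has_bochner_integral (obs_law \<theta>) (\<lambda>y. nsc \<theta> y $ i * nsc \<theta> y $ j) (gram \<theta> $ i $ j)"
    by (subst has_bochner_integral_cong_AE) auto
qed

lemma nsum_nth: "nsum n \<theta> y $ j = (\<Sum>i<n. nsc \<theta> (y i) $ j)"
  by (simp add: nsum_def)

lemma nsum_moments:
  assumes \<theta>: "\<theta> \<in> param_space"
  shows "has_bochner_integral (sample_law n \<theta>) (\<lambda>y. nsum n \<theta> y $ j) 0"
    and "has_bochner_integral (sample_law n \<theta>) (\<lambda>y. nsum n \<theta> y $ i * nsum n \<theta> y $ j) ((real n *\<^sub>R gram \<theta>) $ i $ j)"
  unfolding nsum_nth sample_law_def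
  using PiM_sum_covariance[OF prob_space_obs_law[OF \<theta>] nsc_moments(1)[OF \<theta>] nsc_moments(1)[OF \<theta>] nsc_moments(2)[OF \<theta>]]
  by auto

lemma cov_matrix_nsum:
  fixes P :: "real^2^2"
  assumes "\<theta> \<in> param_space"
  shows "cov_matrix (sample_law n \<theta>) (\<lambda>y. P *v nsum n \<theta> y) = P ** (real n *\<^sub>R gram \<theta>) ** transpose P"
  by (rule cov_matrix_linear) (rule nsum_moments[OF assms])+

lemma info_n_eq:
  assumes "\<theta> \<in> param_space"
  shows "info_n n \<theta> = rescale \<theta> ** (real n *\<^sub>R gram \<theta>) ** transpose (rescale \<theta>)"
proof -
  have "score_n n \<theta> = (\<lambda>y. rescale \<theta> *v nsum n \<theta> y)"
    using param_space_ext[OF assms] by (simp add: fun_eq_iff score_n_eq)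
  then show ?thesis unfolding info_n_def using cov_matrix_nsum[OF assms] by simp
qed

lemma gram_pos_def:
  assumes \<theta>: "\<theta> \<in> param_space" and n: "1 \<le> n"
  shows "pos_def_matrix (real n *\<^sub>R gram \<theta>)"
proof (rule pos_def_2I)
  show "(real n *\<^sub>R gram \<theta>) $ 1 $ 2 = (real n *\<^sub>R gram \<theta>) $ 2 $ 1" by (simp add: gram_sym[of \<theta> 1 2])
  fix a b :: real assume "a \<noteq> 0 \<or> b \<noteq> 0"
  then have "0 < real n * (a\<^sup>2 * gram \<theta> $ 1 $ 1 + 2 * a * b * gram \<theta> $ 1 $ 2 + b\<^sup>2 * gram \<theta> $ 2 $ 2)"
    using n by (intro mult_pos_pos gram_pos[OF \<theta>]) auto
  then show "0 < a\<^sup>2 * (real n *\<^sub>R gram \<theta>) $ 1 $ 1 + 2 * a * b * (real n *\<^sub>R gram \<theta>) $ 1 $ 2 + b\<^sup>2 * (real n *\<^sub>R gram \<theta>) $ 2 $ 2"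
    by (simp add: algebra_simps)
qed

lemma gram_det_pos:
  assumes \<theta>: "\<theta> \<in> param_space"
  shows "0 < gram \<theta> $ 2 $ 2" "0 < gram \<theta> $ 1 $ 1 * gram \<theta> $ 2 $ 2 - gram \<theta> $ 1 $ 2 * gram \<theta> $ 1 $ 2"
proof -
  let ?a = "gram \<theta> $ 1 $ 1" and ?b = "gram \<theta> $ 1 $ 2" and ?d = "gram \<theta> $ 2 $ 2"
  show d: "0 < ?d" using gram_pos[OF \<theta>, of 0 1] by simp
  \<comment> \<open>The vector (d, -b) turns the form into d times the determinant.\<close>
  have "0 < ?d\<^sup>2 * ?a + 2 * ?d * - ?b * ?b + (- ?b)\<^sup>2 * ?d"
    using d by (intro gram_pos[OF \<theta>]) auto
  also have "\<dots> = ?d * (?a * ?d - ?b * ?b)" by (simp add: algebra_simps power2_eq_square)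
  finally show "0 < ?a * ?d - ?b * ?b" using d by (simp add: zero_less_mult_iff)
qed

section \<open>Invariance of the statistic under linear maps\<close>

definition ext_stat :: "nat \<Rightarrow> real^2 \<Rightarrow> (nat \<Rightarrow> real^2) \<Rightarrow> real" where
  "ext_stat n \<theta> y = nsum n \<theta> y \<bullet> (matrix_inv (real n *\<^sub>R gram \<theta>) *v nsum n \<theta> y)"

text \<open>Used twice: for the score, where P is \<open>rescale\<close>, and for the modified
  score, where the rows of P come from \<open>admissible_row\<close>.\<close>

lemma linear_stat:
  fixes P :: "real^2^2"
  assumes \<theta>: "\<theta> \<in> param_space" and n: "1 \<le> n" and X: "\<And>y. X y = P *v nsum n \<theta> y"
    and inv: "invertible (cov_matrix (sample_law n \<theta>) X)"
  shows "X y \<bullet> (matrix_inv (cov_matrix (sample_law n \<theta>) X) *v X y) = ext_stat n \<theta> y"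
proof -
  have "X = (\<lambda>y. P *v nsum n \<theta> y)" using X by auto
  then have cov: "cov_matrix (sample_law n \<theta>) X = P ** (real n *\<^sub>R gram \<theta>) ** transpose P"
    using cov_matrix_nsum[OF \<theta>] by simp
  then have "invertible P"
    using inv by (intro invertible_congruence_factor[of P "real n *\<^sub>R gram \<theta>"]) simp
  then show ?thesis
    unfolding cov X ext_stat_def
    by (rule quadratic_form_congruence[OF pos_def_invertible[OF gram_pos_def[OF \<theta> n]]])
qed

lemma score_stat_eq:
  assumes \<theta>: "\<theta> \<in> param_space" and n: "1 \<le> n" and "\<not> critical n \<theta>"
  shows "score_stat n \<theta> y = ext_stat n \<theta> y"
  unfolding score_stat_def info_n_def
proof (rule linear_stat[OF \<theta> n])
  show "score_n n \<theta> y = rescale \<theta> *v nsum n \<theta> y" for y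
    using param_space_ext[OF \<theta>] by (rule score_n_eq)
qed (use assms(3) in \<open>simp add: critical_def info_n_def\<close>)

lemma invertible_rescale: "\<theta>$1 \<noteq> 0 \<Longrightarrow> invertible (rescale \<theta>)"
  by (auto simp: invertible_iff_kernel vec_eq_iff forall_2 rescale_mult)

lemma not_critical:
  assumes "\<theta> \<in> param_space" "1 \<le> n" "\<theta>$1 \<noteq> 0"
  shows "\<not> critical n \<theta>"
  unfolding critical_def info_n_eq[OF assms(1)]
  using pos_def_invertible[OF pos_def_congruence[OF gram_pos_def[OF assms(1,2)] invertible_rescale[OF assms(3)]]] by simp

section \<open>Admissible orders and eigenvectors\<close>

text \<open>A nonzero combination has positive second moment. This turns almost sure vanishing
  conditions on the score into algebraic equations for an eigenvector.\<close>

lemma nsum_nondegenerate: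
  assumes \<theta>: "\<theta> \<in> param_space" and n: "1 \<le> n" and AE0: "AE y in sample_law n \<theta>. a \<bullet> nsum n \<theta> y = 0"
  shows "a = 0"
proof (rule ccontr)
  assume "a \<noteq> 0"
  then have "a$1 \<noteq> 0 \<or> a$2 \<noteq> 0" by (simp add: vec_eq_iff forall_2)
  let ?s = "\<lambda>j y. nsum n \<theta> y $ j" and ?g = "real n *\<^sub>R gram \<theta>"
  have "has_bochner_integral (sample_law n \<theta>) (\<lambda>y. (a$1)\<^sup>2 * (?s 1 y * ?s 1 y) + 2 * a$1 * a$2 * (?s 1 y * ?s 2 y) + (a$2)\<^sup>2 * (?s 2 y * ?s 2 y))
     ((a$1)\<^sup>2 * ?g$1$1 + 2 * a$1 * a$2 * ?g$1$2 + (a$2)\<^sup>2 * ?g$2$2)"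
    by (intro has_bochner_integral_add has_bochner_integral_mult_right nsum_moments \<theta>)
  moreover have "(a$1)\<^sup>2 * (?s 1 y * ?s 1 y) + 2 * a$1 * a$2 * (?s 1 y * ?s 2 y) + (a$2)\<^sup>2 * (?s 2 y * ?s 2 y) = (a \<bullet> nsum n \<theta> y)\<^sup>2" for y
    by (simp add: inner_vec_def sum_2 power2_eq_square algebra_simps)
  ultimately have "(\<integral>y. (a \<bullet> nsum n \<theta> y)\<^sup>2 \<partial>sample_law n \<theta>) = (a$1)\<^sup>2 * ?g$1$1 + 2 * a$1 * a$2 * ?g$1$2 + (a$2)\<^sup>2 * ?g$2$2"
    by (simp only: has_bochner_integral_iff)
  also have "\<dots> = real n * ((a$1)\<^sup>2 * gram \<theta> $ 1 $ 1 + 2 * a$1 * a$2 * gram \<theta> $ 1 $ 2 + (a$2)\<^sup>2 * gram \<theta> $ 2 $ 2)"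
    by (simp add: algebra_simps)
  also have "\<dots> > 0" using n by (intro mult_pos_pos gram_pos[OF \<theta>]) (use \<open>a$1 \<noteq> 0 \<or> a$2 \<noteq> 0\<close> in auto)
  finally have "(\<integral>y. (a \<bullet> nsum n \<theta> y)\<^sup>2 \<partial>sample_law n \<theta>) > 0" .
  moreover have "(\<integral>y. (a \<bullet> nsum n \<theta> y)\<^sup>2 \<partial>sample_law n \<theta>) = 0"
    by (rule integral_eq_zero_AE) (use AE0 in eventually_elim, simp)
  ultimately show False by simp
qed

lemma rescale_inner: "(rescale \<theta> *v x) \<bullet> v = (rescale \<theta> *v v) \<bullet> x"
  by (simp add: inner_vec_def sum_2 rescale_mult)

lemma nabla_0: "nabla j 0 G \<theta> = G \<theta>"
  by (simp add: nabla_def vec_eq_iff)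

lemma nabla_nth: "nabla j l G \<theta> $ i = (partial j ^^ l) (\<lambda>t. G t $ i) \<theta>"
  by (simp add: nabla_def)

text \<open>Order 1 gives the rescaled eigenvector. A higher order requires the score along
  \<open>v j\<close> to vanish, which by nondegeneracy forces \<open>\<theta>$1 = 0\<close> and
  \<open>v j\<close> to be a multiple of the first axis. The derivative of the score in that
  direction is then known explicitly for either j.\<close>

lemma admissible_row:
  assumes \<theta>: "\<theta> \<in> param_space" and n: "1 \<le> n" and adm: "admissible K n \<theta> k v"
  shows "\<exists>p. \<forall>y. nabla j (k j - 1) (\<lambda>t. score t y) \<theta> \<bullet> v j = p \<bullet> nsc \<theta> y"
proof (cases "k j = 1")
  case True
  have "nabla j (k j - 1) (\<lambda>t. score t y) \<theta> \<bullet> v j = (rescale \<theta> *v v j) \<bullet> nsc \<theta> y" for y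
    using True param_space_ext[OF \<theta>] by (simp add: nabla_0 score_eq rescale_inner)
  then show ?thesis by blast
next
  case False
  note E = param_space_ext[OF \<theta>]
  have "1 \<le> k j" using adm by (auto simp: admissible_def)
  with False have k2: "2 \<le> k j" by simp
  have vanish: "AE y in sample_law n \<theta>. nabla j l (\<lambda>t. score_n n t y) \<theta> \<bullet> v j = 0" if "l + 2 \<le> k j" for l
    using adm that \<theta> unfolding admissible_def by blast
  have "AE y in sample_law n \<theta>. (rescale \<theta> *v v j) \<bullet> nsum n \<theta> y = 0"
    using vanish[of 0] k2 E by (simp add: nabla_0 score_n_eq rescale_inner)
  from nsum_nondegenerate[OF \<theta> n this] have Rv: "\<theta>$1 * v j $ 1 = 0" "v j $ 2 = 0"
    using rescale_mult[of \<theta> "v j"] by auto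
  have "v j \<bullet> v j = 1" using adm by (simp add: admissible_def orthonormal_eigenvectors_def)
  then have v1: "v j $ 1 \<noteq> 0" using Rv by (auto simp: inner_vec_def sum_2)
  then have \<theta>1: "\<theta>$1 = 0" using Rv by simp
  have inner: "x \<bullet> v j = x$1 * v j $ 1" for x :: "real^2" using Rv by (simp add: inner_vec_def sum_2)
  show ?thesis
  proof (cases "j = 1")
    case True
    \<comment> \<open>At order 3 the \<lambda>-derivative of the score would have to vanish too, but
      on this line it is a nondegenerate multiple of the first component of \<open>nsum\<close>. So
      the order is exactly 2.\<close>
    have "\<not> 3 \<le> k j"
    proof
      assume "3 \<le> k j"
      then have "AE y in sample_law n \<theta>. nabla 1 1 (\<lambda>t. score_n n t y) \<theta> \<bullet> v j = 0"
        using vanish[of 1] True by simp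
      then have "AE y in sample_law n \<theta>. v j \<bullet> nsum n \<theta> y = 0"
        by eventually_elim (simp add: inner nabla_nth partial_score_axis[OF E \<theta>1] inner_commute[of "v j"])
      then have "v j = 0" by (rule nsum_nondegenerate[OF \<theta> n])
      then show False using v1 by simp
    qed
    then have "k j - 1 = 1" using k2 by simp
    then have "nabla j (k j - 1) (\<lambda>t. score t y) \<theta> \<bullet> v j = v j \<bullet> nsc \<theta> y" for y
      by (simp add: inner[unfolded True] True nabla_nth partial_score_axis[OF E \<theta>1] inner_commute[of "v 1"])
    then show ?thesis by blast
  next
    case False
    then have j: "j = 2" using exhaust_2[of j] by auto
    \<comment> \<open>The \<lambda>-score vanishes along the whole line, so derivatives in \<psi>
      give nothing and the row is zero.\<close>
    have "(partial 2 ^^ l) (\<lambda>t. score t y $ 1) \<theta> = 0" for l y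
      by (rule partial2_iterate_axis[OF \<theta>1 _ E]) (simp add: score_eq rescale_mult)
    then have "nabla j (k j - 1) (\<lambda>t. score t y) \<theta> \<bullet> v j = 0 \<bullet> nsc \<theta> y" for y
      by (simp add: inner[unfolded j] nabla_nth j)
    then show ?thesis by blast
  qed
qed

lemma mod_score_linear:
  assumes "\<And>j y. nabla j (k j - 1) (\<lambda>t. score t y) \<theta> \<bullet> v j = p j \<bullet> nsc \<theta> y"
  shows "mod_score k v n \<theta> y = (\<chi> j. p j) *v nsum n \<theta> y"
  using assms by (simp add: vec_eq_iff mod_score_def matrix_vector_mul_component nsum_def inner_sum_right)

lemma mod_score_stat_eq:
  assumes \<theta>: "\<theta> \<in> param_space" and n: "1 \<le> n" and adm: "admissible K n \<theta> k v"
  shows "mod_score_stat k v n \<theta> y = ext_stat n \<theta> y"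
proof -
  obtain p where p: "\<And>j y. nabla j (k j - 1) (\<lambda>t. score t y) \<theta> \<bullet> v j = p j \<bullet> nsc \<theta> y"
    using admissible_row[OF assms] by metis
  have "invertible (mod_info k v n \<theta>)"
    using adm by (intro pos_def_invertible) (simp add: admissible_def)
  then show ?thesis
    unfolding mod_score_stat_def mod_info_def
    by (intro linear_stat[OF \<theta> n mod_score_linear[OF p]])
qed

lemma matrix_nth_rescale:
  "(rescale \<theta> ** A ** transpose (rescale \<theta>)) $ i $ j = (if i = 1 then \<theta>$1 else 1) * A $ i $ j * (if j = 1 then \<theta>$1 else 1)"
  using exhaust_2[of i] exhaust_2[of j]
  by (auto simp: matrix_matrix_mult_def transpose_def rescale_def sum_2)

text \<open>At \<open>\<theta>$1 = 0\<close> the information matrix is diagonal with first entry 0,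
  so the axes are eigenvectors; orders 2 and 1 make the modified score equal to \<open>nsum\<close>.
  Elsewhere order 1 suffices, and the modified score is the score rotated into any orthonormal
  eigenbasis.\<close>

lemma admissible_exists:
  assumes \<theta>: "\<theta> \<in> param_space" and n: "1 \<le> n"
  shows "\<exists>k v. admissible 2 n \<theta> k v"
proof (cases "\<theta>$1 = 0")
  case True
  note E = param_space_ext[OF \<theta>]
  define k :: "2 \<Rightarrow> nat" where "k j = (if j = 1 then 2 else 1)" for j
  define v :: "2 \<Rightarrow> real^2" where "v j = axis j 1" for j
  have "nabla j (k j - 1) (\<lambda>t. score t y) \<theta> \<bullet> v j = axis j 1 \<bullet> nsc \<theta> y" for j y
    using exhaust_2[of j] E True partial_score_axis(1)[OF E True, of y]
    by (auto simp: k_def v_def inner_axis inner_axis' nabla_nth nabla_0 score_eq rescale_mult)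
  from mod_score_linear[OF this] have "mod_score k v n \<theta> y = nsum n \<theta> y" for y
    by (simp add: vec_eq_iff matrix_vector_mul_component inner_axis')
  then have "mod_score k v n \<theta> = (\<lambda>y. mat 1 *v nsum n \<theta> y)" by auto
  then have mod_info: "mod_info k v n \<theta> = real n *\<^sub>R gram \<theta>"
    unfolding mod_info_def using cov_matrix_nsum[OF \<theta>, of n "mat 1"] by (simp add: transpose_mat)
  have eig: "orthonormal_eigenvectors (info_n n \<theta>) v"
    unfolding orthonormal_eigenvectors_def
  proof (intro conjI allI)
    show "v i \<bullet> v j = (if i = j then 1 else 0)" for i j by (simp add: v_def inner_axis_axis)
    show "\<exists>c. info_n n \<theta> *v v j = c *\<^sub>R v j" for j
      using exhaust_2[of j] True unfolding info_n_eq[OF \<theta>]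
      by (intro exI[of _ "(rescale \<theta> ** (real n *\<^sub>R gram \<theta>) ** transpose (rescale \<theta>)) $ j $ j"])
        (auto simp: vec_eq_iff forall_2 matrix_vector_mult_def sum_2 v_def axis_def matrix_nth_rescale)
  qed
  have "nabla j l (\<lambda>t. score_n n t y) \<theta>' \<bullet> v j = 0"
    if "l + 2 \<le> k j" "\<theta>' \<in> param_space" "\<theta>'$j = \<theta>$j" for j l y \<theta>'
  proof -
    have "j = 1" "l = 0" using that by (auto simp: k_def split: if_splits)
    moreover have "\<theta>' \<in> ext_space" using that param_space_subset by auto
    ultimately show ?thesis using that True by (simp add: nabla_0 v_def inner_axis score_n_eq rescale_mult)
  qed
  then have "admissible 2 n \<theta> k v"
    using eig mod_info gram_pos_def[OF \<theta> n] smooth_order_2[OF \<theta>]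
    unfolding admissible_def by (auto simp: k_def)
  then show ?thesis by blast
next
  case False
  note E = param_space_ext[OF \<theta>]
  have info: "info_n n \<theta> $ 1 $ 2 = info_n n \<theta> $ 2 $ 1"
    unfolding info_n_eq[OF \<theta>] matrix_nth_rescale by (simp add: gram_sym[of \<theta> 1 2])
  obtain v where v: "orthonormal_eigenvectors (info_n n \<theta>) v"
    using symmetric_2_eigenvectors[OF info] .
  let ?k = "\<lambda>_::2. 1::nat" and ?P = "\<chi> j. rescale \<theta> *v v j"
  have "nabla j (?k j - 1) (\<lambda>t. score t y) \<theta> \<bullet> v j = (rescale \<theta> *v v j) \<bullet> nsc \<theta> y" for j y
    using E by (simp add: nabla_0 score_eq rescale_inner)
  from mod_score_linear[OF this] have "mod_score ?k v n \<theta> = (\<lambda>y. ?P *v nsum n \<theta> y)" by auto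
  then have mod_info: "mod_info ?k v n \<theta> = ?P ** (real n *\<^sub>R gram \<theta>) ** transpose ?P"
    unfolding mod_info_def using cov_matrix_nsum[OF \<theta>] by simp
  \<comment> \<open>Orthonormality says that the matrix with rows \<open>v j\<close> times its
    transpose is the identity.\<close>
  have "(\<chi> j. v j) ** transpose (\<chi> j. v j) = mat 1"
    using v by (simp add: orthonormal_eigenvectors_def vec_eq_iff matrix_matrix_mult_def transpose_def mat_def inner_vec_def)
  then have V: "invertible (\<chi> j. v j)" by (auto simp: invertible_right_inverse)
  have "invertible ?P"
    unfolding invertible_iff_kernel
  proof (intro allI impI)
    fix x assume "?P *v x = 0"
    then have "(rescale \<theta> *v v j) \<bullet> x = 0" for j
      by (auto simp: vec_eq_iff matrix_vector_mul_component)
    then have "v j \<bullet> (rescale \<theta> *v x) = 0" for j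
      using rescale_inner[of \<theta> x "v j"] by (simp add: inner_commute)
    then have "(\<chi> j. v j) *v (rescale \<theta> *v x) = 0"
      by (simp add: vec_eq_iff matrix_vector_mul_component)
    then have "rescale \<theta> *v x = 0" using V by (simp add: invertible_iff_kernel)
    then show "x = 0" using invertible_rescale[OF False] by (simp add: invertible_iff_kernel)
  qed
  then have "pos_def_matrix (mod_info ?k v n \<theta>)"
    unfolding mod_info by (intro pos_def_congruence gram_pos_def \<theta> n)
  then have "admissible 2 n \<theta> ?k v"
    using v smooth_order_2[OF \<theta>] unfolding admissible_def by auto
  then show ?thesis by blast
qed

section \<open>Continuous extension and coverage\<close>

text \<open>An extensional product, because the points of the product measure space are undefined
  outside the index set.\<close>

definition sample_quadrant :: "nat \<Rightarrow> (nat \<Rightarrow> real^2) set" where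
  "sample_quadrant n = (\<Pi>\<^sub>E i\<in>{..<n}. quadrant)"

lemma prob_space_sample_law:
  assumes "\<theta> \<in> param_space"
  shows "prob_space (sample_law n \<theta>)"
  unfolding sample_law_def by (intro prob_space_PiM prob_space_obs_law assms)

lemma full_measure_sample_quadrant: "full_measure n (sample_quadrant n)"
  unfolding full_measure_def
proof (intro ballI conjI)
  fix \<theta> assume \<theta>: "\<theta> \<in> param_space"
  interpret P: prob_space "obs_law \<theta>" by (rule prob_space_obs_law[OF \<theta>])
  interpret product_sigma_finite "\<lambda>_::nat. obs_law \<theta>" by standard
  show "sample_quadrant n \<in> sets (sample_law n \<theta>)"
    unfolding sample_quadrant_def sample_law_def by (intro sets_PiM_I_finite) auto
  have "emeasure (obs_law \<theta>) quadrant = 1"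
    using AE_obs_law_quadrant[OF \<theta>] by (intro P.emeasure_eq_1_AE) auto
  then have "emeasure (sample_law n \<theta>) (sample_quadrant n) = 1"
    unfolding sample_quadrant_def sample_law_def by (subst emeasure_PiM) auto
  then show "measure (sample_law n \<theta>) (sample_quadrant n) = 1"
    by (simp add: measure_def)
qed

lemma AE_sample_quadrant:
  assumes "\<theta> \<in> param_space"
  shows "AE y in sample_law n \<theta>. y \<in> sample_quadrant n"
proof -
  interpret prob_space "sample_law n \<theta>" by (rule prob_space_sample_law[OF assms])
  show ?thesis
    using full_measure_sample_quadrant[of n] assms by (intro prob_eq_1[THEN iffD1]) (auto simp: full_measure_def)
qed

text \<open>With the inverse written out, continuity in parameter and data reduces to that of
  \<open>gram\<close> and \<open>nsum\<close>.\<close>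

lemma ext_stat_eq:
  assumes \<theta>: "\<theta> \<in> param_space" and n: "1 \<le> n"
  shows "ext_stat n \<theta> y = (gram \<theta> $ 2 $ 2 * (nsum n \<theta> y $ 1)\<^sup>2 - 2 * gram \<theta> $ 1 $ 2 * nsum n \<theta> y $ 1 * nsum n \<theta> y $ 2
     + gram \<theta> $ 1 $ 1 * (nsum n \<theta> y $ 2)\<^sup>2) / (real n * (gram \<theta> $ 1 $ 1 * gram \<theta> $ 2 $ 2 - gram \<theta> $ 1 $ 2 * gram \<theta> $ 1 $ 2))"
    (is "_ = (?d * ?s\<^sup>2 - 2 * ?b * ?s * ?t + ?a * ?t\<^sup>2) / (real n * ?D)")
proof -
  let ?A = "real n *\<^sub>R gram \<theta>"
  have det: "?A$1$1 * ?A$2$2 - ?A$1$2 * ?A$1$2 = real n * (real n * ?D)" by (simp add: algebra_simps)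
  have nz: "real n * (real n * ?D) \<noteq> 0" using gram_det_pos(2)[OF \<theta>] n by simp
  have "ext_stat n \<theta> y = (?A$2$2 * ?s\<^sup>2 - 2 * ?A$1$2 * ?s * ?t + ?A$1$1 * ?t\<^sup>2) / (?A$1$1 * ?A$2$2 - ?A$1$2 * ?A$1$2)"
    unfolding ext_stat_def
  proof (rule quadratic_form_2)
    show "?A$1$2 = ?A$2$1" by (simp add: gram_sym[of \<theta> 1 2])
    show "?A$1$1 * ?A$2$2 - ?A$1$2 * ?A$1$2 \<noteq> 0" unfolding det by (rule nz)
    show "invertible ?A" by (rule pos_def_invertible[OF gram_pos_def[OF \<theta> n]])
  qed
  also have "?A$2$2 * ?s\<^sup>2 - 2 * ?A$1$2 * ?s * ?t + ?A$1$1 * ?t\<^sup>2 = real n * (?d * ?s\<^sup>2 - 2 * ?b * ?s * ?t + ?a * ?t\<^sup>2)"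
    by (simp add: algebra_simps)
  finally show ?thesis unfolding det using n by simp
qed

text \<open>Restricted to \<open>sample_quadrant\<close>, the indicator in \<open>nsc\<close> is
  constantly 1, so its jump at the edge of the quadrant does no harm.\<close>

lemma continuous_on_nsum: "continuous_on (param_space \<times> sample_quadrant n) (\<lambda>p. nsum n (fst p) (snd p) $ j)"
proof (rule continuous_on_eq)
  have coord: "continuous_on A (\<lambda>p::(real^2) \<times> (nat \<Rightarrow> real^2). snd p i)" for i A
    by (rule continuous_on_product_then_coordinatewise[OF continuous_on_snd[OF continuous_on_id]])
  have "continuous_on (param_space \<times> sample_quadrant n) (\<lambda>p. nscore j (fst p) (ysum (snd p i)))" for i
  proof (rule continuous_on_nscore)
    show "continuous_on (param_space \<times> sample_quadrant n) fst"
      by (rule continuous_on_fst[OF continuous_on_id])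
    show "continuous_on (param_space \<times> sample_quadrant n) (\<lambda>p. ysum (snd p i))"
      by (rule continuous_on_ysum[OF coord])
    show "fst ` (param_space \<times> sample_quadrant n) \<subseteq> ext_space"
      by (rule image_subsetI) (rule param_space_ext, simp only: mem_Times_iff)
  qed
  then show "continuous_on (param_space \<times> sample_quadrant n) (\<lambda>p. \<Sum>i<n. nscore j (fst p) (ysum (snd p i)))"
    by (rule continuous_on_sum)
  show "(\<Sum>i<n. nscore j (fst p) (ysum (snd p i))) = nsum n (fst p) (snd p) $ j" if "p \<in> param_space \<times> sample_quadrant n" for p
  proof -
    have "snd p i \<in> quadrant" if "i < n" for i
      using \<open>p \<in> param_space \<times> sample_quadrant n\<close> that
      unfolding sample_quadrant_def mem_Times_iff PiE_iff by blast
    then show ?thesis unfolding nsum_nth by (intro sum.cong refl) (simp add: nsc_def)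
  qed
qed

lemma continuous_on_ext_stat:
  assumes n: "1 \<le> n"
  shows "continuous_on (param_space \<times> sample_quadrant n) (\<lambda>(\<theta>, y). ext_stat n \<theta> y)"
proof (rule continuous_on_eq)
  have gram: "continuous_on (param_space \<times> sample_quadrant n) (\<lambda>p. gram (fst p) $ i $ j)" for i j
    by (rule continuous_on_compose2[OF continuous_on_gram]) (auto intro!: continuous_intros)
  let ?g = "\<lambda>p i j. gram (fst p) $ i $ j" and ?s = "\<lambda>p j. nsum n (fst p) (snd p) $ j"
  have nz: "\<forall>p\<in>param_space \<times> sample_quadrant n. real n * (?g p 1 1 * ?g p 2 2 - ?g p 1 2 * ?g p 1 2) \<noteq> 0"
  proof
    fix p assume "p \<in> param_space \<times> sample_quadrant n"
    then have "0 < ?g p 1 1 * ?g p 2 2 - ?g p 1 2 * ?g p 1 2" by (intro gram_det_pos(2)) auto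
    then show "real n * (?g p 1 1 * ?g p 2 2 - ?g p 1 2 * ?g p 1 2) \<noteq> 0" using n by simp
  qed
  show "continuous_on (param_space \<times> sample_quadrant n) (\<lambda>p. (?g p 2 2 * (?s p 1)\<^sup>2 - 2 * ?g p 1 2 * ?s p 1 * ?s p 2
     + ?g p 1 1 * (?s p 2)\<^sup>2) / (real n * (?g p 1 1 * ?g p 2 2 - ?g p 1 2 * ?g p 1 2)))"
    by (intro continuous_on_divide[OF _ _ nz] continuous_on_add continuous_on_diff continuous_on_mult
        continuous_on_power continuous_on_const gram continuous_on_nsum)
qed (use n in \<open>auto simp: ext_stat_eq\<close>)

lemma cont_extension_ext_stat:
  assumes "1 \<le> n"
  shows "cont_extension n (sample_quadrant n) (ext_stat n)"
  unfolding cont_extension_def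
  by (intro conjI ballI impI continuous_on_ext_stat score_stat_eq[symmetric] assms)

text \<open>Points with \<open>\<theta>$1 \<noteq> 0\<close> are non-critical and accumulate at
  every point of the boundary line, so continuity in the parameter with y held fixed determines the
  extension.\<close>

lemma cont_extension_unique:
  assumes n: "1 \<le> n" and T: "cont_extension n (sample_quadrant n) T"
    and \<theta>: "\<theta> \<in> param_space" and y: "y \<in> sample_quadrant n"
  shows "T \<theta> y = ext_stat n \<theta> y"
proof (cases "\<theta>$1 = 0")
  case False
  then show ?thesis
    using T \<theta> y not_critical[OF \<theta> n] score_stat_eq[OF \<theta> n] by (simp add: cont_extension_def)
next
  case True
  \<comment> \<open>A first coordinate of at most half of \<open>\<theta>$2\<close> keeps the point
    in the cone, because sqrt 3 / 2 < 1.\<close>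
  define x where "x m = \<theta> + (\<theta>$2 / 2 * inverse (real (Suc m))) *\<^sub>R axis 1 1" for m :: nat
  have pos: "0 < \<theta>$2" using \<theta> True by (simp add: param_space_def)
  have nth: "x m $ 1 = \<theta>$2 / 2 * inverse (real (Suc m))" "x m $ 2 = \<theta>$2" for m
    using True by (simp_all add: x_def axis_def)
  have x: "x m \<in> param_space" "x m $ 1 \<noteq> 0" for m
  proof -
    have "sqrt 3 * (\<theta>$2 / 2 * inverse (real (Suc m))) < 2 * (\<theta>$2 / 2 * 1)"
    proof (rule mult_less_le_imp_less)
      show "sqrt 3 < (2::real)" by (rule real_less_lsqrt) auto
      show "\<theta>$2 / 2 * inverse (real (Suc m)) \<le> \<theta>$2 / 2 * 1"
        using pos by (intro mult_left_mono) (auto simp: field_simps)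
    qed (use pos in auto)
    then show "x m \<in> param_space" using pos by (simp add: param_space_def nth)
    show "x m $ 1 \<noteq> 0" using pos by (simp add: nth)
  qed
  have "x \<longlonglongrightarrow> \<theta> + (\<theta>$2 / 2 * 0) *\<^sub>R axis 1 1"
    unfolding x_def[abs_def] by (intro tendsto_intros LIMSEQ_inverse_real_of_nat)
  then have lim: "(\<lambda>m. (x m, y)) \<longlonglongrightarrow> (\<theta>, y)" by (intro tendsto_Pair) auto
  have conv: "(\<lambda>m. F (x m) y) \<longlonglongrightarrow> F \<theta> y"
    if F: "continuous_on (param_space \<times> sample_quadrant n) (\<lambda>(\<theta>, y). F \<theta> y)" for F :: "real^2 \<Rightarrow> (nat \<Rightarrow> real^2) \<Rightarrow> real"
    using continuous_on_tendsto_compose[OF F lim] \<theta> y x by auto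
  have "(\<lambda>m. T (x m) y) \<longlonglongrightarrow> T \<theta> y" using T by (intro conv) (simp add: cont_extension_def)
  moreover have "T (x m) y = ext_stat n (x m) y" for m
    using T x(1)[of m] y not_critical[OF x(1) n x(2)] score_stat_eq[OF x(1) n] by (simp add: cont_extension_def)
  ultimately have "(\<lambda>m. ext_stat n (x m) y) \<longlonglongrightarrow> T \<theta> y" by simp
  then show ?thesis using conv[OF continuous_on_ext_stat[OF n]] LIMSEQ_unique by blast
qed

section \<open>Coverage along sequences of parameters and over compact sets\<close>

lemma nsc_third_moment:
  assumes \<theta>: "\<theta> \<in> param_space" and r: "rates r0 r1 \<theta>"
  shows "integrable (obs_law \<theta>) (\<lambda>y. \<bar>nsc \<theta> y $ j\<bar> ^ 3)"
    and "(\<integral>y. \<bar>nsc \<theta> y $ j\<bar> ^ 3 \<partial>obs_law \<theta>) \<le> (6 * (1 + 2 / r0)\<^sup>2) ^ 3 * r1\<^sup>2 * (\<integral>y. envelope r0 y \<partial>lborel)"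
proof -
  have b: "\<bar>\<bar>nsc \<theta> y $ j\<bar> ^ 3\<bar> \<le> (6 * (1 + 2 / r0)\<^sup>2) ^ 3 * (1 + ysum y) ^ 6" if "y \<in> quadrant" for y
    using nscore_power_bound[OF r ysum_nonneg[OF that], of 3 j] that by (simp add: nsc_def)
  show "integrable (obs_law \<theta>) (\<lambda>y. \<bar>nsc \<theta> y $ j\<bar> ^ 3)"
    and "(\<integral>y. \<bar>nsc \<theta> y $ j\<bar> ^ 3 \<partial>obs_law \<theta>) \<le> (6 * (1 + 2 / r0)\<^sup>2) ^ 3 * r1\<^sup>2 * (\<integral>y. envelope r0 y \<partial>lborel)"
    by (rule obs_law_integrable[OF \<theta> r _ _ b]; simp)+
qed

lemma compact_bound:
  fixes f :: "real^2 \<Rightarrow> real"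
  assumes "compact C" "continuous_on C f"
  shows "\<exists>K. \<forall>\<theta>\<in>C. \<bar>f \<theta>\<bar> \<le> K"
  using compact_imp_bounded[OF compact_continuous_image[OF assms(2,1)]] by (auto simp: bounded_iff)

text \<open>The sequence of parameters is arbitrary in \<open>C\<close>. The standardizing
  coefficients are continuous on \<open>C\<close>, since \<open>gram\<close> is positive definite up
  to the boundary, and therefore bounded; together with common rates this bounds the third moments
  in n.\<close>

lemma ext_stat_limit:
  assumes C: "compact C" "C \<subseteq> param_space" and \<theta>: "\<And>n. \<theta> n \<in> C" and q: "0 \<le> q"
  shows "(\<lambda>n. measure (sample_law n (\<theta> n)) {y \<in> space (sample_law n (\<theta> n)). ext_stat n (\<theta> n) y \<le> q}) \<longlonglongrightarrow> 1 - exp (- q / 2)"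
proof -
  have P: "t \<in> param_space" if "t \<in> C" for t using C that by auto
  have P\<theta>: "\<theta> n \<in> param_space" for n using \<theta> P by auto
  have cont: "continuous_on C (\<lambda>t. gram t $ i $ j)" for i j
    using continuous_on_gram C(2) by (rule continuous_on_subset)
  let ?D = "\<lambda>t. gram t $ 1 $ 1 * gram t $ 2 $ 2 - gram t $ 1 $ 2 * gram t $ 1 $ 2"
  \<comment> \<open>Cholesky factor of the inverse covariance: \<open>\<alpha> u\<^sub>1 + \<beta> u\<^sub>2\<close> and \<open>\<gamma> u\<^sub>2\<close> are uncorrelated with unit variance.\<close>
  define \<alpha> where "\<alpha> t = sqrt (gram t $ 2 $ 2 / ?D t)" for t
  define \<beta> where "\<beta> t = - (gram t $ 1 $ 2 / gram t $ 2 $ 2) * \<alpha> t" for t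
  define \<gamma> where "\<gamma> t = sqrt (1 / gram t $ 2 $ 2)" for t
  have nz: "\<forall>t\<in>C. gram t $ 2 $ 2 \<noteq> 0" "\<forall>t\<in>C. ?D t \<noteq> 0"
    using gram_det_pos[OF P] by (metis less_irrefl)+
  have "continuous_on C \<alpha>" unfolding \<alpha>_def using nz by (intro continuous_intros cont) auto
  moreover from this have "continuous_on C \<beta>" unfolding \<beta>_def using nz by (intro continuous_intros cont) auto
  moreover have "continuous_on C \<gamma>" unfolding \<gamma>_def using nz by (intro continuous_intros cont) auto
  ultimately obtain K1 K2 K3 where K123: "\<forall>t\<in>C. \<bar>\<alpha> t\<bar> \<le> K1" "\<forall>t\<in>C. \<bar>\<beta> t\<bar> \<le> K2" "\<forall>t\<in>C. \<bar>\<gamma> t\<bar> \<le> K3"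
    using compact_bound[OF C(1)] by metis
  define K where "K = max K1 (max K2 K3)"
  have K: "\<bar>\<alpha> t\<bar> \<le> K" "\<bar>\<beta> t\<bar> \<le> K" "\<bar>\<gamma> t\<bar> \<le> K" if "t \<in> C" for t
    using K123 that by (auto simp: K_def le_max_iff_disj)
  have "C \<subseteq> ext_space" using C(2) param_space_subset by blast
  with C(1) obtain r0 r1 where "0 < r0" and r: "\<And>t. t \<in> C \<Longrightarrow> rates r0 r1 t"
    by (rule rates_compact) blast
  define B where "B = (6 * (1 + 2 / r0)\<^sup>2) ^ 3 * r1\<^sup>2 * (\<integral>y. envelope r0 y \<partial>lborel)"
  note third = nsc_third_moment[OF P r, folded B_def]
  define X where "X n y = \<alpha> (\<theta> n) * nsc (\<theta> n) y $ 1 + \<beta> (\<theta> n) * nsc (\<theta> n) y $ 2" for n y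
  define Y where "Y n y = \<gamma> (\<theta> n) * nsc (\<theta> n) y $ 2" for n y
  have coeffs: "(\<alpha> t)\<^sup>2 = gram t $ 2 $ 2 / ?D t" "(\<gamma> t)\<^sup>2 = 1 / gram t $ 2 $ 2" if "t \<in> C" for t
    using gram_det_pos[OF P[OF that]] by (simp_all add: \<alpha>_def \<gamma>_def)
  have K0: "0 \<le> K" using K(1)[OF \<theta>[of 0]] by linarith
  have B0: "0 \<le> B"
    using third(2)[OF \<theta>[of 0] \<theta>[of 0], of 1] by (rule order_trans[rotated]) simp
  have X3: "\<bar>X n y\<bar> ^ 3 \<le> 4 * (K ^ 3 * \<bar>nsc (\<theta> n) y $ 1\<bar> ^ 3 + K ^ 3 * \<bar>nsc (\<theta> n) y $ 2\<bar> ^ 3)" for n y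
  proof -
    have "\<bar>X n y\<bar> ^ 3 \<le> 4 * (\<bar>\<alpha> (\<theta> n) * nsc (\<theta> n) y $ 1\<bar> ^ 3 + \<bar>\<beta> (\<theta> n) * nsc (\<theta> n) y $ 2\<bar> ^ 3)"
      unfolding X_def by (rule abs_add_power3_le)
    also have "\<dots> \<le> 4 * (K ^ 3 * \<bar>nsc (\<theta> n) y $ 1\<bar> ^ 3 + K ^ 3 * \<bar>nsc (\<theta> n) y $ 2\<bar> ^ 3)"
      unfolding abs_mult power_mult_distrib by (intro mult_left_mono add_mono mult_right_mono power_mono K \<theta>) auto
    finally show ?thesis .
  qed
  have Y3: "\<bar>Y n y\<bar> ^ 3 \<le> K ^ 3 * \<bar>nsc (\<theta> n) y $ 2\<bar> ^ 3" for n y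
    unfolding Y_def abs_mult power_mult_distrib by (intro mult_right_mono power_mono K \<theta>) auto
  have int3: "integrable (obs_law (\<theta> n)) (\<lambda>y. \<bar>nsc (\<theta> n) y $ j\<bar> ^ 3)" "(\<integral>y. \<bar>nsc (\<theta> n) y $ j\<bar> ^ 3 \<partial>obs_law (\<theta> n)) \<le> B" for n j
    by (rule third[OF \<theta> \<theta>])+
  \<comment> \<open>The constant is 4 (K^3 B + K^3 B), from cubing a sum of two terms with
    coefficients at most K.\<close>
  interpret standardized_pair "\<lambda>n. obs_law (\<theta> n)" X Y "8 * K ^ 3 * B"
  proof (rule standardized_pair.intro)
    fix n
    note hbi = nsc_moments[OF P\<theta>[of n]]
    let ?u = "\<lambda>j y. nsc (\<theta> n) y $ j" and ?g = "gram (\<theta> n)"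
    show "prob_space (obs_law (\<theta> n))" by (rule prob_space_obs_law[OF P\<theta>])
    show [measurable]: "X n \<in> borel_measurable (obs_law (\<theta> n))" "Y n \<in> borel_measurable (obs_law (\<theta> n))"
      unfolding X_def[abs_def] Y_def[abs_def] by measurable
    have i4: "integrable (obs_law (\<theta> n)) (\<lambda>y. 4 * (K ^ 3 * \<bar>?u 1 y\<bar> ^ 3 + K ^ 3 * \<bar>?u 2 y\<bar> ^ 3))"
      by (intro integrable_mult_right Bochner_Integration.integrable_add int3)
    show iX: "integrable (obs_law (\<theta> n)) (\<lambda>y. \<bar>X n y\<bar> ^ 3)"
      by (rule Bochner_Integration.integrable_bound[OF i4]) (auto intro!: AE_I2 order_trans[OF X3])
    have iY4: "integrable (obs_law (\<theta> n)) (\<lambda>y. K ^ 3 * \<bar>?u 2 y\<bar> ^ 3)"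
      by (intro integrable_mult_right int3)
    show iY: "integrable (obs_law (\<theta> n)) (\<lambda>y. \<bar>Y n y\<bar> ^ 3)"
      by (rule Bochner_Integration.integrable_bound[OF iY4]) (use K0 in \<open>auto intro!: AE_I2 order_trans[OF Y3]\<close>)
    have "(\<integral>y. \<bar>X n y\<bar> ^ 3 \<partial>obs_law (\<theta> n)) \<le> (\<integral>y. 4 * (K ^ 3 * \<bar>?u 1 y\<bar> ^ 3 + K ^ 3 * \<bar>?u 2 y\<bar> ^ 3) \<partial>obs_law (\<theta> n))"
      by (intro integral_mono iX i4 X3)
    also have "\<dots> = 4 * (K ^ 3 * (\<integral>y. \<bar>?u 1 y\<bar> ^ 3 \<partial>obs_law (\<theta> n)) + K ^ 3 * (\<integral>y. \<bar>?u 2 y\<bar> ^ 3 \<partial>obs_law (\<theta> n)))"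
      using int3(1)[of n] by simp
    also have "\<dots> \<le> 4 * (K ^ 3 * B + K ^ 3 * B)"
      using K0 by (intro mult_left_mono add_mono int3) auto
    finally show "(\<integral>y. \<bar>X n y\<bar> ^ 3 \<partial>obs_law (\<theta> n)) \<le> 8 * K ^ 3 * B" by (simp add: mult_ac)
    have "(\<integral>y. \<bar>Y n y\<bar> ^ 3 \<partial>obs_law (\<theta> n)) \<le> (\<integral>y. K ^ 3 * \<bar>?u 2 y\<bar> ^ 3 \<partial>obs_law (\<theta> n))"
      by (intro integral_mono iY iY4 Y3)
    also have "\<dots> = K ^ 3 * (\<integral>y. \<bar>?u 2 y\<bar> ^ 3 \<partial>obs_law (\<theta> n))" by simp
    also have "\<dots> \<le> K ^ 3 * B" using K0 by (intro mult_left_mono int3) auto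
    also have "\<dots> \<le> 8 * (K ^ 3 * B)" using K0 B0 by simp
    finally show "(\<integral>y. \<bar>Y n y\<bar> ^ 3 \<partial>obs_law (\<theta> n)) \<le> 8 * K ^ 3 * B" by (simp add: mult_ac)
    let ?\<alpha> = "\<alpha> (\<theta> n)" and ?\<beta> = "\<beta> (\<theta> n)" and ?\<gamma> = "\<gamma> (\<theta> n)"
    have "has_bochner_integral (obs_law (\<theta> n)) (\<lambda>y. ?\<alpha> * ?u 1 y + ?\<beta> * ?u 2 y) (?\<alpha> * 0 + ?\<beta> * 0)"
      by (intro has_bochner_integral_add has_bochner_integral_mult_right hbi)
    then show "(\<integral>y. X n y \<partial>obs_law (\<theta> n)) = 0" by (simp add: X_def has_bochner_integral_iff)
    have "has_bochner_integral (obs_law (\<theta> n)) (\<lambda>y. ?\<gamma> * ?u 2 y) (?\<gamma> * 0)"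
      by (intro has_bochner_integral_mult_right hbi)
    then show "(\<integral>y. Y n y \<partial>obs_law (\<theta> n)) = 0" by (simp add: Y_def has_bochner_integral_iff)
    note D = gram_det_pos[OF P\<theta>[of n]] and c = coeffs[OF \<theta>[of n]]
    have XX: "has_bochner_integral (obs_law (\<theta> n)) (\<lambda>y. ?\<alpha>\<^sup>2 * (?u 1 y * ?u 1 y) + 2 * ?\<alpha> * ?\<beta> * (?u 1 y * ?u 2 y) + ?\<beta>\<^sup>2 * (?u 2 y * ?u 2 y))
      (?\<alpha>\<^sup>2 * ?g$1$1 + 2 * ?\<alpha> * ?\<beta> * ?g$1$2 + ?\<beta>\<^sup>2 * ?g$2$2)"
      by (intro has_bochner_integral_add has_bochner_integral_mult_right hbi)
    have XX': "?\<alpha>\<^sup>2 * (?u 1 y * ?u 1 y) + 2 * ?\<alpha> * ?\<beta> * (?u 1 y * ?u 2 y) + ?\<beta>\<^sup>2 * (?u 2 y * ?u 2 y) = (X n y)\<^sup>2" for y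
      by (simp add: X_def power2_eq_square algebra_simps)
    have XX1: "?\<alpha>\<^sup>2 * ?g$1$1 + 2 * ?\<alpha> * ?\<beta> * ?g$1$2 + ?\<beta>\<^sup>2 * ?g$2$2 = 1"
    proof -
      have "?\<alpha>\<^sup>2 * ?g$1$1 + 2 * ?\<alpha> * ?\<beta> * ?g$1$2 + ?\<beta>\<^sup>2 * ?g$2$2 = ?\<alpha>\<^sup>2 * (?D (\<theta> n) / ?g$2$2)"
        using D(1) by (simp add: \<beta>_def field_simps power2_eq_square)
      then show ?thesis using D by (simp add: c)
    qed
    show "integrable (obs_law (\<theta> n)) (\<lambda>y. (X n y)\<^sup>2)" "(\<integral>y. (X n y)\<^sup>2 \<partial>obs_law (\<theta> n)) = 1"
      using XX unfolding XX' XX1 by (simp_all add: has_bochner_integral_iff)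
    have YY: "has_bochner_integral (obs_law (\<theta> n)) (\<lambda>y. ?\<gamma>\<^sup>2 * (?u 2 y * ?u 2 y)) (?\<gamma>\<^sup>2 * ?g$2$2)"
      by (intro has_bochner_integral_mult_right hbi)
    moreover have "?\<gamma>\<^sup>2 * (?u 2 y * ?u 2 y) = (Y n y)\<^sup>2" for y by (simp add: Y_def power2_eq_square)
    moreover have "?\<gamma>\<^sup>2 * ?g$2$2 = 1" using D by (simp add: c)
    ultimately show "integrable (obs_law (\<theta> n)) (\<lambda>y. (Y n y)\<^sup>2)" "(\<integral>y. (Y n y)\<^sup>2 \<partial>obs_law (\<theta> n)) = 1"
      by (simp_all add: has_bochner_integral_iff)
    have XY: "has_bochner_integral (obs_law (\<theta> n)) (\<lambda>y. ?\<alpha> * ?\<gamma> * (?u 1 y * ?u 2 y) + ?\<beta> * ?\<gamma> * (?u 2 y * ?u 2 y)) (?\<alpha> * ?\<gamma> * ?g$1$2 + ?\<beta> * ?\<gamma> * ?g$2$2)"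
      by (intro has_bochner_integral_add has_bochner_integral_mult_right hbi)
    have XY': "?\<alpha> * ?\<gamma> * (?u 1 y * ?u 2 y) + ?\<beta> * ?\<gamma> * (?u 2 y * ?u 2 y) = X n y * Y n y" for y
      by (simp add: X_def Y_def algebra_simps)
    have XY0: "?\<alpha> * ?\<gamma> * ?g$1$2 + ?\<beta> * ?\<gamma> * ?g$2$2 = 0"
      using D(1) by (simp add: \<beta>_def)
    show "(\<integral>y. X n y * Y n y \<partial>obs_law (\<theta> n)) = 0"
      using XY unfolding XY' XY0 by (simp add: has_bochner_integral_iff)
  qed
  have PR: "P n = sample_law n (\<theta> n)" for n by (simp add: P_def sample_law_def)
  have R: "R n y = ext_stat n (\<theta> n) y" if n: "1 \<le> n" for n y
  proof -
    define a b d where "a = gram (\<theta> n) $ 1 $ 1" and "b = gram (\<theta> n) $ 1 $ 2" and "d = gram (\<theta> n) $ 2 $ 2"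
    let ?s = "nsum n (\<theta> n) y $ 1" and ?t = "nsum n (\<theta> n) y $ 2"
    have D: "0 < d" "0 < a * d - b * b" using gram_det_pos[OF P\<theta>[of n]] by (simp_all add: a_def b_def d_def)
    have c: "(\<alpha> (\<theta> n))\<^sup>2 = d / (a * d - b * b)" "(\<gamma> (\<theta> n))\<^sup>2 = 1 / d" "\<beta> (\<theta> n) = - (b / d) * \<alpha> (\<theta> n)"
      using coeffs[OF \<theta>[of n]] by (simp_all add: a_def b_def d_def \<beta>_def)
    have "(\<Sum>i<n. X n (y i)) = \<alpha> (\<theta> n) * (?s - b / d * ?t)" "(\<Sum>i<n. Y n (y i)) = \<gamma> (\<theta> n) * ?t"
      by (simp_all add: X_def Y_def nsum_nth sum.distrib sum_subtractf sum_distrib_left c(3) algebra_simps)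
    then have "R n y = ((\<alpha> (\<theta> n))\<^sup>2 * (?s - b / d * ?t)\<^sup>2 + (\<gamma> (\<theta> n))\<^sup>2 * ?t\<^sup>2) / real n"
      by (simp add: R_def power_divide power_mult_distrib add_divide_distrib)
    \<comment> \<open>Completing the square in the first coordinate of the inverse quadratic
      form.\<close>
    also have "(\<alpha> (\<theta> n))\<^sup>2 * (?s - b / d * ?t)\<^sup>2 + (\<gamma> (\<theta> n))\<^sup>2 * ?t\<^sup>2 = (d * ?s\<^sup>2 - 2 * b * ?s * ?t + a * ?t\<^sup>2) / (a * d - b * b)"
    proof -
      have "d / E * (s - b / d * t)\<^sup>2 + 1 / d * t\<^sup>2 = (d * s\<^sup>2 - 2 * b * s * t + a * t\<^sup>2) / E"
        if "E = a * d - b * b" "E \<noteq> 0" for E s t :: real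
      proof -
        have "d * (s - b / d * t)\<^sup>2 = d * s\<^sup>2 - 2 * b * s * t + b * b / d * t\<^sup>2"
          using D(1) by (simp add: power2_eq_square field_simps)
        moreover have "1 / d * t\<^sup>2 = (E / d * t\<^sup>2) / E" using that(2) by simp
        moreover have "E / d = a - b * b / d" using D(1) that(1) by (simp add: field_simps)
        ultimately have "d / E * (s - b / d * t)\<^sup>2 + 1 / d * t\<^sup>2 = (d * s\<^sup>2 - 2 * b * s * t + b * b / d * t\<^sup>2 + (a - b * b / d) * t\<^sup>2) / E"
          by (simp add: add_divide_distrib)
        also have "d * s\<^sup>2 - 2 * b * s * t + b * b / d * t\<^sup>2 + (a - b * b / d) * t\<^sup>2 = d * s\<^sup>2 - 2 * b * s * t + a * t\<^sup>2"
          by (simp add: left_diff_distrib)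
        finally show ?thesis .
      qed
      then show ?thesis using D(2) unfolding c(1,2) by simp
    qed
    finally show ?thesis
      using ext_stat_eq[OF P\<theta> n, of n y] by (simp add: a_def b_def d_def mult.commute)
  qed
  have "(\<lambda>n. measure (P n) {\<omega> \<in> space (P n). R n \<omega> \<le> q}) \<longlonglongrightarrow> 1 - exp (- q / 2)"
    by (rule R_limit[OF q])
  then show ?thesis
  proof (rule Lim_transform_eventually)
    show "\<forall>\<^sub>F n in sequentially. measure (P n) {\<omega> \<in> space (P n). R n \<omega> \<le> q}
      = measure (sample_law n (\<theta> n)) {y \<in> space (sample_law n (\<theta> n)). ext_stat n (\<theta> n) y \<le> q}"
      using eventually_ge_at_top[of 1] by eventually_elim (simp add: R PR)
  qed
qed

lemma measurable_ext_stat: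
  "ext_stat n \<theta> \<in> borel_measurable (sample_law n t)"
proof -
  have [measurable]: "(\<lambda>y. nsum n \<theta> y $ j) \<in> borel_measurable (sample_law n t)" for j
  proof -
    have "(\<lambda>y. nsc \<theta> y $ j) \<in> borel_measurable (obs_law t)" by measurable
    then have "(\<lambda>y. nsc \<theta> (y i) $ j) \<in> borel_measurable (sample_law n t)" if "i < n" for i
      unfolding sample_law_def using that
      by (intro measurable_compose[OF measurable_component_singleton, of i]) auto
    then show ?thesis unfolding nsum_nth by (intro borel_measurable_sum) auto
  qed
  show ?thesis
    unfolding ext_stat_def[abs_def] inner_vec_def matrix_vector_mult_def by simp
qed

text \<open>On \<open>sample_quadrant\<close> every extension coincides with
  \<open>ext_stat\<close>, and the rest of the sample space is null.\<close>

lemma coverage_eq: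
  assumes n: "1 \<le> n" and T: "cont_extension n (sample_quadrant n) T" and \<theta>: "\<theta> \<in> param_space"
    and \<alpha>: "0 < \<alpha>" "\<alpha> < 1"
  shows "measure (sample_law n \<theta>) {y \<in> sample_quadrant n. \<theta> \<in> conf_region T \<alpha> y}
    = measure (sample_law n \<theta>) {y \<in> space (sample_law n \<theta>). ext_stat n \<theta> y \<le> - 2 * ln \<alpha>}"
proof -
  interpret prob_space "sample_law n \<theta>" by (rule prob_space_sample_law[OF \<theta>])
  have [measurable]: "ext_stat n \<theta> \<in> borel_measurable (sample_law n \<theta>)" by (rule measurable_ext_stat)
  have Q [measurable]: "sample_quadrant n \<in> sets (sample_law n \<theta>)"
    using full_measure_sample_quadrant[of n] \<theta> by (simp add: full_measure_def)
  have "{y \<in> sample_quadrant n. \<theta> \<in> conf_region T \<alpha> y} = sample_quadrant n \<inter> {y \<in> space (sample_law n \<theta>). ext_stat n \<theta> y \<le> - 2 * ln \<alpha>}"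
    using cont_extension_unique[OF n T \<theta>] \<theta> sets.sets_into_space[OF Q]
    by (auto simp: conf_region_def chi_square_2_quantile[OF \<alpha>])
  also have "measure (sample_law n \<theta>) \<dots> = measure (sample_law n \<theta>) {y \<in> space (sample_law n \<theta>). ext_stat n \<theta> y \<le> - 2 * ln \<alpha>}"
    using AE_sample_quadrant[OF \<theta>, of n] by (intro measure_eq_AE) (auto elim: eventually_mono)
  finally show ?thesis .
qed

text \<open>The infimum need not be attained, so near-minimizers with slack 1 / (n + 1) are chosen.
  Along them the values tend to \<open>L\<close>, and the infimum is squeezed between the value and
  the value minus the slack.\<close>

lemma tendsto_INF_of_sequences:
  fixes p :: "nat \<Rightarrow> 'a \<Rightarrow> real"
  assumes C: "C \<noteq> {}" and bdd: "\<And>n. bdd_below (p n ` C)"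
    and seq: "\<And>x. (\<And>n. x n \<in> C) \<Longrightarrow> (\<lambda>n. p n (x n)) \<longlonglongrightarrow> L"
  shows "(\<lambda>n. INF x\<in>C. p n x) \<longlonglongrightarrow> L"
proof -
  have "\<exists>x\<in>C. p n x < (INF x\<in>C. p n x) + inverse (real (Suc n))" for n
    using cINF_less_iff[OF C bdd, of n "(INF x\<in>C. p n x) + inverse (real (Suc n))"] by simp
  then obtain x where x: "\<And>n. x n \<in> C" "\<And>n. p n (x n) < (INF x\<in>C. p n x) + inverse (real (Suc n))" by metis
  have "(\<lambda>n. p n (x n) - inverse (real (Suc n))) \<longlonglongrightarrow> L - 0"
    by (intro tendsto_diff seq x LIMSEQ_inverse_real_of_nat)
  then have lower: "(\<lambda>n. p n (x n) - inverse (real (Suc n))) \<longlonglongrightarrow> L" by simp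
  have "p n (x n) - inverse (real (Suc n)) \<le> (INF x\<in>C. p n x)" for n using x(2)[of n] by linarith
  moreover have "(INF x\<in>C. p n x) \<le> p n (x n)" for n by (rule cINF_lower[OF bdd x(1)])
  ultimately show ?thesis
    by (intro tendsto_sandwich[OF _ _ lower seq[OF x(1)]] always_eventually allI)
qed

theorem theorem3p6:
  shows "(\<exists>K. \<forall>\<theta>\<in>param_space. \<forall>n\<ge>1. \<exists>k v. admissible (K \<theta>) n \<theta> k v) \<and>
    (\<exists>\<Y>.
      (\<forall>n\<ge>1. full_measure n (\<Y> n) \<and> (\<exists>T. cont_extension n (\<Y> n) T) \<and>
        (\<forall>T. cont_extension n (\<Y> n) T \<longrightarrow>
          (\<forall>\<theta>\<in>param_space. \<forall>K k v. admissible K n \<theta> k v \<longrightarrow>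
            (\<forall>y\<in>\<Y> n. T \<theta> y = mod_score_stat k v n \<theta> y)))) \<and>
      (\<forall>T. (\<forall>n\<ge>1. cont_extension n (\<Y> n) (T n)) \<longrightarrow>
        (\<forall>\<alpha>\<in>{0<..<1}. \<forall>C. C \<subseteq> param_space \<and> compact C \<and> C \<noteq> {} \<longrightarrow>
          (\<lambda>n. INF \<theta>\<in>C. measure (sample_law n \<theta>) {y \<in> \<Y> n. \<theta> \<in> conf_region (T n) \<alpha> y})
            \<longlonglongrightarrow> 1 - \<alpha>)))"
proof (rule conjI)
  show "\<exists>K. \<forall>\<theta>\<in>param_space. \<forall>n\<ge>1. \<exists>k v. admissible (K \<theta>) n \<theta> k v"
    \<comment> \<open>Order 2 serves all parameters and all sample sizes.\<close>
    using admissible_exists by (intro exI[of _ "\<lambda>_. 2"]) blast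
next
  show "\<exists>\<Y>.
      (\<forall>n\<ge>1. full_measure n (\<Y> n) \<and> (\<exists>T. cont_extension n (\<Y> n) T) \<and>
        (\<forall>T. cont_extension n (\<Y> n) T \<longrightarrow>
          (\<forall>\<theta>\<in>param_space. \<forall>K k v. admissible K n \<theta> k v \<longrightarrow>
            (\<forall>y\<in>\<Y> n. T \<theta> y = mod_score_stat k v n \<theta> y)))) \<and>
      (\<forall>T. (\<forall>n\<ge>1. cont_extension n (\<Y> n) (T n)) \<longrightarrow>
        (\<forall>\<alpha>\<in>{0<..<1}. \<forall>C. C \<subseteq> param_space \<and> compact C \<and> C \<noteq> {} \<longrightarrow>
          (\<lambda>n. INF \<theta>\<in>C. measure (sample_law n \<theta>) {y \<in> \<Y> n. \<theta> \<in> conf_region (T n) \<alpha> y})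
            \<longlonglongrightarrow> 1 - \<alpha>))"
  proof (rule exI[of _ sample_quadrant], intro conjI allI ballI impI)
  fix T :: "nat \<Rightarrow> real^2 \<Rightarrow> (nat \<Rightarrow> real^2) \<Rightarrow> real" and \<alpha> :: real and C :: "(real^2) set"
  assume T: "\<forall>n\<ge>1. cont_extension n (sample_quadrant n) (T n)" and \<alpha>: "\<alpha> \<in> {0<..<1}"
    and C: "C \<subseteq> param_space \<and> compact C \<and> C \<noteq> {}"
  show "(\<lambda>n. INF \<theta>\<in>C. measure (sample_law n \<theta>) {y \<in> sample_quadrant n. \<theta> \<in> conf_region (T n) \<alpha> y}) \<longlonglongrightarrow> 1 - \<alpha>"
  proof (rule tendsto_INF_of_sequences)
    show "C \<noteq> {}" using C by simp
    show "bdd_below ((\<lambda>\<theta>. measure (sample_law n \<theta>) {y \<in> sample_quadrant n. \<theta> \<in> conf_region (T n) \<alpha> y}) ` C)" for n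
      by (rule bdd_belowI2[of _ 0]) simp
    fix \<theta> assume \<theta>: "\<And>n::nat. \<theta> n \<in> C"
    \<comment> \<open>The threshold is the chi-square quantile, for which exp (- q / 2) equals
      \<alpha>.\<close>
    have "(\<lambda>n. measure (sample_law n (\<theta> n)) {y \<in> space (sample_law n (\<theta> n)). ext_stat n (\<theta> n) y \<le> - 2 * ln \<alpha>}) \<longlonglongrightarrow> 1 - exp (- (- 2 * ln \<alpha>) / 2)"
      by (rule ext_stat_limit[of C]) (use C \<theta> \<alpha> in auto)
    then have "(\<lambda>n. measure (sample_law n (\<theta> n)) {y \<in> space (sample_law n (\<theta> n)). ext_stat n (\<theta> n) y \<le> - 2 * ln \<alpha>}) \<longlonglongrightarrow> 1 - \<alpha>"
      using \<alpha> by simp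
    then show "(\<lambda>n. measure (sample_law n (\<theta> n)) {y \<in> sample_quadrant n. \<theta> n \<in> conf_region (T n) \<alpha> y}) \<longlonglongrightarrow> 1 - \<alpha>"
    proof (rule Lim_transform_eventually)
      show "\<forall>\<^sub>F n in sequentially. measure (sample_law n (\<theta> n)) {y \<in> space (sample_law n (\<theta> n)). ext_stat n (\<theta> n) y \<le> - 2 * ln \<alpha>}
        = measure (sample_law n (\<theta> n)) {y \<in> sample_quadrant n. \<theta> n \<in> conf_region (T n) \<alpha> y}"
        using eventually_ge_at_top[of 1]
      proof eventually_elim
        case (elim n)
        show ?case
          by (rule coverage_eq[symmetric]) (use elim T \<alpha> C \<theta> in auto)
      qed
    qed
  qed
  next
    show "full_measure n (sample_quadrant n)" for n
      by (rule full_measure_sample_quadrant)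
    show "\<exists>T. cont_extension n (sample_quadrant n) T" if "1 \<le> n" for n
      using cont_extension_ext_stat[OF that] by blast
    show "T \<theta> y = mod_score_stat k v n \<theta> y"
      if "1 \<le> n" "cont_extension n (sample_quadrant n) T" "\<theta> \<in> param_space" "admissible K n \<theta> k v" "y \<in> sample_quadrant n"
      for n T \<theta> K k v y
      using cont_extension_unique[OF that(1,2,3,5)] mod_score_stat_eq[OF that(3,1,4)] by simp
  qed
qed

end
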